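(* For every $g\ge2$ and all positive $k$, $\dim\mathrm{FM}^{(g)}_k\ll_g k^{\frac{g(g+1)}{2}}$, where the implied constant depends only on $g$.
   Context: $\mathrm{FM}^{(g)}_k=\mathrm{FM}^{(g,1)}_k$ is the space of scalar-valued symmetric formal Fourier–Jacobi series of genus $g$, cogenus $1$, weight $k$ and trivial type, defined as follows. Write $\tau\in\mathbb{H}_g$ as $\begin{pmatrix}\tau_1&z\\{}^tz&\tau_2\end{pmatrix}$ with $\tau_2\in\mathbb{H}_1$, $z\in\mathbb{C}^{g-1}$ (column). For integers $m\ge0$, $\mathrm{J}^{(g-1)}_{k,m}$ is the space of Jacobi forms of genus $g-1$, weight $k$ and index $m$: holomorphic $\phi(\tau_1,z)$ such that $\tau\mapsto\phi(\tau_1,z)e(m\tau_2)$ transforms like a genus $g$ Siegel modular form of weight $k$ under the embedded Jacobi group $\mathrm{Sp}_{2(g-1)}(\mathbb{Z})\ltimes(\mathbb{Z}^{g-1}\times\mathbb{Z}^{g-1})$, i.e. under $\begin{pmatrix}a&0&b&a\mu-b\lambda\\{}^t\lambda&1&{}^t\mu&0\\c&0&d&c\mu-d\lambda\\0&0&0&1\end{pmatrix}\in\mathrm{Sp}_{2g}(\mathbb{Z})$ (with holomorphy at the cusp if $g=2$); it has Fourier expansion $\phi=\sum c(\phi;n,r)e(n\tau_1+r\,{}^tz)$, $e(x)=\exp(2\pi i\,\mathrm{tr}\,x)$. A formal series $f=\sum_{m\ge0}\phi_m(\tau_1,z)e(m\tau_2)$ with $\phi_m\in\mathrm{J}^{(g-1)}_{k,m}$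 (no convergence assumed) has coefficients $c(f;t)=c(\phi_m;n,r)$ for $t=\begin{pmatrix}n&\frac12r\\\frac12{}^tr&m\end{pmatrix}$, and is symmetric if $c(f;t)=\det(u)^k c(f;{}^tu\,t\,u)$ for all $t\ge0$ and $u\in\mathrm{GL}_g(\mathbb{Z})$. *)

theory Defs
  imports "HOL-Analysis.Analysis" "HOL-Library.Function_Algebras"
begin

section \<open>Block matrices\<close>

text \<open>
  The genus is carried by the index type: Siegel genus \<open>g - 1\<close> corresponds to a finite type \<open>'n\<close>
  with \<open>g - 1\<close> elements, and genus \<open>g\<close> to the disjoint sum \<open>'n + 1\<close>. Column vectors of length
  \<open>g - 1\<close> are matrices with one column, indexed by the one-element type \<open>1\<close>.
\<close>

definition block ::
  "'a^'n^'m \<Rightarrow> 'a^'p^'m \<Rightarrow> 'a^'n^'q \<Rightarrow> 'a^'p^'q \<Rightarrow> 'a^('n::finite + 'p::finite)^('m::finite + 'q::finite)" where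
  "block A B C D = (\<chi> i j. case i of
      Inl a \<Rightarrow> (case j of Inl b \<Rightarrow> A $ a $ b | Inr b \<Rightarrow> B $ a $ b)
    | Inr a \<Rightarrow> (case j of Inl b \<Rightarrow> C $ a $ b | Inr b \<Rightarrow> D $ a $ b))"

definition upper_left :: "'a^('n::finite + 'p::finite)^('m::finite + 'q::finite) \<Rightarrow> 'a^'n^'m" where
  "upper_left M = (\<chi> i j. M $ Inl i $ Inl j)"

definition upper_right :: "'a^('n::finite + 'p::finite)^('m::finite + 'q::finite) \<Rightarrow> 'a^'p^'m" where
  "upper_right M = (\<chi> i j. M $ Inl i $ Inr j)"

definition lower_left :: "'a^('n::finite + 'p::finite)^('m::finite + 'q::finite) \<Rightarrow> 'a^'n^'q" where
  "lower_left M = (\<chi> i j. M $ Inr i $ Inl j)"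

definition lower_right :: "'a^('n::finite + 'p::finite)^('m::finite + 'q::finite) \<Rightarrow> 'a^'p^'q" where
  "lower_right M = (\<chi> i j. M $ Inr i $ Inr j)"


section \<open>Siegel upper half space and integral symplectic group\<close>

definition pos_def :: "real^'n^'n \<Rightarrow> bool" where
  "pos_def Y \<longleftrightarrow> transpose Y = Y \<and> (\<forall>v. v \<noteq> 0 \<longrightarrow> v \<bullet> (Y *v v) > 0)"

definition pos_semidef :: "real^'n^'n \<Rightarrow> bool" where
  "pos_semidef Y \<longleftrightarrow> transpose Y = Y \<and> (\<forall>v. v \<bullet> (Y *v v) \<ge> 0)"

definition siegel :: "(complex^'n^'n) set" where
  "siegel = {\<tau>. transpose \<tau> = \<tau> \<and> pos_def (map_matrix Im \<tau>)}"

definition Sp_int :: "(int^('n::finite + 'n)^('n + 'n)) set" where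
  "Sp_int = (let J = block 0 (mat 1) (- mat 1) 0 in {M. transpose M ** J ** M = J})"

definition automorphy :: "int^('n::finite + 'n)^('n + 'n) \<Rightarrow> complex^'n^'n \<Rightarrow> complex^'n^'n" where
  "automorphy M \<tau> =
     map_matrix of_int (lower_left M) ** \<tau> + map_matrix of_int (lower_right M)"

definition siegel_action :: "int^('n::finite + 'n)^('n + 'n) \<Rightarrow> complex^'n^'n \<Rightarrow> complex^'n^'n" where
  "siegel_action M \<tau> =
     (map_matrix of_int (upper_left M) ** \<tau> + map_matrix of_int (upper_right M))
       ** matrix_inv (automorphy M \<tau>)"


section \<open>Jacobi forms of genus \<open>CARD('n)\<close>\<close>

definition e_tr :: "complex^'n^'n \<Rightarrow> complex" where
  "e_tr X = exp (2 * of_real pi * \<i> * trace X)"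

text \<open>
  The embedding of the Jacobi group into genus \<open>g\<close>; \<open>l\<close> is the vector usually called \<open>\<lambda>\<close>, which is
  reserved syntax here.
\<close>

definition jacobi_matrix ::
  "int^('n::finite + 'n)^('n + 'n) \<Rightarrow> int^1^'n \<Rightarrow> int^1^'n \<Rightarrow> int^(('n + 1) + ('n + 1))^(('n + 1) + ('n + 1))"
  where
  "jacobi_matrix M l \<mu> =
     (let a = upper_left M; b = upper_right M; c = lower_left M; d = lower_right M
      in block (block a 0 (transpose l) (mat 1)) (block b (a ** \<mu> - b ** l) (transpose \<mu>) 0)
               (block c 0 0 0)                   (block d (c ** \<mu> - d ** l) 0 (mat 1)))"

text \<open>
  A function of \<open>(\<tau>\<^sub>1, z)\<close> is a total HOL function on pairs of matrices, normalised to vanish off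
  the domain \<open>jacobi_domain\<close>, so that it is determined by its restriction to that domain.
\<close>

type_synonym 'n jacobi_fun = "(complex^'n^'n) \<times> (complex^1^'n) \<Rightarrow> complex"

definition jacobi_domain :: "((complex^'n^'n) \<times> (complex^1^'n)) set" where
  "jacobi_domain = siegel \<times> UNIV"

text \<open>
  Holomorphy in several variables: complex differentiability at every point. The derivative is
  taken within the domain, because \<open>siegel\<close> is open only in the space of symmetric matrices.
\<close>

definition jacobi_holomorphic :: "('n::finite) jacobi_fun \<Rightarrow> bool" where
  "jacobi_holomorphic \<phi> \<longleftrightarrow>
     (\<forall>x \<in> jacobi_domain. \<exists>\<phi>'. (\<phi> has_derivative \<phi>') (at x within jacobi_domain) \<and>
        (\<forall>c A w. \<phi>' (map_matrix ((*) c) A, map_matrix ((*) c) w) = c * \<phi>' (A, w)))"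

text \<open>The function \<open>\<tau> \<mapsto> \<phi>(\<tau>\<^sub>1, z) e(m \<tau>\<^sub>2)\<close> of genus \<open>g\<close>.\<close>

definition jacobi_lift :: "nat \<Rightarrow> ('n::finite) jacobi_fun \<Rightarrow> complex^('n + 1)^('n + 1) \<Rightarrow> complex" where
  "jacobi_lift m \<phi> \<tau> =
     \<phi> (upper_left \<tau>, upper_right \<tau>) * e_tr (real m *\<^sub>R lower_right \<tau>)"

definition half_integral :: "real^'n^'n \<Rightarrow> bool" where
  "half_integral t \<longleftrightarrow> transpose t = t \<and> (\<forall>i. t $ i $ i \<in> \<int>) \<and> (\<forall>i j. 2 * t $ i $ j \<in> \<int>)"

definition fourier_indices :: "((real^'n^'n) \<times> (real^1^'n)) set" where
  "fourier_indices = {(n, r). half_integral n \<and> (\<forall>i j. r $ i $ j \<in> \<int>)}"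

definition has_fourier_expansion ::
  "('n::finite) jacobi_fun \<Rightarrow> ((real^'n^'n) \<times> (real^1^'n) \<Rightarrow> complex) \<Rightarrow> bool" where
  "has_fourier_expansion \<phi> c \<longleftrightarrow>
     (\<forall>x. x \<notin> fourier_indices \<longrightarrow> c x = 0) \<and>
     (\<forall>(\<tau>, z) \<in> jacobi_domain.
        ((\<lambda>(n, r). c (n, r) *
            e_tr (map_matrix of_real n ** \<tau> + map_matrix of_real r ** transpose z))
          has_sum \<phi> (\<tau>, z)) fourier_indices)"

text \<open>
  Holomorphic functions satisfying the Jacobi transformation laws have exactly one Fourier
  expansion, so that the description below picks out its coefficients.
\<close>

definition fourier_coeff :: "('n::finite) jacobi_fun \<Rightarrow> (real^'n^'n) \<times> (real^1^'n) \<Rightarrow> complex" where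
  "fourier_coeff \<phi> = (THE c. has_fourier_expansion \<phi> c)"

text \<open>The Fourier index \<open>t\<close> of genus \<open>g\<close> with blocks \<open>n\<close>, \<open>r / 2\<close> and \<open>m\<close>.\<close>

definition index_matrix :: "real^('n::finite)^'n \<Rightarrow> real^1^'n \<Rightarrow> nat \<Rightarrow> real^('n + 1)^('n + 1)" where
  "index_matrix n r m =
     block n ((1 / 2) *\<^sub>R r) ((1 / 2) *\<^sub>R transpose r) (mat (real m))"

text \<open>
  Holomorphy at the cusp is imposed only for Jacobi forms of genus 1; in higher genus it is
  automatic by the Koecher principle.
\<close>

definition jacobi_forms :: "nat \<Rightarrow> nat \<Rightarrow> (('n::finite) jacobi_fun) set" where
  "jacobi_forms k m = {\<phi>.
     (\<forall>x. x \<notin> jacobi_domain \<longrightarrow> \<phi> x = 0) \<and>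
     jacobi_holomorphic \<phi> \<and>
     (\<forall>M \<in> Sp_int. \<forall>l \<mu>. \<forall>\<tau> \<in> siegel.
        jacobi_lift m \<phi> (siegel_action (jacobi_matrix M l \<mu>) \<tau>) =
          det (automorphy (jacobi_matrix M l \<mu>) \<tau>) ^ k * jacobi_lift m \<phi> \<tau>) \<and>
     (CARD('n) = 1 \<longrightarrow>
        (\<forall>(n, r) \<in> fourier_indices.
           fourier_coeff \<phi> (n, r) \<noteq> 0 \<longrightarrow> pos_semidef (index_matrix n r m)))}"


section \<open>Symmetric formal Fourier--Jacobi series of cogenus 1\<close>

text \<open>A formal series \<open>\<Sum>m. \<phi>\<^sub>m e(m \<tau>\<^sub>2)\<close> is the sequence of its coefficients \<open>\<phi>\<^sub>m\<close>.\<close>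

type_synonym 'n formal_series = "nat \<Rightarrow> 'n jacobi_fun"

definition fj_coeff :: "('n::finite) formal_series \<Rightarrow> real^('n + 1)^('n + 1) \<Rightarrow> complex" where
  "fj_coeff f t =
     fourier_coeff (f (nat \<lfloor>lower_right t $ 1 $ 1\<rfloor>)) (upper_left t, 2 *\<^sub>R upper_right t)"

definition fj_symmetric :: "nat \<Rightarrow> ('n::finite) formal_series \<Rightarrow> bool" where
  "fj_symmetric k f \<longleftrightarrow>
     (\<forall>t (u :: int^('n + 1)^('n + 1)). half_integral t \<longrightarrow> pos_semidef t \<longrightarrow> invertible u \<longrightarrow>
        fj_coeff f t =
          of_int (det u) ^ k *
          fj_coeff f (transpose (map_matrix of_int u) ** t ** map_matrix of_int u))"

definition FM :: "nat \<Rightarrow> (('n::finite) formal_series) set" where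
  "FM k = {f. (\<forall>m. f m \<in> jacobi_forms k m) \<and> fj_symmetric k f}"

definition fj_scale :: "complex \<Rightarrow> ('n::finite) formal_series \<Rightarrow> 'n formal_series" where
  "fj_scale c f = (\<lambda>m x. c * f m x)"

global_interpretation fj: vector_space fj_scale
  by unfold_locales (auto simp: fj_scale_def fun_eq_iff algebra_simps)

end

theory Submission
  imports Defs "HOL-Complex_Analysis.Complex_Analysis"
begin

text \<open>
  Let \<open>f\<close> be a nonzero symmetric formal series and \<open>t\<close> an index in its support. Fix a diagonal position
  \<open>j\<close> of \<open>\<tau>\<^sub>1\<close> and collect the coefficients whose indices agree with \<open>t\<close> away from row and column \<open>j\<close>:
  this is a Jacobi form of genus 1 with matrix index, for which the maximum argument of the reduction
  theory of the modular group shows that some index \<open>s\<close> of the collection satisfies \<open>s[x] < k\<close> for a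
  real vector \<open>x\<close> with \<open>x j = 1\<close>. Since the support is stable under unimodular substitutions, we can
  take \<open>t\<close> minimal for the lexicographic order of its diagonal and \<open>j\<close> the last position; Dirichlet
  approximation of \<open>x\<close> then bounds all diagonal entries of \<open>t\<close> by a constant multiple of \<open>k\<close>. So \<open>f\<close> is
  determined by its coefficients at the \<open>O(k\<^bsup>g(g+1)/2\<^esup>)\<close> semidefinite indices with diagonal of size \<open>O(k)\<close>.
\<close>

text \<open>The series need not converge, so there is no function on the half space of genus g to
  work with: only the single coefficients \<open>f m\<close> are functions, and each knows the
  Jacobi group alone. That group still contains a copy of SL(2,Z) at every diagonal position of the
  first block, and the shears belonging to it. Both commute with translations of the entries outside
  row and column \<open>j\<close>, so their laws pass to the partial Fourier sum over one block of
  indices. The bound \<open>k\<close> comes from a contraction: if all values were at least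
  \<open>k\<close>, lowering a height \<open>v \<ge> 1/2\<close> by 1/4 would cost at most sqrt 2
  and gain exp(- pi / 2) per unit of weight, and the supremum of an invariant norm would be at most
  half of itself. The short value occurs at an index \<open>t1\<close> of the block, not at
  \<open>t\<close>. This does no harm: both agree outside row and column \<open>j\<close>, and the
  approximation of \<open>x\<close> is exact at \<open>j\<close>, so the one uncontrolled diagonal
  entry of \<open>t1\<close> is multiplied by zero. Coefficients are given by a definite
  description, so existence and uniqueness of Fourier expansions have to be proved as well.\<close>

no_notation fps_nth (infixl \<open>$\<close> 75)

section \<open>Fourier coefficients on a horizontal strip\<close>

definition ee :: "complex \<Rightarrow> complex" where
  "ee z = exp (2 * of_real pi * \<i> * z)"

lemma ee_add: "ee (a + b) = ee a * ee b"
  by (simp add: ee_def exp_add distrib_left)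

lemma ee_0 [simp]: "ee 0 = 1"
  by (simp add: ee_def)

lemma ee_minus: "ee (- a) = inverse (ee a)"
  by (simp add: ee_def exp_minus)

lemma ee_nonzero [simp]: "ee a \<noteq> 0"
  by (simp add: ee_def)

lemma ee_of_int [simp]: "ee (of_int n) = 1"
  unfolding ee_def using exp_integer_2pi[of "of_int n"] by (simp add: mult.commute mult.left_commute)

lemma ee_eq_1: "ee z = 1 \<longleftrightarrow> (\<exists>n::int. z = of_int n)"
proof
  assume "ee z = 1"
  then obtain n :: int where "Re (2 * of_real pi * \<i> * z) = 0" "Im (2 * of_real pi * \<i> * z) = of_int (2 * n) * pi"
    unfolding ee_def exp_eq_1 by auto
  then have "z = of_int n" by (auto simp: complex_eq_iff)
  then show "\<exists>n::int. z = of_int n" ..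
qed auto

lemma ee_power: "ee z ^ n = ee (of_nat n * z)"
  by (simp add: ee_def exp_of_nat_mult [symmetric] algebra_simps)

lemma norm_ee: "norm (ee z) = exp (- (2 * pi * Im z))"
  by (simp add: ee_def)

lemma holomorphic_ee [holomorphic_intros]:
  "f holomorphic_on S \<Longrightarrow> (\<lambda>z. ee (f z)) holomorphic_on S"
  unfolding ee_def by (intro holomorphic_intros)

lemma continuous_on_ee [continuous_intros]:
  "continuous_on S f \<Longrightarrow> continuous_on S (\<lambda>z. ee (f z))"
  unfolding ee_def by (intro continuous_intros)

lemma abs_summable_geometric_int:
  assumes "0 < (r::real)" "r < 1"
  shows "(\<lambda>n::int. r ^ nat \<bar>n\<bar>) summable_on UNIV"
proof -
  have g: "(\<lambda>n::nat. r ^ n) summable_on UNIV"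
    by (rule norm_summable_imp_summable_on) (use assms in \<open>auto simp: power_abs intro: summable_geometric\<close>)
  have 1: "(\<lambda>n::int. r ^ nat \<bar>n\<bar>) summable_on (int ` UNIV)"
    by (subst summable_on_reindex) (use g in \<open>auto simp: o_def inj_on_def\<close>)
  have 2: "(\<lambda>n::int. r ^ nat \<bar>n\<bar>) summable_on ((\<lambda>n. - int n) ` UNIV)"
    by (subst summable_on_reindex) (use g in \<open>auto simp: o_def inj_on_def\<close>)
  have "UNIV = range int \<union> range (\<lambda>n. - int n)"
  proof -
    have "x \<in> range int \<union> range (\<lambda>n. - int n)" for x :: int
      by (cases x rule: int_cases2) auto
    then show ?thesis by blast
  qed
  then show ?thesis using summable_on_union[OF 1 2] by simp
qed

text \<open>The phase uses only the offset \<open>s\<close>, not the point \<open>z + s\<close>, so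
  this is the whole n-th term of the Fourier series at \<open>z\<close>, with the character
  \<open>ee (n z)\<close> included. Terms, unlike coefficients, are again functions of the point and
  can be expanded further.\<close>

definition fourier_int :: "(complex \<Rightarrow> complex) \<Rightarrow> int \<Rightarrow> complex \<Rightarrow> complex" where
  "fourier_int g n z = integral {0..1} (\<lambda>s. g (z + of_real s) * ee (- (of_int n * of_real s)))"

text \<open>No width is fixed and no boundary is named: the sets needed later are intersections of
  the Siegel half space with complex lines, of which only openness, convexity and stability under
  real translation are used.\<close>

locale periodic_strip =
  fixes S :: "complex set" and g :: "complex \<Rightarrow> complex"
  assumes open_S: "open S" and convex_S: "convex S"
    and real_shift: "z \<in> S \<Longrightarrow> z + of_real r \<in> S"
    and holo: "g holomorphic_on S"
    and periodic: "z \<in> S \<Longrightarrow> g (z + 1) = g z"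
begin

lemma periodic_int: "z \<in> S \<Longrightarrow> g (z + of_int n) = g z"
proof -
  have nat: "g (z + of_nat m) = g z" if "z \<in> S" for z m
    using that
  proof (induction m)
    case (Suc m)
    have "z + of_nat m \<in> S" using real_shift[OF Suc.prems, of "of_nat m"] by simp
    from periodic[OF this] show ?case using Suc by (simp add: add_ac)
  qed simp
  assume z: "z \<in> S"
  show ?thesis
  proof (cases n rule: int_cases2)
    case (nonneg m) then show ?thesis using nat[OF z] by simp
  next
    case (nonpos m)
    have "z - of_nat m \<in> S" using real_shift[OF z, of "- of_nat m"] by simp
    from nat[OF this, of m] nonpos show ?thesis by simp
  qed
qed

text \<open>A primitive \<open>H\<close> of \<open>g x * ee (- n x)\<close> exists on the convex
  set, and \<open>H (x + 1) - H x\<close> has derivative 0 by periodicity. This constant is the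
  Fourier coefficient, so the contour is shifted without any rectangle.\<close>

lemma fourier_int_shift:
  assumes z: "z \<in> S" and zw: "z + w \<in> S"
  shows "fourier_int g n (z + w) = ee (of_int n * w) * fourier_int g n z"
proof -
  define G where "G = (\<lambda>x. g x * ee (- (of_int n * x)))"
  have G: "G holomorphic_on S"
    unfolding G_def by (intro holomorphic_intros holo)
  obtain H where H: "\<And>x. x \<in> S \<Longrightarrow> (H has_field_derivative G x) (at x)"
    using holomorphic_convex_primitive'[OF convex_S open_S G] open_S by (metis at_within_open)
  have I: "((\<lambda>s. G (x + of_real s)) has_integral H (x + 1) - H x) {0..1}" if x: "x \<in> S" for x
  proof -
    have "((\<lambda>s. H (x + of_real s)) has_vector_derivative G (x + of_real s)) (at s within {0..1})" for s
    proof -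
      have "((\<lambda>y. H (x + y)) has_field_derivative G (x + of_real s)) (at (of_real s))"
        using H[OF real_shift[OF x, of s]] DERIV_shift[of H "G (x + of_real s)" "of_real s" x]
        by (simp add: add.commute)
      from has_vector_derivative_real_field[OF this] show ?thesis .
    qed
    from fundamental_theorem_of_calculus[OF _ this] show ?thesis by simp
  qed
  have "((\<lambda>x. H (x + 1) - H x) has_field_derivative 0) (at x within S)" if x: "x \<in> S" for x
  proof -
    have x1: "x + 1 \<in> S" using real_shift[OF x, of 1] by simp
    have "((\<lambda>x. H (x + 1) - H x) has_field_derivative G (x + 1) - G x) (at x)"
      by (intro derivative_intros H x) (use H[OF x1] in \<open>simp add: DERIV_shift\<close>)
    moreover have "G (x + 1) = G x"
    proof -
      have "ee (- (of_int n * (x + 1))) = ee (- (of_int n * x)) * ee (of_int (- n))"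
        by (simp only: ee_add[symmetric]) (simp add: algebra_simps)
      then show ?thesis using periodic[OF x] by (simp add: G_def del: of_int_minus)
    qed
    ultimately show ?thesis by (simp add: has_field_derivative_at_within)
  qed
  then obtain c where c: "\<And>x. x \<in> S \<Longrightarrow> H (x + 1) - H x = c"
    using has_field_derivative_zero_constant[OF convex_S, of "\<lambda>x. H (x + 1) - H x"] by blast
  have F: "fourier_int g n x = ee (of_int n * x) * c" if x: "x \<in> S" for x
  proof -
    have "fourier_int g n x = integral {0..1} (\<lambda>s. ee (of_int n * x) * G (x + of_real s))"
    proof -
      have "ee (- (of_int n * of_real s)) = ee (of_int n * x) * ee (- (of_int n * (x + of_real s)))" for s
        by (simp only: ee_add[symmetric]) (simp add: algebra_simps)
      then show ?thesis unfolding fourier_int_def G_def by (simp add: mult_ac)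
    qed
    also have "\<dots> = ee (of_int n * x) * integral {0..1} (\<lambda>s. G (x + of_real s))"
      by (rule integral_mult_right)
    finally show ?thesis using I[OF x] c[OF x] by (simp add: integral_unique)
  qed
  show ?thesis using F[OF z] F[OF zw] by (simp add: distrib_left ee_add)
qed

text \<open>The segment is moved vertically by \<open>d\<close> in the direction in which the n-th
  character grows, downwards for \<open>n \<ge> 0\<close> and upwards otherwise. The trivial bound
  there, transported back by \<open>fourier_int_shift\<close>, gains the geometric factor.\<close>

lemma fourier_int_bound:
  assumes z: "z \<in> S" and zp: "z + \<i> * of_real d \<in> S" and zm: "z - \<i> * of_real d \<in> S"
    and "d \<ge> 0"
    and C: "\<And>s. s \<in> {0..1} \<Longrightarrow> norm (g (z + \<i> * of_real d + of_real s)) \<le> C"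
           "\<And>s. s \<in> {0..1} \<Longrightarrow> norm (g (z - \<i> * of_real d + of_real s)) \<le> C"
  shows "norm (fourier_int g n z) \<le> C * exp (- (2 * pi * d)) ^ nat \<bar>n\<bar>"
proof -
  define w where "w = (if n \<ge> 0 then - (\<i> * of_real d) else \<i> * of_real d)"
  have zw: "z + w \<in> S" and Cw: "\<And>s. s \<in> {0..1} \<Longrightarrow> norm (g (z + w + of_real s)) \<le> C"
    using assms by (auto simp: w_def)
  have "C \<ge> 0" using order_trans[OF norm_ge_zero Cw[of 0]] by simp
  have cont: "continuous_on {0..1} (\<lambda>s. g (z + w + of_real s) * ee (- (of_int n * of_real s)))"
    by (intro continuous_intros continuous_on_compose2[OF holomorphic_on_imp_continuous_on[OF holo]])
      (use real_shift[OF zw] in auto)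
  have "norm (fourier_int g n (z + w)) \<le> C * (1 - 0)"
    unfolding fourier_int_def
    by (rule integral_bound[OF _ cont]) (use Cw in \<open>auto simp: norm_mult norm_ee\<close>)
  moreover have "fourier_int g n z = ee (- (of_int n * w)) * fourier_int g n (z + w)"
    by (simp add: fourier_int_shift[OF z zw] ee_minus)
  moreover have "norm (ee (- (of_int n * w))) = exp (- (2 * pi * d)) ^ nat \<bar>n\<bar>"
    unfolding norm_ee exp_of_nat_mult[symmetric] by (auto simp: w_def)
  ultimately show ?thesis by (simp add: norm_mult mult.commute mult_left_mono)
qed

lemma fourier_int_decay:
  assumes z: "z \<in> S"
  obtains C r where "0 < r" "r < 1" "\<And>n. norm (fourier_int g n z) \<le> C * r ^ nat \<bar>n\<bar>"
proof -
  obtain e where e: "e > 0" "ball z e \<subseteq> S" using open_S z openE by blast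
  define d where "d = e / 2"
  have d: "d > 0" using e by (simp add: d_def)
  have zpm: "z + \<i> * of_real d \<in> S" "z - \<i> * of_real d \<in> S"
    using e by (auto simp: d_def dist_norm norm_mult subset_iff)
  have ex: "\<exists>C. \<forall>s\<in>{0..1::real}. norm (g (x + of_real s)) \<le> C" if "x \<in> S" for x
  proof -
    have "continuous_on {0..1} (\<lambda>s. g (x + of_real s))"
      by (intro continuous_intros continuous_on_compose2[OF holomorphic_on_imp_continuous_on[OF holo]])
        (use real_shift[OF that] in auto)
    then have "compact ((\<lambda>s. g (x + of_real s)) ` {0..1})"
      by (rule compact_continuous_image) auto
    then show ?thesis using compact_imp_bounded bounded_iff by (metis imageI)
  qed
  obtain C1 where C1: "\<And>s. s \<in> {0..1} \<Longrightarrow> norm (g (z + \<i> * of_real d + of_real s)) \<le> C1" using ex[OF zpm(1)] by blast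
  obtain C2 where C2: "\<And>s. s \<in> {0..1} \<Longrightarrow> norm (g (z - \<i> * of_real d + of_real s)) \<le> C2" using ex[OF zpm(2)] by blast
  have "norm (fourier_int g n z) \<le> max C1 C2 * exp (- (2 * pi * d)) ^ nat \<bar>n\<bar>" for n
    by (rule fourier_int_bound[OF z zpm]) (use d C1 C2 in \<open>auto simp: max.coboundedI1 max.coboundedI2\<close>)
  then show ?thesis using that[of "exp (- (2 * pi * d))" "max C1 C2"] d by auto
qed

lemma fourier_int_summable:
  assumes "z \<in> S" shows "(\<lambda>n. fourier_int g n z) summable_on UNIV"
proof -
  obtain C r where r: "0 < r" "r < 1" "\<And>n. norm (fourier_int g n z) \<le> C * r ^ nat \<bar>n\<bar>"
    using fourier_int_decay[OF assms] by blast
  have "(\<lambda>n. C * r ^ nat \<bar>n\<bar>) summable_on UNIV"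
    by (intro summable_on_cmult_right abs_summable_geometric_int r)
  then have "(\<lambda>n. norm (fourier_int g n z)) summable_on UNIV"
    by (rule summable_on_comparison_test) (use r in auto)
  then show ?thesis by (rule abs_summable_summable)
qed

lemma integrable_shift:
  assumes "z \<in> S"
  shows "(\<lambda>s. g (z + of_real s) * ee (- (of_int n * of_real s))) integrable_on {0..1}"
  by (intro integrable_continuous_interval continuous_intros
      continuous_on_compose2[OF holomorphic_on_imp_continuous_on[OF holo]])
    (use real_shift[OF assms] in auto)

end

lemma integral_ee_int:
  "integral {0..1} (\<lambda>s. ee (of_int n * of_real s)) = (if n = 0 then 1 else 0)"
proof (cases "n = 0")
  case False
  define k :: complex where "k = 2 * of_real pi * \<i> * of_int n"
  have k: "k \<noteq> 0" using False by (simp add: k_def)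
  have "((\<lambda>s. ee (of_int n * of_real s) / k) has_vector_derivative ee (of_int n * of_real s)) (at s within {0..1})" for s
  proof -
    have "((\<lambda>s. exp (k * s) / k) has_field_derivative exp (k * of_real s)) (at (of_real s))"
      using k by (auto intro!: derivative_eq_intros)
    from has_vector_derivative_real_field[OF this] show ?thesis
      by (simp add: ee_def k_def mult.assoc)
  qed
  from fundamental_theorem_of_calculus[OF _ this]
  have "((\<lambda>s. ee (of_int n * of_real s)) has_integral ee (of_int n * of_real 1) / k - ee (of_int n * of_real 0) / k) {0..1}"
    by simp
  then show ?thesis using False by (simp add: integral_unique)
qed simp

text \<open>Dividing \<open>g - g z\<close> by \<open>ee (w - z) - 1\<close> makes the Fourier coefficients telescope.\<close>

theorem (in periodic_strip) fourier_int_has_sum: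
  assumes z: "z \<in> S"
  shows "((\<lambda>n. fourier_int g n z) has_sum g z) UNIV"
proof -
  \<comment> \<open>The points with \<open>ee (w - z) = 1\<close> are the integer translates of
    \<open>z\<close>. There the quotient is filled in by its limit, the quotient of the derivatives
    of numerator and denominator.\<close>
  define h where "h = (\<lambda>w. if ee (w - z) = 1 then deriv g z / (2 * of_real pi * \<i>)
     else (g w - g z) / (ee (w - z) - 1))"
  have zn: "z + of_int n \<in> S" for n using real_shift[OF z, of "of_int n"] by simp
  have derivg: "deriv g (z + of_int n) = deriv g z" for n
  proof -
    have D: "(g has_field_derivative deriv g (z + of_int n)) (at (z + of_int n))"
      using holomorphic_derivI[OF holo open_S zn] .
    then have "((\<lambda>x. g (x + of_int n)) has_field_derivative deriv g (z + of_int n)) (at z)"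
      by (simp add: DERIV_shift)
    then have "(g has_field_derivative deriv g (z + of_int n)) (at z)"
      by (rule has_field_derivative_transform_within_open[OF _ open_S z]) (simp add: periodic_int)
    moreover have "(g has_field_derivative deriv g z) (at z)"
      using holomorphic_derivI[OF holo open_S z] .
    ultimately show ?thesis by (rule DERIV_unique)
  qed
  have "h field_differentiable (at w)" if w: "w \<in> S" for w
  proof (cases "ee (w - z) = 1")
    case False
    have "open (S \<inter> {w. ee (w - z) \<noteq> 1})"
      by (intro open_Int open_S open_Collect_neq continuous_intros)
    moreover have "(\<lambda>w. (g w - g z) / (ee (w - z) - 1)) holomorphic_on (S \<inter> {w. ee (w - z) \<noteq> 1})"
      by (intro holomorphic_intros holomorphic_on_subset[OF holo]) auto
    then have "h holomorphic_on (S \<inter> {w. ee (w - z) \<noteq> 1})"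
      by (rule holomorphic_transform) (auto simp: h_def)
    ultimately show ?thesis using w False by (auto intro: holomorphic_on_imp_differentiable_at)
  next
    case True
    then obtain n where n: "w = z + of_int n"
      unfolding ee_eq_1 by (metis add.commute diff_add_cancel)
    \<comment> \<open>Radius 1 excludes every other integer translate, so \<open>w\<close> is the
      only zero of the denominator in \<open>U\<close>; dividing both parts by \<open>x - w\<close>
      removes it.\<close>
    define U where "U = S \<inter> ball w 1"
    define u1 where "u1 = (\<lambda>x. if x = w then deriv g w else (g x - g w) / (x - w))"
    define u2 where "u2 = (\<lambda>x. if x = w then deriv (\<lambda>x. ee (x - w)) w else (ee (x - w) - ee (w - w)) / (x - w))"
    have U: "open U" "w \<in> U" unfolding U_def using open_S w by auto
    have dee: "deriv (\<lambda>x. ee (x - w)) w = 2 * of_real pi * \<i>"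
      unfolding ee_def by (rule DERIV_imp_deriv) (auto intro!: derivative_eq_intros)
    have u1: "u1 holomorphic_on U"
      unfolding u1_def by (rule pole_lemma_open) (auto simp: U_def open_S intro: holomorphic_on_subset[OF holo])
    have u2: "u2 holomorphic_on U"
      unfolding u2_def by (rule pole_lemma_open) (auto simp: U_def open_S intro!: holomorphic_intros)
    have ne1: "ee (x - w) \<noteq> 1" if "x \<in> U" "x \<noteq> w" for x
    proof
      assume "ee (x - w) = 1"
      then obtain m :: int where "x - w = of_int m" unfolding ee_eq_1 by auto
      moreover have "norm (x - w) < 1" using that by (simp add: U_def dist_norm norm_minus_commute)
      ultimately have "\<bar>m\<bar> < 1" by (metis norm_of_int of_int_less_1_iff of_int_abs)
      then show False using \<open>x - w = of_int m\<close> that by auto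
    qed
    have ne: "u2 x \<noteq> 0" if "x \<in> U" for x
      using ne1[OF that] unfolding u2_def dee by auto
    have eqw: "ee (x - z) = ee (x - w)" for x
      using ee_add[of "x - w" "of_int n"] by (simp add: n)
    have "h x = u1 x / u2 x" if "x \<in> U" for x
    proof (cases "x = w")
      case True
      then show ?thesis unfolding h_def u1_def u2_def dee eqw by (simp add: n derivg)
    next
      case False
      have "g w = g z" using periodic_int[OF z] n by simp
      then show ?thesis using False ne1[OF that False] unfolding h_def u1_def u2_def eqw by simp
    qed
    moreover have "(\<lambda>x. u1 x / u2 x) holomorphic_on U"
      by (intro holomorphic_intros u1 u2) (use ne in auto)
    ultimately have "h holomorphic_on U" by (metis (no_types, lifting) holomorphic_transform)
    then show ?thesis using U holomorphic_on_imp_differentiable_at by blast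
  qed
  then have hol_h: "h holomorphic_on S"
    using open_S by (auto simp: holomorphic_on_def intro: field_differentiable_at_within)
  interpret h: periodic_strip S h
  proof
    show "h (w + 1) = h w" if "w \<in> S" for w
    proof -
      have "ee (w + 1 - z) = ee (w - z)"
        using ee_add[of "w - z" 1] ee_of_int[of 1] by (simp add: algebra_simps del: ee_of_int)
      then show ?thesis by (simp add: h_def periodic[OF that])
    qed
  qed (use open_S convex_S real_shift hol_h in auto)
  \<comment> \<open>Multiplying the integrand by \<open>ee s\<close> lowers the index of a Fourier
    term by one, so \<open>h * (ee s - 1)\<close> contributes a difference of neighbouring terms of
    \<open>h\<close>.\<close>
  have key: "fourier_int g n z = (if n = 0 then g z else 0) + (fourier_int h (n - 1) z - fourier_int h n z)" for n
  proof -
    have pt: "g (z + of_real s) * ee (- (of_int n * of_real s)) =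
       g z * ee (of_int (- n) * of_real s) +
       (h (z + of_real s) * ee (- (of_int (n - 1) * of_real s)) - h (z + of_real s) * ee (- (of_int n * of_real s)))" for s
    proof -
      have "h (z + of_real s) * (ee (of_real s) - 1) = g (z + of_real s) - g z"
      proof (cases "ee (of_real s) = 1")
        case True
        then obtain m :: int where "complex_of_real s = of_int m" unfolding ee_eq_1 by auto
        then show ?thesis using periodic_int[OF z, of m] by simp
      qed (simp add: h_def)
      then have *: "g (z + of_real s) = g z + h (z + of_real s) * (ee (of_real s) - 1)" by simp
      have "- (of_int (n - 1) * of_real s) = - (of_int n * of_real s) + (of_real s :: complex)"
        by (simp add: algebra_simps)
      then show ?thesis by (simp only: * ee_add) (simp add: algebra_simps)
    qed
    have i1: "(\<lambda>s. ee (of_int (- n) * of_real s)) integrable_on {0..1}"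
      by (intro integrable_continuous_interval continuous_intros)
    have "fourier_int g n z = integral {0..1} (\<lambda>s. g z * ee (of_int (- n) * of_real s)) +
       (fourier_int h (n - 1) z - fourier_int h n z)"
      unfolding fourier_int_def pt
      by (subst integral_add, intro integrable_on_mult_right i1,
         intro integrable_diff h.integrable_shift z, subst integral_diff, (intro h.integrable_shift z)+) simp
    also have "integral {0..1} (\<lambda>s. g z * ee (of_int (- n) * of_real s)) = (if n = 0 then g z else 0)"
      by (subst integral_mult_right) (simp only: integral_ee_int, simp)
    finally show ?thesis .
  qed
  obtain q where q: "((\<lambda>n. fourier_int h n z) has_sum q) UNIV"
    using h.fourier_int_summable[OF z] by (auto simp: summable_on_def)
  \<comment> \<open>Both families in the difference have the same sum \<open>q\<close> and cancel,
    so only the extra term at index 0 remains.\<close>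
  have "bij_betw (\<lambda>n::int. n - 1) UNIV UNIV"
    by (rule bij_betwI[where g="\<lambda>n. n + 1"]) auto
  from has_sum_reindex_bij_betw[OF this, of "\<lambda>n. fourier_int h n z" q]
  have "((\<lambda>n. fourier_int h (n - 1) z) has_sum q) UNIV" using q by simp
  from has_sum_add[OF this has_sum_uminusI[OF q]]
  have 1: "((\<lambda>n. fourier_int h (n - 1) z - fourier_int h n z) has_sum 0) UNIV" by simp
  have 2: "((\<lambda>n::int. if n = 0 then g z else 0) has_sum g z) UNIV"
    by (rule has_sum_finite_neutralI[of "{0}"]) auto
  show ?thesis unfolding key using has_sum_add[OF 2 1] by simp
qed

section \<open>Periodic holomorphic functions on the Siegel half space\<close>

text \<open>Morera: for each parameter the integral over a triangle vanishes by Cauchy, and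
  continuity on the product allows the two integrations to be exchanged.\<close>

lemma holomorphic_integral_param:
  fixes f :: "complex \<Rightarrow> real \<Rightarrow> complex"
  assumes U: "open U" and cont: "continuous_on (U \<times> {0..1}) (\<lambda>(z, s). f z s)"
    and hol: "\<And>s. s \<in> {0..1} \<Longrightarrow> (\<lambda>z. f z s) holomorphic_on U"
  shows "(\<lambda>z. integral {0..1} (f z)) holomorphic_on U"
proof -
  let ?F = "\<lambda>z. integral {0..1} (f z)"
  have contF: "continuous_on U ?F"
    using integral_continuous_on_param[of U 0 1 f] cont by simp
  have line: "contour_integral (linepath a b) ?F = integral {0..1} (\<lambda>s. contour_integral (linepath a b) (\<lambda>z. f z s))
      \<and> (\<lambda>s. contour_integral (linepath a b) (\<lambda>z. f z s)) integrable_on {0..1}"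
    if ab: "closed_segment a b \<subseteq> U" for a b
  proof -
    have mem: "linepath a b x \<in> U" if "x \<in> {0..1}" for x
      using ab that linepath_in_path by blast
    have c: "continuous_on ({0..1} \<times> {0..1}) (\<lambda>(x, s). f (linepath a b x) s)"
    proof -
      have l: "continuous_on ({0..1} \<times> {0..1}) (\<lambda>p::real \<times> real. (linepath a b (fst p), snd p))"
        unfolding linepath_def by (intro continuous_intros)
      have "continuous_on ({0..1} \<times> {0..1}) (\<lambda>p. (\<lambda>(z, s). f z s) (linepath a b (fst p), snd p))"
        by (rule continuous_on_compose2[OF cont l]) (use mem in auto)
      then show ?thesis by (simp add: case_prod_unfold)
    qed
    have c': "continuous_on ({0..1} \<times> {0..1}) (\<lambda>(s, x). f (linepath a b x) s)"
    proof -
      have "continuous_on ({0..1} \<times> {0..1}) (\<lambda>p. (\<lambda>(x, s). f (linepath a b x) s) (snd p, fst p))"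
        by (rule continuous_on_compose2[OF c]) (auto intro!: continuous_intros)
      then show ?thesis by (simp add: case_prod_unfold)
    qed
    have eq: "contour_integral (linepath a b) h = integral {0..1} (\<lambda>x. h (linepath a b x)) * (b - a)" for h
      by (simp add: contour_integral_integral)
    have sw: "integral {0..1} (\<lambda>x. integral {0..1} (f (linepath a b x))) =
        integral {0..1} (\<lambda>s. integral {0..1} (\<lambda>x. f (linepath a b x) s))"
      using integral_swap_continuous[of "0::real" "0::real" "1::real" "1::real" "\<lambda>x s. f (linepath a b x) s"] c
      by (simp add: cbox_Pair_eq)
    have i: "(\<lambda>s. integral {0..1} (\<lambda>x. f (linepath a b x) s)) integrable_on {0..1}"
      by (intro integrable_continuous_interval)
        (use integral_continuous_on_param[of "{0..1}" 0 1 "\<lambda>s x. f (linepath a b x) s"] c' in simp)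
    show ?thesis unfolding eq sw using i by (simp add: integrable_on_mult_left)
  qed
  have "contour_integral (linepath a b) ?F + contour_integral (linepath b c) ?F + contour_integral (linepath c a) ?F = 0"
    if abc: "convex hull {a, b, c} \<subseteq> U" for a b c
  proof -
    have seg: "closed_segment a b \<subseteq> U" "closed_segment b c \<subseteq> U" "closed_segment c a \<subseteq> U"
      by (rule order_trans[OF _ abc], rule segments_subset_convex_hull)+
    have z: "contour_integral (linepath a b) (\<lambda>z. f z s) + contour_integral (linepath b c) (\<lambda>z. f z s) +
         contour_integral (linepath c a) (\<lambda>z. f z s) = 0" if s: "s \<in> {0..1}" for s
    proof -
      have hs: "(\<lambda>z. f z s) holomorphic_on convex hull {a, b, c}"
        using hol[OF s] abc by (rule holomorphic_on_subset)
      have ci: "(\<lambda>z. f z s) contour_integrable_on linepath x y" if "closed_segment x y \<subseteq> U" for x y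
        by (rule contour_integrable_continuous_linepath)
          (use hol[OF s] that in \<open>meson holomorphic_on_imp_continuous_on continuous_on_subset\<close>)
      from Cauchy_theorem_triangle[OF hs] show ?thesis
        using ci seg by (auto dest!: contour_integral_unique simp: contour_integrable_joinI add.assoc)
    qed
    have "contour_integral (linepath a b) ?F + contour_integral (linepath b c) ?F + contour_integral (linepath c a) ?F =
      integral {0..1} (\<lambda>s. contour_integral (linepath a b) (\<lambda>z. f z s) + contour_integral (linepath b c) (\<lambda>z. f z s) +
         contour_integral (linepath c a) (\<lambda>z. f z s))"
      using line[OF seg(1)] line[OF seg(2)] line[OF seg(3)]
      by (simp add: integral_add integrable_add)
    also have "\<dots> = integral {0..1} (\<lambda>s::real. 0 :: complex)"
      by (intro integral_cong z) auto
    finally show ?thesis by simp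
  qed
  then have "?F analytic_on U"
    by (intro Morera_triangle contF U) blast
  then show ?thesis by (rule analytic_imp_holomorphic)
qed

section \<open>Coordinates of symmetric matrices and the geometry of the Siegel half space\<close>

definition cscale :: "complex \<Rightarrow> complex^'n^'m \<Rightarrow> complex^'n^'m" where
  "cscale c M = (\<chi> a b. c * M $ a $ b)"

text \<open>One- and two-element sets index the coordinates of a symmetric matrix:
  \<open>{a}\<close> stands for a diagonal entry, \<open>{a, b}\<close> for the two equal entries
  off the diagonal.\<close>

definition pairs :: "'g::finite set set" where
  "pairs = {A. A \<noteq> {} \<and> card A \<le> 2}"

text \<open>Polymorphic, because translation by this matrix is needed both as an integral block of a
  symplectic matrix and as a complex direction.\<close>

definition unit_sym :: "'g::finite set \<Rightarrow> 'a::zero_neq_one^'g^'g" where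
  "unit_sym A = (\<chi> a b. if {a, b} = A then 1 else 0)"

lemma finite_pairs [simp]: "finite (pairs :: 'g::finite set set)"
  by simp

lemma pairs_iff: "A \<in> pairs \<longleftrightarrow> (\<exists>a b. A = {a, b})"
proof
  assume "A \<in> pairs"
  then have "card A = 1 \<or> card A = 2" 
    by (auto simp: pairs_def le_Suc_eq numeral_2_eq_2)
  then show "\<exists>a b. A = {a, b}"
    by (auto simp: card_1_singleton_iff card_2_iff)
qed (auto simp: pairs_def card_insert_if)

lemma pairsI [simp]: "{a, b} \<in> pairs"
  by (auto simp: pairs_iff)

lemma sym_nth: "transpose M = M \<Longrightarrow> M $ a $ b = M $ b $ a"
  by (metis transpose_def vec_lambda_beta)

lemma transpose_unit_sym [simp]: "transpose (unit_sym A) = unit_sym A"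
  by (auto simp: transpose_def unit_sym_def vec_eq_iff insert_commute)

lemma transpose_cscale: "transpose (cscale c M) = cscale c (transpose M)"
  by (simp add: transpose_def cscale_def)

lemma transpose_add: "transpose (M + N) = transpose M + transpose (N :: 'a::plus^'n^'m)"
  by (simp add: transpose_def vec_eq_iff)

lemma qform: "v \<bullet> (Y *v v) = (\<Sum>a\<in>UNIV. \<Sum>b\<in>UNIV. Y $ a $ b * (v $ a * v $ b))" for Y :: "real^'n^'n"
  by (simp add: inner_vec_def matrix_vector_mult_def sum_distrib_left mult_ac)

lemma siegel_iff: "\<tau> \<in> siegel \<longleftrightarrow> transpose \<tau> = \<tau> \<and>
   (\<forall>v. v \<noteq> 0 \<longrightarrow> (\<Sum>a\<in>UNIV. \<Sum>b\<in>UNIV. Im (\<tau> $ a $ b) * (v $ a * v $ b)) > 0)"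
proof -
  have "transpose \<tau> = \<tau> \<Longrightarrow> transpose (map_matrix Im \<tau>) = map_matrix Im \<tau>"
    by (auto simp: transpose_def map_matrix_def vec_eq_iff)
  then show ?thesis unfolding siegel_def pos_def_def qform
    by (auto simp: map_matrix_def)
qed

lemma siegelD_sym: "\<tau> \<in> siegel \<Longrightarrow> transpose \<tau> = \<tau>"
  by (simp add: siegel_iff)

lemma siegel_real_shift:
  fixes \<tau> X :: "complex^'g::finite^'g"
  assumes "\<tau> \<in> siegel" "transpose X = X" "\<And>a b. Im (X $ a $ b) = 0"
  shows "\<tau> + X \<in> siegel"
  using assms by (simp add: siegel_iff transpose_add)

lemma convex_siegel: "convex (siegel :: (complex^'g::finite^'g) set)"
proof (rule convexI)
  fix \<tau> \<sigma> :: "complex^'g^'g" and u v :: real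
  assume t: "\<tau> \<in> siegel" and s: "\<sigma> \<in> siegel" and uv: "0 \<le> u" "0 \<le> v" "u + v = 1"
  have "(\<Sum>a\<in>UNIV. \<Sum>b\<in>UNIV. Im ((u *\<^sub>R \<tau> + v *\<^sub>R \<sigma>) $ a $ b) * (x $ a * x $ b)) > 0" if "x \<noteq> 0" for x
  proof -
    have eq: "(\<Sum>a\<in>UNIV. \<Sum>b\<in>UNIV. Im ((u *\<^sub>R \<tau> + v *\<^sub>R \<sigma>) $ a $ b) * (x $ a * x $ b)) =
       u * (\<Sum>a\<in>UNIV. \<Sum>b\<in>UNIV. Im (\<tau> $ a $ b) * (x $ a * x $ b)) +
       v * (\<Sum>a\<in>UNIV. \<Sum>b\<in>UNIV. Im (\<sigma> $ a $ b) * (x $ a * x $ b))"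
      by (simp add: sum_distrib_left sum.distrib[symmetric] algebra_simps)
    have "(\<Sum>a\<in>UNIV. \<Sum>b\<in>UNIV. Im (\<tau> $ a $ b) * (x $ a * x $ b)) > 0"
         "(\<Sum>a\<in>UNIV. \<Sum>b\<in>UNIV. Im (\<sigma> $ a $ b) * (x $ a * x $ b)) > 0"
      using t s that by (auto simp: siegel_iff)
    then show ?thesis unfolding eq using uv
      by (cases "u = 0") (auto intro: add_pos_nonneg)
  qed
  moreover have "transpose (u *\<^sub>R \<tau> + v *\<^sub>R \<sigma>) = u *\<^sub>R \<tau> + v *\<^sub>R \<sigma>"
    using siegelD_sym[OF t] siegelD_sym[OF s]
    by (simp add: transpose_def vec_eq_iff)
  ultimately show "u *\<^sub>R \<tau> + v *\<^sub>R \<sigma> \<in> siegel" by (simp add: siegel_iff)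
qed

text \<open>By compactness of the unit sphere the imaginary form has a positive minimum
  \<open>c\<close> there. The g^2 entries of a perturbation, each at most \<open>c / (2 * N)\<close>
  with \<open>N\<close> equal to g^2, change it by at most \<open>c / 2\<close>. Real parts are
  unrestricted, which later allows contours of full unit length.\<close>

lemma siegel_perturb:
  fixes \<tau> :: "complex^'g::finite^'g"
  assumes "\<tau> \<in> siegel"
  obtains d where "d > 0"
    "\<And>X. transpose X = X \<Longrightarrow> (\<And>a b. \<bar>Im (X $ a $ b)\<bar> \<le> d) \<Longrightarrow> \<tau> + X \<in> siegel"
proof -
  define q where "q = (\<lambda>(M :: complex^'g^'g) v. \<Sum>a\<in>UNIV. \<Sum>b\<in>UNIV. Im (M $ a $ b) * (v $ a * v $ b :: real))"
  have q: "q \<tau> v > 0" if "v \<noteq> 0" for v using assms that by (simp add: siegel_iff q_def)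
  have "continuous_on (sphere 0 1) (q \<tau>)"
    unfolding q_def by (intro continuous_intros)
  then obtain v0 where v0: "v0 \<in> sphere 0 1" "\<And>v. v \<in> sphere 0 1 \<Longrightarrow> q \<tau> v0 \<le> q \<tau> v"
    using continuous_attains_inf[of "sphere 0 1" "q \<tau>"] by (auto simp: sphere_eq_empty)
  define c where "c = q \<tau> v0"
  have "v0 \<noteq> 0" using v0 by auto
  then have c: "c > 0" using q c_def by simp
  define N where "N = real CARD('g) * real CARD('g)"
  have N: "N > 0" by (simp add: N_def)
  have lower: "q \<tau> v \<ge> c * (norm v)\<^sup>2" for v
  proof (cases "v = 0")
    case False
    have "q \<tau> ((1 / norm v) *\<^sub>R v) = q \<tau> v / (norm v)\<^sup>2"
      by (simp add: q_def sum_divide_distrib power2_eq_square mult_ac)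
    moreover have "q \<tau> ((1 / norm v) *\<^sub>R v) \<ge> c"
      unfolding c_def by (rule v0(2)) (use False in simp)
    moreover have "(norm v)\<^sup>2 > 0" using False by simp
    ultimately show ?thesis by (simp only: pos_le_divide_eq)
  qed (simp add: q_def)
  show ?thesis
  proof (rule that[of "c / (2 * N)"])
    show "c / (2 * N) > 0" using c N by simp
    fix X :: "complex^'g^'g" assume X: "transpose X = X" "\<And>a b. \<bar>Im (X $ a $ b)\<bar> \<le> c / (2 * N)"
    have "q (\<tau> + X) v > 0" if v: "v \<noteq> 0" for v
    proof -
      have "\<bar>q X v\<bar> \<le> (\<Sum>a\<in>(UNIV::'g set). \<Sum>b\<in>(UNIV::'g set). c / (2 * N) * (norm v * norm v))"
        unfolding q_def
      proof (rule order_trans[OF sum_abs sum_mono], rule order_trans[OF sum_abs sum_mono])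
        fix a b
        have "\<bar>Im (X $ a $ b) * (v $ a * v $ b)\<bar> \<le> c / (2 * N) * (norm v * norm v)"
          unfolding abs_mult by (intro mult_mono X component_le_norm_cart) (use c N in auto)
        then show "\<bar>Im (X $ a $ b) * (v $ a * v $ b)\<bar> \<le> c / (2 * N) * (norm v * norm v)" .
      qed
      also have "\<dots> = c / 2 * (norm v)\<^sup>2"
        using N by (simp add: N_def power2_eq_square)
      finally have "\<bar>q X v\<bar> \<le> c / 2 * (norm v)\<^sup>2" .
      moreover have "q (\<tau> + X) v = q \<tau> v + q X v"
        by (simp add: q_def sum.distrib algebra_simps)
      moreover have "c * (norm v)\<^sup>2 > 0" using v c by simp
      ultimately show ?thesis using lower[of v] by linarith
    qed
    then show "\<tau> + X \<in> siegel" using X(1) siegelD_sym[OF assms]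
      by (simp add: siegel_iff q_def transpose_add)
  qed
qed

section \<open>Coordinate lines in the half space and iterated Fourier projections\<close>

definition siegel_line :: "complex^'g::finite^'g \<Rightarrow> 'g set \<Rightarrow> complex set" where
  "siegel_line \<tau> A = {\<zeta>. \<tau> + cscale \<zeta> (unit_sym A) \<in> siegel}"

lemma cscale_add: "cscale (x + y) M = cscale x M + cscale y M"
  by (simp add: cscale_def vec_eq_iff distrib_right)

lemma cscale_1 [simp]: "cscale 1 M = M" by (simp add: cscale_def vec_eq_iff)
lemma cscale_0 [simp]: "cscale 0 M = 0" by (simp add: cscale_def vec_eq_iff)

lemma siegel_scalar:
  assumes "y > 0" shows "cscale (\<i> * of_real y) (mat 1 :: complex^'g::finite^'g) \<in> siegel"
proof -
  have "(\<Sum>a\<in>UNIV. \<Sum>b\<in>UNIV. Im (cscale (\<i> * of_real y) (mat 1 :: complex^'g^'g) $ a $ b) * (v $ a * v $ b)) > 0"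
    if "v \<noteq> 0" for v :: "real^'g"
  proof -
    have "Im (cscale (\<i> * of_real y) (mat 1 :: complex^'g^'g) $ a $ b) * (v $ a * v $ b) = (if b = a then y * (v $ a * v $ a) else 0)" for a b
      by (auto simp: cscale_def mat_def)
    then have "(\<Sum>a\<in>UNIV. \<Sum>b\<in>UNIV. Im (cscale (\<i> * of_real y) (mat 1 :: complex^'g^'g) $ a $ b) * (v $ a * v $ b)) = y * (v \<bullet> v)"
      by (simp add: inner_vec_def sum_distrib_left)
    then show ?thesis using that assms by simp
  qed
  then show ?thesis by (simp add: siegel_iff transpose_cscale transpose_mat)
qed

lemma siegel_shift_of_real: "\<tau> \<in> siegel \<Longrightarrow> \<tau> + cscale (of_real r) (unit_sym A) \<in> siegel"
  by (rule siegel_real_shift) (simp_all only: transpose_cscale transpose_unit_sym, simp add: cscale_def unit_sym_def)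

lemma siegel_line_shift: "\<zeta> \<in> siegel_line \<tau> A \<Longrightarrow> \<zeta> + of_real r \<in> siegel_line \<tau> A"
  using siegel_shift_of_real by (simp add: siegel_line_def cscale_add add.assoc[symmetric])

lemma siegel_line_0: "0 \<in> siegel_line \<tau> A \<longleftrightarrow> \<tau> \<in> siegel"
  by (simp add: siegel_line_def)

lemma convex_siegel_line: "convex (siegel_line \<tau> A)"
proof (rule convexI)
  fix x y u v assume xy: "x \<in> siegel_line \<tau> A" "y \<in> siegel_line \<tau> A" and uv: "0 \<le> (u::real)" "0 \<le> v" "u + v = 1"
  have "u *\<^sub>R (\<tau> + cscale x (unit_sym A)) + v *\<^sub>R (\<tau> + cscale y (unit_sym A)) = \<tau> + cscale (u *\<^sub>R x + v *\<^sub>R y) (unit_sym A)"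
  proof -
    have "u *\<^sub>R \<tau> + v *\<^sub>R \<tau> = \<tau>" using uv by (metis scaleR_add_left scaleR_one)
    then have "u *\<^sub>R \<tau> $ a $ b + v *\<^sub>R \<tau> $ a $ b = \<tau> $ a $ b" for a b
      by (metis vector_add_component vector_scaleR_component)
    then show ?thesis by (simp add: cscale_def vec_eq_iff algebra_simps)
  qed
  moreover have "u *\<^sub>R (\<tau> + cscale x (unit_sym A)) + v *\<^sub>R (\<tau> + cscale y (unit_sym A)) \<in> siegel"
    using convex_siegel xy uv unfolding siegel_line_def convex_def by blast
  ultimately show "u *\<^sub>R x + v *\<^sub>R y \<in> siegel_line \<tau> A" by (simp add: siegel_line_def)
qed

lemma open_siegel_line: "open (siegel_line \<tau> A)"
proof (rule openI)
  fix z assume "z \<in> siegel_line \<tau> A"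
  then have z: "\<tau> + cscale z (unit_sym A) \<in> siegel" by (simp add: siegel_line_def)
  obtain d where d: "d > 0" "\<And>X. transpose X = X \<Longrightarrow> (\<And>a b. \<bar>Im (X $ a $ b)\<bar> \<le> d) \<Longrightarrow> \<tau> + cscale z (unit_sym A) + X \<in> siegel"
    using siegel_perturb[OF z] by blast
  have "ball z d \<subseteq> siegel_line \<tau> A"
  proof
    fix w assume "w \<in> ball z d"
    then have w: "norm (w - z) < d" by (simp add: dist_norm norm_minus_commute)
    have "\<tau> + cscale z (unit_sym A) + cscale (w - z) (unit_sym A) \<in> siegel"
    proof (rule d(2))
      show "transpose (cscale (w - z) (unit_sym A)) = cscale (w - z) (unit_sym A)" by (simp only: transpose_cscale transpose_unit_sym)
      show "\<bar>Im (cscale (w - z) (unit_sym A) $ a $ b)\<bar> \<le> d" for a b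
        using w abs_Im_le_cmod[of "w - z"] d(1) by (auto simp: cscale_def unit_sym_def)
    qed
    moreover have "cscale z (unit_sym A) + cscale (w - z) (unit_sym A) = cscale w (unit_sym A)"
      by (simp add: cscale_add[symmetric])
    ultimately show "w \<in> siegel_line \<tau> A" by (simp add: siegel_line_def add.assoc)
  qed
  then show "\<exists>e>0. ball z e \<subseteq> siegel_line \<tau> A" using d by blast
qed

text \<open>Joint continuity and holomorphy along coordinate lines suffice for the one-variable
  theory, and both pass to integrals over a parameter, so the property is inherited by every Fourier
  projection.\<close>

definition siegel_periodic :: "(complex^'g::finite^'g \<Rightarrow> complex) \<Rightarrow> bool" where
  "siegel_periodic \<Phi> \<longleftrightarrow> continuous_on siegel \<Phi> \<and> (\<forall>\<tau>\<in>siegel. \<forall>A\<in>pairs.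
     (\<lambda>\<zeta>. \<Phi> (\<tau> + cscale \<zeta> (unit_sym A))) holomorphic_on siegel_line \<tau> A \<and> \<Phi> (\<tau> + unit_sym A) = \<Phi> \<tau>)"

text \<open>\<open>fourier_int\<close> along the coordinate \<open>A\<close>, regarded as a function
  on the whole half space so that projections in other coordinates can follow.\<close>

definition fourier_proj :: "'g::finite set \<Rightarrow> int \<Rightarrow> (complex^'g^'g \<Rightarrow> complex) \<Rightarrow> complex^'g^'g \<Rightarrow> complex" where
  "fourier_proj A n \<Phi> \<tau> = integral {0..1} (\<lambda>s. \<Phi> (\<tau> + cscale (of_real s) (unit_sym A)) * ee (- (of_int n * of_real s)))"

lemma fourier_int_line:
  "fourier_int (\<lambda>\<zeta>. \<Phi> (\<tau> + cscale \<zeta> (unit_sym A))) n z = fourier_proj A n \<Phi> (\<tau> + cscale z (unit_sym A))"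
  by (simp add: fourier_int_def fourier_proj_def cscale_add add.assoc)

lemma siegel_periodic_strip:
  assumes "siegel_periodic \<Phi>" "\<tau> \<in> siegel" "A \<in> pairs"
  shows "periodic_strip (siegel_line \<tau> A) (\<lambda>\<zeta>. \<Phi> (\<tau> + cscale \<zeta> (unit_sym A)))"
proof
  fix z assume "z \<in> siegel_line \<tau> A"
  then have "\<tau> + cscale z (unit_sym A) \<in> siegel" by (simp add: siegel_line_def)
  then have "\<Phi> (\<tau> + cscale z (unit_sym A) + unit_sym A) = \<Phi> (\<tau> + cscale z (unit_sym A))"
    using assms unfolding siegel_periodic_def by blast
  then show "\<Phi> (\<tau> + cscale (z + 1) (unit_sym A)) = \<Phi> (\<tau> + cscale z (unit_sym A))"
    by (simp add: cscale_add add.assoc)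
qed (use assms in \<open>auto simp: siegel_periodic_def open_siegel_line convex_siegel_line siegel_line_shift\<close>)

lemma continuous_cscale [continuous_intros]:
  assumes "continuous_on S f" shows "continuous_on S (\<lambda>x. cscale (f x) M)"
  unfolding cscale_def by (intro continuous_intros assms)

lemma siegel_periodic_fourier_proj:
  assumes \<Phi>: "siegel_periodic \<Phi>" and A: "A \<in> pairs"
  shows "siegel_periodic (fourier_proj A n \<Phi>)"
  unfolding siegel_periodic_def
proof (intro conjI ballI)
  have cont: "continuous_on siegel \<Phi>" using \<Phi> by (simp add: siegel_periodic_def)
  have "continuous_on (siegel \<times> cbox 0 1) (\<lambda>p. \<Phi> (fst p + cscale (of_real (snd p)) (unit_sym A)) * ee (- (of_int n * of_real (snd p))))"
    by (intro continuous_intros continuous_on_compose2[OF cont]) (auto simp: siegel_shift_of_real)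
  then have "continuous_on (siegel \<times> cbox 0 1) (\<lambda>(\<tau>, s). \<Phi> (\<tau> + cscale (of_real s) (unit_sym A)) * ee (- (of_int n * of_real s)))"
    by (simp add: case_prod_unfold)
  from integral_continuous_on_param[OF this] show "continuous_on siegel (fourier_proj A n \<Phi>)"
    by (simp add: fourier_proj_def[abs_def])
  fix \<tau> :: "complex^'a^'a" and B :: "'a set" assume \<tau>: "\<tau> \<in> siegel" and B: "B \<in> pairs"
  show "fourier_proj A n \<Phi> (\<tau> + unit_sym B) = fourier_proj A n \<Phi> \<tau>"
  proof -
    have "\<Phi> (\<tau> + unit_sym B + cscale (of_real s) (unit_sym A)) = \<Phi> (\<tau> + cscale (of_real s) (unit_sym A))" for s
    proof -
      have "\<tau> + unit_sym B + cscale (of_real s) (unit_sym A) = \<tau> + cscale (of_real s) (unit_sym A) + unit_sym B" by simp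
      moreover have "\<Phi> (\<tau> + cscale (of_real s) (unit_sym A) + unit_sym B) = \<Phi> (\<tau> + cscale (of_real s) (unit_sym A))"
        using \<Phi> B siegel_shift_of_real[OF \<tau>, of s A] unfolding siegel_periodic_def by blast
      ultimately show ?thesis by (simp only:)
    qed
    then show ?thesis by (simp add: fourier_proj_def)
  qed
  have sw: "\<tau> + cscale z (unit_sym B) + cscale (of_real s) (unit_sym A) = \<tau> + cscale (of_real s) (unit_sym A) + cscale z (unit_sym B)" for z s
    by simp
  have inS: "\<tau> + cscale z (unit_sym B) + cscale (of_real s) (unit_sym A) \<in> siegel" if "z \<in> siegel_line \<tau> B" for z s
    using siegel_shift_of_real that by (auto simp: siegel_line_def)
  show "(\<lambda>\<zeta>. fourier_proj A n \<Phi> (\<tau> + cscale \<zeta> (unit_sym B))) holomorphic_on siegel_line \<tau> B"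
    unfolding fourier_proj_def
  proof (rule holomorphic_integral_param[OF open_siegel_line])
    have "continuous_on (siegel_line \<tau> B \<times> {0..1}) (\<lambda>p. \<Phi> (\<tau> + cscale (fst p) (unit_sym B) + cscale (of_real (snd p)) (unit_sym A)) *
       ee (- (of_int n * of_real (snd p))))"
      by (intro continuous_intros continuous_on_compose2[OF cont]) (use inS in auto)
    then show "continuous_on (siegel_line \<tau> B \<times> {0..1}) (\<lambda>(z, s). \<Phi> (\<tau> + cscale z (unit_sym B) + cscale (of_real s) (unit_sym A)) *
       ee (- (of_int n * of_real s)))"
      by (simp add: case_prod_unfold)
    fix s :: real
    have sl: "siegel_line \<tau> B = siegel_line (\<tau> + cscale (of_real s) (unit_sym A)) B"
    proof -
      have "z \<in> siegel_line \<tau> B \<longleftrightarrow> z \<in> siegel_line (\<tau> + cscale (of_real s) (unit_sym A)) B" for z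
      proof
        assume "z \<in> siegel_line (\<tau> + cscale (of_real s) (unit_sym A)) B"
        then have "\<tau> + cscale (of_real s) (unit_sym A) + cscale z (unit_sym B) + cscale (of_real (- s)) (unit_sym A) \<in> siegel"
          using siegel_shift_of_real unfolding siegel_line_def by blast
        moreover have "cscale (of_real (- s)) (unit_sym A :: complex^'a^'a) = - cscale (of_real s) (unit_sym A)"
          by (simp add: cscale_def vec_eq_iff)
        ultimately show "z \<in> siegel_line \<tau> B" unfolding siegel_line_def mem_Collect_eq
          by (simp add: algebra_simps)
      qed (use inS in \<open>auto simp: siegel_line_def sw\<close>)
      then show ?thesis by blast
    qed
    have "(\<lambda>z. \<Phi> (\<tau> + cscale (of_real s) (unit_sym A) + cscale z (unit_sym B))) holomorphic_on siegel_line \<tau> B"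
      using \<Phi> siegel_shift_of_real[OF \<tau>] B unfolding siegel_periodic_def sl by blast
    then show "(\<lambda>z. \<Phi> (\<tau> + cscale z (unit_sym B) + cscale (of_real s) (unit_sym A)) * ee (- (of_int n * of_real s)))
        holomorphic_on siegel_line \<tau> B"
      unfolding sw by (intro holomorphic_intros)
  qed
qed

definition homog :: "'g::finite set \<Rightarrow> int \<Rightarrow> (complex^'g^'g \<Rightarrow> complex) \<Rightarrow> bool" where
  "homog A n \<Phi> \<longleftrightarrow> (\<forall>\<tau>\<in>siegel. \<forall>\<zeta>. \<tau> + cscale \<zeta> (unit_sym A) \<in> siegel \<longrightarrow>
      \<Phi> (\<tau> + cscale \<zeta> (unit_sym A)) = ee (of_int n * \<zeta>) * \<Phi> \<tau>)"

lemma homog_fourier_proj: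
  assumes "siegel_periodic \<Phi>" "A \<in> pairs"
  shows "homog A n (fourier_proj A n \<Phi>)"
  unfolding homog_def
proof (intro ballI allI impI)
  fix \<tau> \<zeta> assume \<tau>: "\<tau> \<in> siegel" and z: "\<tau> + cscale \<zeta> (unit_sym A) \<in> siegel"
  interpret periodic_strip "siegel_line \<tau> A" "\<lambda>\<zeta>. \<Phi> (\<tau> + cscale \<zeta> (unit_sym A))"
    by (rule siegel_periodic_strip[OF assms(1) \<tau> assms(2)])
  from fourier_int_shift[of 0 \<zeta> n] show "fourier_proj A n \<Phi> (\<tau> + cscale \<zeta> (unit_sym A)) = ee (of_int n * \<zeta>) * fourier_proj A n \<Phi> \<tau>"
    using \<tau> z by (simp add: siegel_line_def fourier_int_line)
qed

lemma homog_fourier_proj_other: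
  assumes h: "homog B m \<Phi>"
  shows "homog B m (fourier_proj A n \<Phi>)"
  unfolding homog_def
proof (intro ballI allI impI)
  fix \<tau> \<zeta> assume \<tau>: "\<tau> \<in> siegel" and z: "\<tau> + cscale \<zeta> (unit_sym B) \<in> siegel"
  have "\<Phi> (\<tau> + cscale \<zeta> (unit_sym B) + cscale (of_real s) (unit_sym A)) = ee (of_int m * \<zeta>) * \<Phi> (\<tau> + cscale (of_real s) (unit_sym A))" for s
  proof -
    have "\<tau> + cscale (of_real s) (unit_sym A) \<in> siegel" "\<tau> + cscale (of_real s) (unit_sym A) + cscale \<zeta> (unit_sym B) \<in> siegel"
      using siegel_shift_of_real[OF \<tau>] siegel_shift_of_real[OF z, of s A] by (auto simp: add_ac)
    moreover have "\<tau> + cscale \<zeta> (unit_sym B) + cscale (of_real s) (unit_sym A) = \<tau> + cscale (of_real s) (unit_sym A) + cscale \<zeta> (unit_sym B)"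
      by simp
    ultimately show ?thesis using h unfolding homog_def by metis
  qed
  then show "fourier_proj A n \<Phi> (\<tau> + cscale \<zeta> (unit_sym B)) = ee (of_int m * \<zeta>) * fourier_proj A n \<Phi> \<tau>"
    unfolding fourier_proj_def by (simp add: mult.assoc)
qed

lemma fourier_proj_has_sum:
  assumes "siegel_periodic \<Phi>" "A \<in> pairs" "\<tau> \<in> siegel"
  shows "((\<lambda>n. fourier_proj A n \<Phi> \<tau>) has_sum \<Phi> \<tau>) UNIV"
proof -
  interpret periodic_strip "siegel_line \<tau> A" "\<lambda>\<zeta>. \<Phi> (\<tau> + cscale \<zeta> (unit_sym A))"
    by (rule siegel_periodic_strip[OF assms(1) assms(3) assms(2)])
  from fourier_int_has_sum[of 0] show ?thesis using assms by (simp add: siegel_line_0 fourier_int_line)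
qed

lemma norm_vec_le_sum: "norm x \<le> (\<Sum>i\<in>UNIV. norm (x $ i))"
  by (simp add: norm_vec_def L2_set_le_sum)

text \<open>Room for \<open>k\<close> one-variable contour shifts starting at \<open>\<tau>\<close>:
  each moves real parts by at most 1 and imaginary parts by at most \<open>d\<close>. Compactness
  bounds a continuous function on it.\<close>

definition siegel_box :: "complex^'g::finite^'g \<Rightarrow> real \<Rightarrow> real \<Rightarrow> (complex^'g^'g) set" where
  "siegel_box \<tau> d k = {\<sigma>. transpose \<sigma> = \<sigma> \<and> (\<forall>a b. \<bar>Re (\<sigma> $ a $ b - \<tau> $ a $ b)\<bar> \<le> k \<and> \<bar>Im (\<sigma> $ a $ b - \<tau> $ a $ b)\<bar> \<le> k * d)}"

lemma compact_siegel_box: "compact (siegel_box \<tau> d k)"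
  unfolding compact_eq_bounded_closed
proof
  show "closed (siegel_box \<tau> d k)"
  proof -
    have "siegel_box \<tau> d k = (\<Inter>a. \<Inter>b. {\<sigma>. \<sigma> $ b $ a = \<sigma> $ a $ b} \<inter>
        {\<sigma>. \<bar>Re (\<sigma> $ a $ b - \<tau> $ a $ b)\<bar> \<le> k} \<inter> {\<sigma>. \<bar>Im (\<sigma> $ a $ b - \<tau> $ a $ b)\<bar> \<le> k * d})"
      by (auto simp: siegel_box_def transpose_def vec_eq_iff)
    also have "closed \<dots>"
      by (intro closed_INT ballI closed_Int closed_Collect_eq closed_Collect_le continuous_intros)
    finally show ?thesis .
  qed
  have "norm (\<sigma> - \<tau>) \<le> (\<Sum>a\<in>(UNIV::'a set). \<Sum>b\<in>(UNIV::'a set). k + k * d)" if "\<sigma> \<in> siegel_box \<tau> d k" for \<sigma>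
  proof -
    have "norm (\<sigma> - \<tau>) \<le> (\<Sum>a\<in>UNIV. norm ((\<sigma> - \<tau>) $ a))" by (rule norm_vec_le_sum)
    also have "\<dots> \<le> (\<Sum>a\<in>UNIV. \<Sum>b\<in>UNIV. norm ((\<sigma> - \<tau>) $ a $ b))" by (intro sum_mono norm_vec_le_sum)
    also have "\<dots> \<le> (\<Sum>a\<in>(UNIV::'a set). \<Sum>b\<in>(UNIV::'a set). k + k * d)"
      by (intro sum_mono order_trans[OF cmod_le] add_mono) (use that in \<open>auto simp: siegel_box_def\<close>)
    finally show ?thesis .
  qed
  then have "siegel_box \<tau> d k \<subseteq> cball \<tau> (\<Sum>a\<in>(UNIV::'a set). \<Sum>b\<in>(UNIV::'a set). k + k * d)"
    by (auto simp: dist_norm norm_minus_commute)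
  then show "bounded (siegel_box \<tau> d k)" using bounded_cball bounded_subset by blast
qed

lemma siegel_box_block_bound:
  assumes "\<sigma> \<in> siegel_box \<tau> d k" "\<bar>Re z\<bar> \<le> 1" "\<bar>Im z\<bar> \<le> d" "0 \<le> d"
  shows "\<sigma> + cscale z (unit_sym A) \<in> siegel_box \<tau> d (k + 1)"
proof -
  have "transpose (\<sigma> + cscale z (unit_sym A)) = \<sigma> + cscale z (unit_sym A)"
    using assms by (simp add: siegel_box_def transpose_add transpose_cscale)
  moreover have "\<bar>Re ((\<sigma> + cscale z (unit_sym A)) $ a $ b - \<tau> $ a $ b)\<bar> \<le> k + 1"
     and "\<bar>Im ((\<sigma> + cscale z (unit_sym A)) $ a $ b - \<tau> $ a $ b)\<bar> \<le> (k + 1) * d" for a b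
  proof -
    have r: "\<bar>Re (\<sigma> $ a $ b - \<tau> $ a $ b)\<bar> \<le> k" "\<bar>Im (\<sigma> $ a $ b - \<tau> $ a $ b)\<bar> \<le> k * d"
      using assms(1) by (auto simp: siegel_box_def)
    show "\<bar>Re ((\<sigma> + cscale z (unit_sym A)) $ a $ b - \<tau> $ a $ b)\<bar> \<le> k + 1"
      using r(1) assms(2) by (auto simp: cscale_def unit_sym_def)
    show "\<bar>Im ((\<sigma> + cscale z (unit_sym A)) $ a $ b - \<tau> $ a $ b)\<bar> \<le> (k + 1) * d"
      using r(2) assms(3,4) by (auto simp: cscale_def unit_sym_def distrib_right)
  qed
  ultimately show ?thesis unfolding siegel_box_def by blast
qed

fun fourier_projs :: "('g::finite set \<times> int) list \<Rightarrow> (complex^'g^'g \<Rightarrow> complex) \<Rightarrow> complex^'g^'g \<Rightarrow> complex" where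
  "fourier_projs [] \<Phi> = \<Phi>"
| "fourier_projs ((A, n) # r) \<Phi> = fourier_projs r (fourier_proj A n \<Phi>)"

lemma fourier_projs_homog: "homog A n \<Phi> \<Longrightarrow> homog A n (fourier_projs r \<Phi>)"
  by (induction r \<Phi> rule: fourier_projs.induct) (auto intro: homog_fourier_proj_other)

lemma fourier_projs_homog_mem:
  assumes "siegel_periodic \<Phi>" "set As \<subseteq> pairs" "length ns = length As" "(A, n) \<in> set (zip As ns)"
  shows "homog A n (fourier_projs (zip As ns) \<Phi>)"
  using assms
proof (induction As arbitrary: ns \<Phi>)
  case (Cons B As)
  then obtain m ms where ns: "ns = m # ms" by (cases ns) auto
  have B: "B \<in> pairs" using Cons.prems by simp
  show ?case
  proof (cases "(A, n) = (B, m)")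
    case True
    then show ?thesis using fourier_projs_homog[OF homog_fourier_proj[OF Cons.prems(1) B]] by (simp add: ns)
  next
    case False
    then show ?thesis using Cons.IH[OF siegel_periodic_fourier_proj[OF Cons.prems(1) B, of m], of ms] Cons.prems by (auto simp: ns)
  qed
qed simp

text \<open>Each projection spends one unit of the size of the box and earns one geometric factor.
  The contours of successive projections add up, hence the bound on the full box at the
  start.\<close>

lemma fourier_projs_bound:
  assumes "siegel_periodic \<Phi>" "set As \<subseteq> pairs" "length ns = length As" "0 \<le> d"
    "\<And>\<sigma>. \<sigma> \<in> siegel_box \<tau> d (length As) \<Longrightarrow> \<sigma> \<in> siegel \<and> norm (\<Phi> \<sigma>) \<le> C" "\<tau> \<in> siegel"
  shows "norm (fourier_projs (zip As ns) \<Phi> \<tau>) \<le> C * (\<Prod>n\<leftarrow>ns. exp (- (2 * pi * d)) ^ nat \<bar>n\<bar>)"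
  using assms(1-5)
proof (induction As arbitrary: ns \<Phi> C)
  case Nil
  have "\<tau> \<in> siegel_box \<tau> d 0" using assms(6) by (auto simp: siegel_box_def siegelD_sym)
  then show ?case using Nil by auto
next
  case (Cons B As)
  obtain m ms where ns: "ns = m # ms" using Cons.prems by (cases ns) auto
  have B: "B \<in> pairs" using Cons.prems by simp
  have mem: "\<sigma> + cscale z (unit_sym B) \<in> siegel_box \<tau> d (length (B # As))"
    if "\<sigma> \<in> siegel_box \<tau> d (length As)" "\<bar>Re z\<bar> \<le> 1" "\<bar>Im z\<bar> \<le> d" for \<sigma> z
    using siegel_box_block_bound[OF that Cons.prems(4)] by (simp add: add.commute)
  have "\<sigma> \<in> siegel \<and> norm (fourier_proj B m \<Phi> \<sigma>) \<le> C * exp (- (2 * pi * d)) ^ nat \<bar>m\<bar>" if s: "\<sigma> \<in> siegel_box \<tau> d (length As)" for \<sigma>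
  proof
    show sg: "\<sigma> \<in> siegel"
      using mem[OF s, of 0] Cons.prems(4,5) by auto
    interpret periodic_strip "siegel_line \<sigma> B" "\<lambda>\<zeta>. \<Phi> (\<sigma> + cscale \<zeta> (unit_sym B))"
      by (rule siegel_periodic_strip[OF Cons.prems(1) sg B])
    have "norm (fourier_int (\<lambda>\<zeta>. \<Phi> (\<sigma> + cscale \<zeta> (unit_sym B))) m 0) \<le> C * exp (- (2 * pi * d)) ^ nat \<bar>m\<bar>"
      by (rule fourier_int_bound)
        (use Cons.prems(4) mem[OF s] Cons.prems(5) in \<open>auto simp: siegel_line_def sg\<close>)
    then show "norm (fourier_proj B m \<Phi> \<sigma>) \<le> C * exp (- (2 * pi * d)) ^ nat \<bar>m\<bar>"
      by (simp add: fourier_int_line)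
  qed
  from Cons.IH[OF siegel_periodic_fourier_proj[OF Cons.prems(1) B] _ _ Cons.prems(4) this, of ms] Cons.prems ns
  show ?case by (simp add: mult.assoc)
qed

lemma bij_betw_Cons_lists:
  "bij_betw (\<lambda>(n, ns). n # ns) (UNIV \<times> {ns. length ns = k}) {ns. length ns = Suc k}"
  by (rule bij_betwI[where g = "\<lambda>ns. (hd ns, tl ns)"]) (auto simp: length_Suc_conv)

lemma summable_prod_list:
  fixes f :: "'a \<Rightarrow> real"
  assumes f: "f summable_on UNIV" "\<And>x. f x \<ge> 0"
  shows "(\<lambda>ns. \<Prod>n\<leftarrow>ns. f n) summable_on {ns. length ns = k}"
proof (induction k)
  case (Suc k)
  obtain s where s: "((\<lambda>ns. \<Prod>n\<leftarrow>ns. f n) has_sum s) {ns. length ns = k}"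
    using Suc by (auto simp: summable_on_def)
  have "(\<lambda>(n, ns). f n * (\<Prod>n\<leftarrow>ns. f n)) summable_on (UNIV \<times> {ns. length ns = k})"
  proof (rule summable_on_SigmaI[where g = "\<lambda>n. f n * s"])
    show "((\<lambda>y. case (x, y) of (n, ns) \<Rightarrow> f n * (\<Prod>n\<leftarrow>ns. f n)) has_sum f x * s) {ns. length ns = k}" for x
      using has_sum_cmult_right[OF s, of "f x"] by simp
    show "(\<lambda>n. f n * s) summable_on UNIV" by (rule summable_on_cmult_left[OF f(1)])
    show "(case x of (n, ns) \<Rightarrow> f n * (\<Prod>n\<leftarrow>ns. f n)) \<ge> 0" for x
      by (cases x) (auto intro!: mult_nonneg_nonneg prod_list_nonneg f(2))
  qed
  then have "(\<lambda>p. (\<lambda>ns. \<Prod>n\<leftarrow>ns. f n) (case p of (n, ns) \<Rightarrow> n # ns)) summable_on (UNIV \<times> {ns. length ns = k})"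
    by (simp add: case_prod_unfold)
  then show ?case using summable_on_reindex_bij_betw[OF bij_betw_Cons_lists] by blast
qed simp

text \<open>Absolute summability over all exponent lists at once comes from the geometric bound;
  only with it may the iterated one-variable expansions be combined into a sum over the
  product.\<close>

lemma fourier_projs_has_sum:
  assumes "siegel_periodic \<Phi>" "set As \<subseteq> pairs" "\<tau> \<in> siegel"
  shows "(\<lambda>ns. norm (fourier_projs (zip As ns) \<Phi> \<tau>)) summable_on {ns. length ns = length As} \<and>
    ((\<lambda>ns. fourier_projs (zip As ns) \<Phi> \<tau>) has_sum \<Phi> \<tau>) {ns. length ns = length As}"
  using assms(1,2)
proof (induction As arbitrary: \<Phi>)
  case (Cons B As)
  have B: "B \<in> pairs" using Cons.prems by simp
  \<comment> \<open>With steps of size \<open>d / N\<close> the box for all remaining projections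
    stays in the half space.\<close>
  define N where "N = real (length (B # As))"
  have N: "N > 0" by (simp add: N_def)
  obtain d where d: "d > 0" "\<And>X. transpose X = X \<Longrightarrow> (\<And>a b. \<bar>Im (X $ a $ b)\<bar> \<le> d) \<Longrightarrow> \<tau> + X \<in> siegel"
    using siegel_perturb[OF assms(3)] by blast
  have sub: "siegel_box \<tau> (d / N) N \<subseteq> siegel"
  proof
    fix \<sigma> assume s: "\<sigma> \<in> siegel_box \<tau> (d / N) N"
    have "\<tau> + (\<sigma> - \<tau>) \<in> siegel"
      using d(2)[of "\<sigma> - \<tau>"] s siegelD_sym[OF assms(3)] N
      by (auto simp: siegel_box_def transpose_def vec_eq_iff)
    then show "\<sigma> \<in> siegel" by simp
  qed
  have "continuous_on (siegel_box \<tau> (d / N) N) \<Phi>"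
    using Cons.prems(1) sub unfolding siegel_periodic_def by (meson continuous_on_subset)
  from compact_imp_bounded[OF compact_continuous_image[OF this compact_siegel_box]]
  obtain C where C: "\<And>\<sigma>. \<sigma> \<in> siegel_box \<tau> (d / N) N \<Longrightarrow> norm (\<Phi> \<sigma>) \<le> C"
    unfolding bounded_iff by blast
  define r where "r = exp (- (2 * pi * (d / N)))"
  have r: "0 < r" "r < 1" using d N by (auto simp: r_def)
  have bd: "norm (fourier_projs (zip (B # As) ns) \<Phi> \<tau>) \<le> C * (\<Prod>n\<leftarrow>ns. r ^ nat \<bar>n\<bar>)" if "length ns = length (B # As)" for ns
    unfolding r_def by (rule fourier_projs_bound) (use Cons.prems that d N assms(3) C sub in \<open>auto simp: N_def\<close>)
  have "(\<lambda>ns. C * (\<Prod>n\<leftarrow>ns. r ^ nat \<bar>n\<bar>)) summable_on {ns. length ns = length (B # As)}"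
    by (intro summable_on_cmult_right summable_prod_list abs_summable_geometric_int r) (use r in auto)
  then have sm: "(\<lambda>ns. norm (fourier_projs (zip (B # As) ns) \<Phi> \<tau>)) summable_on {ns. length ns = length (B # As)}"
    by (rule summable_on_comparison_test) (use bd in auto)
  have "(\<lambda>ns. fourier_projs (zip (B # As) ns) \<Phi> \<tau>) summable_on {ns. length ns = Suc (length As)}"
    using abs_summable_summable[OF sm] by simp
  then have "(\<lambda>p. fourier_projs (zip (B # As) (case p of (n, ns) \<Rightarrow> n # ns)) \<Phi> \<tau>) summable_on (UNIV \<times> {ns. length ns = length As})"
    by (subst summable_on_reindex_bij_betw[OF bij_betw_Cons_lists, where f = "\<lambda>ns. fourier_projs (zip (B # As) ns) \<Phi> \<tau>"])
  then have s1: "(\<lambda>(n, ns). fourier_projs (zip As ns) (fourier_proj B n \<Phi>) \<tau>) summable_on (UNIV \<times> {ns. length ns = length As})"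
    by (simp add: case_prod_unfold)
  have "((\<lambda>(n, ns). fourier_projs (zip As ns) (fourier_proj B n \<Phi>) \<tau>) has_sum \<Phi> \<tau>) (UNIV \<times> {ns. length ns = length As})"
  proof (rule has_sum_SigmaI[OF _ _ s1])
    show "((\<lambda>y. case (x, y) of (n, ns) \<Rightarrow> fourier_projs (zip As ns) (fourier_proj B n \<Phi>) \<tau>) has_sum fourier_proj B x \<Phi> \<tau>) {ns. length ns = length As}" for x
      using Cons.IH[of "fourier_proj B x \<Phi>"] Cons.prems B by (auto intro: siegel_periodic_fourier_proj)
    show "((\<lambda>n. fourier_proj B n \<Phi> \<tau>) has_sum \<Phi> \<tau>) UNIV"
      by (rule fourier_proj_has_sum[OF Cons.prems(1) B assms(3)])
  qed
  then have "((\<lambda>p. fourier_projs (zip (B # As) (case p of (n, ns) \<Rightarrow> n # ns)) \<Phi> \<tau>) has_sum \<Phi> \<tau>) (UNIV \<times> {ns. length ns = length As})"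
    by (simp add: case_prod_unfold)
  then have "((\<lambda>ns. fourier_projs (zip (B # As) ns) \<Phi> \<tau>) has_sum \<Phi> \<tau>) {ns. length ns = Suc (length As)}"
    by (subst (asm) has_sum_reindex_bij_betw[OF bij_betw_Cons_lists, where f = "\<lambda>ns. fourier_projs (zip (B # As) ns) \<Phi> \<tau>"])
  then show ?case using sm by simp
qed (auto intro!: has_sum_finiteI simp: assms)

section \<open>Characters indexed by half-integral matrices and the existence of Fourier
  expansions\<close>

definition pairing :: "real^'g::finite^'g \<Rightarrow> complex^'g^'g \<Rightarrow> complex" where
  "pairing t M = (\<Sum>a\<in>UNIV. \<Sum>b\<in>UNIV. of_real (t $ a $ b) * M $ a $ b)"

text \<open>The exponent of the character \<open>ee (pairing t \<tau>)\<close> along the coordinate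
  \<open>A\<close>: a diagonal entry of \<open>t\<close>, or twice an off-diagonal one when
  \<open>t\<close> is symmetric. Half-integrality makes all of them integers.\<close>

definition pair_entry :: "real^'g::finite^'g \<Rightarrow> 'g set \<Rightarrow> real" where
  "pair_entry t A = (\<Sum>a\<in>UNIV. \<Sum>b\<in>UNIV. if {a, b} = A then t $ a $ b else 0)"

lemma pairing_add: "pairing t (M + N) = pairing t M + pairing t N"
  by (simp add: pairing_def sum.distrib algebra_simps)

lemma pairing_cscale: "pairing t (cscale z M) = z * pairing t M"
  by (simp add: pairing_def cscale_def sum_distrib_left mult_ac)

lemma pairing_unit_sym: "pairing t (unit_sym A) = of_real (pair_entry t A)"
  by (simp add: pairing_def pair_entry_def unit_sym_def if_distrib[of "\<lambda>x. _ * x"] if_distrib[of of_real] cong: if_cong)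

lemma sum_delta2:
  fixes c :: "'b::comm_monoid_add"
  shows "(\<Sum>x\<in>(UNIV::'a::finite set). \<Sum>y\<in>(UNIV::'c::finite set). if x = a then if y = b then c else 0 else 0) = c"
proof -
  have "(\<Sum>y\<in>(UNIV::'c set). if x = a then if y = b then c else 0 else 0) = (if x = a then c else 0)" for x :: 'a
    by (cases "x = a") auto
  then show ?thesis by simp
qed

lemma pair_entry_single: "pair_entry t {a} = t $ a $ a"
proof -
  have "(if {x, y} = {a} then t $ x $ y else 0) = (if x = a then (if y = a then t $ a $ a else 0) else 0)" for x y
    by auto
  then show ?thesis unfolding pair_entry_def by (simp only: sum_delta2)
qed

lemma pair_entry_pair:
  assumes "transpose t = t" "a \<noteq> b" shows "pair_entry t {a, b} = 2 * t $ a $ b"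
proof -
  have "(if {x, y} = {a, b} then t $ x $ y else 0) =
     (if x = a then (if y = b then t $ a $ b else 0) else 0) + (if x = b then (if y = a then t $ b $ a else 0) else 0)" for x y
    using assms(2) by (auto simp: doubleton_eq_iff)
  then show ?thesis unfolding pair_entry_def using sym_nth[OF assms(1), of a b] by (simp only: sum.distrib sum_delta2)
qed

lemma pair_entry_Ints: "half_integral t \<Longrightarrow> A \<in> pairs \<Longrightarrow> pair_entry t A \<in> \<int>"
  unfolding pairs_iff half_integral_def
  by (metis pair_entry_pair pair_entry_single insert_absorb2)

lemma eq_by_entries:
  assumes "transpose t = t" "transpose t' = t'" "\<And>A. A \<in> pairs \<Longrightarrow> pair_entry t A = pair_entry t' A"
  shows "t = t'"
proof -
  have "t $ a $ b = t' $ a $ b" for a b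
  proof (cases "a = b")
    case True
    then show ?thesis using assms(3)[of "{a}"] pairsI[of a a] by (simp add: pair_entry_single)
  next
    case False
    then show ?thesis using assms(3)[of "{a, b}"] assms by (simp add: pair_entry_pair)
  qed
  then show ?thesis by (simp add: vec_eq_iff)
qed

definition of_entries :: "('g::finite set \<Rightarrow> int) \<Rightarrow> real^'g^'g" where
  "of_entries f = (\<chi> a b. if a = b then of_int (f {a}) else of_int (f {a, b}) / 2)"

lemma of_entries: "half_integral (of_entries f)" "A \<in> pairs \<Longrightarrow> pair_entry (of_entries f) A = of_int (f A)"
proof -
  have s: "transpose (of_entries f) = of_entries f" by (simp add: of_entries_def transpose_def vec_eq_iff insert_commute)
  then show "half_integral (of_entries f)" unfolding half_integral_def by (auto simp: of_entries_def)
  assume "A \<in> pairs"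
  then obtain a b where "A = {a, b}" by (auto simp: pairs_iff)
  then show "pair_entry (of_entries f) A = of_int (f A)"
  proof (cases "a = b")
    case True
    then show ?thesis using \<open>A = {a, b}\<close> pair_entry_single[of "of_entries f" b] by (simp add: of_entries_def)
  next
    case False
    then show ?thesis using \<open>A = {a, b}\<close> pair_entry_pair[OF s False] by (simp add: of_entries_def)
  qed
qed

text \<open>After division by the expected character the function is constant along every coordinate
  line. Small symmetric perturbations are sums of coordinate moves, so it is locally constant, and
  the half space is convex, hence connected.\<close>

lemma homog_const:
  fixes G :: "complex^'g::finite^'g \<Rightarrow> complex"
  assumes h: "\<And>A. A \<in> pairs \<Longrightarrow> homog A (n A) G" and t: "\<And>A. A \<in> pairs \<Longrightarrow> pair_entry t A = of_int (n A)"
  obtains c where "\<And>\<tau>. \<tau> \<in> siegel \<Longrightarrow> G \<tau> = c * ee (pairing t \<tau>)"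
proof -
  define K where "K = (\<lambda>\<tau>. G \<tau> * ee (- pairing t \<tau>))"
  have block_bound: "K (\<tau> + cscale z (unit_sym A)) = K \<tau>" if "\<tau> \<in> siegel" "A \<in> pairs" "\<tau> + cscale z (unit_sym A) \<in> siegel" for \<tau> z A
    using h[OF that(2)] that unfolding homog_def K_def
    by (simp add: pairing_add pairing_cscale pairing_unit_sym t ee_add[symmetric] mult_ac)
  have loc: "\<exists>d>0. \<forall>X. transpose X = X \<longrightarrow> (\<forall>a b. \<bar>Im (X $ a $ b)\<bar> \<le> d) \<longrightarrow> K (\<tau> + X) = K \<tau>" if tau: "\<tau> \<in> siegel" for \<tau>
  proof -
    obtain d where d: "d > 0" "\<And>X. transpose X = X \<Longrightarrow> (\<And>a b. \<bar>Im (X $ a $ b)\<bar> \<le> d) \<Longrightarrow> \<tau> + X \<in> siegel"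
      using siegel_perturb[OF tau] by blast
    have "K (\<tau> + X) = K \<tau>" if X: "transpose X = X" "\<And>a b. \<bar>Im (X $ a $ b)\<bar> \<le> d" for X
    proof -
      \<comment> \<open>The perturbation is built up one coordinate at a time. Every partial matrix
        obeys the same bound as \<open>X\<close>, so all intermediate points stay in the half
        space.\<close>
      define XP where "XP = (\<lambda>P::'g set set. \<chi> a b. if {a, b} \<in> P then X $ a $ b else 0)"
      have sy: "transpose (XP P) = XP P" for P
        using sym_nth[OF X(1)] by (simp add: XP_def transpose_def vec_eq_iff insert_commute)
      have S: "\<tau> + XP P \<in> siegel" for P
        by (rule d(2)[OF sy]) (use X(2) d(1) in \<open>auto simp: XP_def\<close>)
      have "K (\<tau> + XP P) = K \<tau>" if "P \<subseteq> pairs" for P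
        using finite_subset[OF that finite_pairs] that
      proof (induction P)
        case empty
        have "XP {} = 0" by (simp add: XP_def vec_eq_iff)
        then show ?case by simp
      next
        case (insert A P)
        obtain a b where A: "A = {a, b}" using insert.prems by (auto simp: pairs_iff)
        have "XP (insert A P) = XP P + cscale (X $ a $ b) (unit_sym A)"
        proof -
          have "XP (insert A P) $ i $ j = (XP P + cscale (X $ a $ b) (unit_sym A)) $ i $ j" for i j
          proof (cases "{i, j} = A")
            case True
            then have "X $ i $ j = X $ a $ b"
              using sym_nth[OF X(1), of a b] unfolding A doubleton_eq_iff by metis
            moreover have "A \<notin> P" by fact
            ultimately show ?thesis using True by (simp add: XP_def cscale_def unit_sym_def)
          qed (simp add: XP_def cscale_def unit_sym_def)
          then show ?thesis by (simp add: vec_eq_iff)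
        qed
        then have "K (\<tau> + XP (insert A P)) = K (\<tau> + XP P)"
          using block_bound[OF S[of P], of A "X $ a $ b"] S[of "insert A P"] insert.prems by (simp add: add.assoc)
        then show ?case using insert by simp
      qed
      from this[of pairs] show ?thesis by (simp add: XP_def)
    qed
    then show ?thesis using d(1) by blast
  qed
  have "\<forall>\<tau>\<in>siegel. eventually (\<lambda>\<sigma>. K \<tau> = K \<sigma>) (at \<tau> within siegel)"
  proof
    fix \<tau> :: "complex^'g^'g" assume tau: "\<tau> \<in> siegel"
    obtain d where d: "d > 0" "\<And>X. transpose X = X \<Longrightarrow> (\<And>a b. \<bar>Im (X $ a $ b)\<bar> \<le> d) \<Longrightarrow> K (\<tau> + X) = K \<tau>"
      using loc[OF tau] by blast
    show "eventually (\<lambda>\<sigma>. K \<tau> = K \<sigma>) (at \<tau> within siegel)"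
      unfolding eventually_at
    proof (intro exI[of _ d] conjI ballI impI d(1))
      fix \<sigma> assume s: "\<sigma> \<in> siegel" "\<sigma> \<noteq> \<tau> \<and> dist \<sigma> \<tau> < d"
      have "\<bar>Im ((\<sigma> - \<tau>) $ a $ b)\<bar> \<le> d" for a b
      proof -
        have "\<bar>Im ((\<sigma> - \<tau>) $ a $ b)\<bar> \<le> norm ((\<sigma> - \<tau>) $ a $ b)" by (rule abs_Im_le_cmod)
        also have "\<dots> \<le> norm ((\<sigma> - \<tau>) $ a)" by (rule Finite_Cartesian_Product.norm_nth_le)
        also have "\<dots> \<le> norm (\<sigma> - \<tau>)" by (rule Finite_Cartesian_Product.norm_nth_le)
        finally show ?thesis using s by (simp add: dist_norm)
      qed
      then have "K (\<tau> + (\<sigma> - \<tau>)) = K \<tau>"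
        using siegelD_sym[OF tau] siegelD_sym[OF s(1)]
        by (intro d(2)) (auto simp: transpose_def vec_eq_iff)
      then show "K \<tau> = K \<sigma>" by simp
    qed
  qed
  then have "K \<tau> = K \<sigma>" if "\<tau> \<in> siegel" "\<sigma> \<in> siegel" for \<tau> \<sigma>
    using connected_local_const[OF convex_connected[OF convex_siegel]] that by blast
  then obtain c where c: "\<And>\<tau>. \<tau> \<in> siegel \<Longrightarrow> K \<tau> = c" by metis
  show ?thesis
  proof
    fix \<tau> :: "complex^'g^'g" assume "\<tau> \<in> siegel"
    from c[OF this] show "G \<tau> = c * ee (pairing t \<tau>)"
      by (auto simp: K_def ee_minus field_simps)
  qed
qed

definition fourier_exp :: "(complex^'g::finite^'g \<Rightarrow> complex) \<Rightarrow> (real^'g^'g \<Rightarrow> complex) \<Rightarrow> bool" where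
  "fourier_exp \<Phi> c \<longleftrightarrow> (\<forall>\<tau>\<in>siegel. ((\<lambda>t. c t * ee (pairing t \<tau>)) has_sum \<Phi> \<tau>) (Collect half_integral))"

text \<open>One projection for every coordinate leaves a multiple of a character, by
  \<open>homog_const\<close>. Exponent lists along the enumeration \<open>As\<close> correspond
  bijectively to half-integral matrices, through \<open>of_entries\<close> and
  \<open>nsof\<close>.\<close>

theorem siegel_fourier_exists:
  fixes \<Phi> :: "complex^'g::finite^'g \<Rightarrow> complex"
  assumes "siegel_periodic \<Phi>"
  obtains c where "fourier_exp \<Phi> c"
proof -
  obtain As :: "'g set list" where As: "set As = pairs" "distinct As"
    using finite_distinct_list[of "pairs :: 'g set set"] by auto
  define f where "f = (\<lambda>ns A. the (map_of (zip As ns) A) :: int)"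
  define nsof where "nsof = (\<lambda>t::real^'g^'g. map (\<lambda>A. \<lfloor>pair_entry t A\<rfloor>) As)"
  have "\<exists>c. \<forall>\<tau>\<in>siegel. fourier_projs (zip As ns) \<Phi> \<tau> = c * ee (pairing (of_entries (f ns)) \<tau>)" if l: "length ns = length As" for ns
  proof -
    have "homog A (f ns A) (fourier_projs (zip As ns) \<Phi>)" if "A \<in> pairs" for A
    proof (rule fourier_projs_homog_mem[OF assms _ l])
      have "A \<in> dom (map_of (zip As ns))" using that As l by (simp add: dom_map_of_zip)
      then obtain n where "map_of (zip As ns) A = Some n" by blast
      then show "(A, f ns A) \<in> set (zip As ns)" by (auto simp: f_def dest: map_of_SomeD)
    qed (use As in auto)
    from homog_const[of "f ns", OF this of_entries(2)] show ?thesis by metis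
  qed
  then obtain c where c: "\<And>ns \<tau>. length ns = length As \<Longrightarrow> \<tau> \<in> siegel \<Longrightarrow> fourier_projs (zip As ns) \<Phi> \<tau> = c ns * ee (pairing (of_entries (f ns)) \<tau>)"
    by metis
  have fn: "f (nsof t) A = \<lfloor>pair_entry t A\<rfloor>" if "A \<in> pairs" for t A
    using that As by (simp add: f_def nsof_def map_of_zip_map)
  have 1: "of_entries (f (nsof t)) = t" if "half_integral t" for t
  proof (rule eq_by_entries)
    show "pair_entry (of_entries (f (nsof t))) A = pair_entry t A" if A: "A \<in> pairs" for A
      using pair_entry_Ints[OF \<open>half_integral t\<close> A] by (simp add: of_entries A fn)
  qed (use that of_entries(1) in \<open>auto simp: half_integral_def\<close>)
  have 2: "nsof (of_entries (f ns)) = ns" if l: "length ns = length As" for ns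
  proof (rule nth_equalityI)
    show "length (nsof (of_entries (f ns))) = length ns" by (simp add: nsof_def l)
    fix i assume "i < length (nsof (of_entries (f ns)))"
    then have i: "i < length As" by (simp add: nsof_def)
    have "As ! i \<in> pairs" using i As nth_mem by blast
    then have "nsof (of_entries (f ns)) ! i = f ns (As ! i)" using i by (simp add: nsof_def of_entries)
    also have "\<dots> = ns ! i" unfolding f_def using As(2) i l by (simp add: map_of_zip_nth)
    finally show "nsof (of_entries (f ns)) ! i = ns ! i" .
  qed
  have "fourier_exp \<Phi> (\<lambda>t. c (nsof t))"
    unfolding fourier_exp_def
  proof
    fix \<tau> :: "complex^'g^'g" assume tau: "\<tau> \<in> siegel"
    have "((\<lambda>ns. fourier_projs (zip As ns) \<Phi> \<tau>) has_sum \<Phi> \<tau>) {ns. length ns = length As}"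
      using fourier_projs_has_sum[OF assms _ tau, of As] As by simp
    also have "?this \<longleftrightarrow> ((\<lambda>t. c (nsof t) * ee (pairing t \<tau>)) has_sum \<Phi> \<tau>) (Collect half_integral)"
    proof (rule has_sum_reindex_bij_witness[where i = nsof and j = "\<lambda>ns. of_entries (f ns)"])
      show "nsof t \<in> {ns. length ns = length As}" for t by (simp add: nsof_def)
    qed (auto simp: 1 2 of_entries c tau)
    finally show "((\<lambda>t. c (nsof t) * ee (pairing t \<tau>)) has_sum \<Phi> \<tau>) (Collect half_integral)" .
  qed
  then show ?thesis by (rule that)
qed

section \<open>Averages and restricted Fourier sums\<close>

lemma average_ee:
  assumes "N > 0"
  shows "(\<Sum>s<N. ee (of_int m * of_nat s / of_nat N)) = (if int N dvd m then of_nat N else 0)"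
proof -
  define w where "w = ee (of_int m / of_nat N)"
  have pw: "ee (of_int m * of_nat s / of_nat N) = w ^ s" for s
    by (simp add: w_def ee_power mult_ac)
  have wN: "w ^ N = 1"
    using assms by (simp add: w_def ee_power)
  have w1: "w = 1 \<longleftrightarrow> int N dvd m"
  proof
    assume "w = 1"
    then obtain k :: int where "complex_of_int m / of_nat N = of_int k" by (auto simp: w_def ee_eq_1)
    then have "complex_of_int m = of_int (k * int N)" using assms by (simp add: field_simps)
    then have "m = k * int N" by (simp only: of_int_eq_iff)
    then show "int N dvd m" by simp
  next
    assume "int N dvd m"
    then obtain k where "m = int N * k" by auto
    then have "complex_of_int m / of_nat N = of_int k" using assms by simp
    then show "w = 1" by (simp add: w_def)
  qed
  show ?thesis
  proof (cases "w = 1")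
    case True
    then show ?thesis using w1 by (simp add: pw)
  next
    case False
    have "(\<Sum>s<N. w ^ s) = 0" using geometric_sum[OF False, of N] wN by simp
    then show ?thesis using False w1 by (simp add: pw)
  qed
qed

lemma has_sum_finite_sum:
  fixes f :: "'i \<Rightarrow> 'x \<Rightarrow> 'a::topological_comm_monoid_add"
  assumes "finite I" "\<And>i. i \<in> I \<Longrightarrow> (f i has_sum x i) T"
  shows "((\<lambda>t. \<Sum>i\<in>I. f i t) has_sum (\<Sum>i\<in>I. x i)) T"
  using assms by (induction I) (auto intro!: has_sum_add)

text \<open>Averaging over N-th roots of unity keeps exactly the indices with \<open>n t\<close>
  congruent to \<open>m\<close> modulo \<open>N\<close>. For large \<open>N\<close>, congruence and
  equality differ only outside a finite set that carries almost all of the absolute sum. Finite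
  averages are enough, so no integral is exchanged with the sum.\<close>

lemma average_limit:
  fixes a :: "'x \<Rightarrow> complex" and n :: "'x \<Rightarrow> int"
  assumes a: "(\<lambda>t. norm (a t)) summable_on T"
  shows "(\<lambda>N. (\<Sum>s<N. ee (- (of_int m * of_nat s / of_nat N)) *
      infsum (\<lambda>t. a t * ee (of_int (n t) * of_nat s / of_nat N)) T) / of_nat N)
    \<longlonglongrightarrow> infsum a {t \<in> T. n t = m}"
proof (rule LIMSEQ_I)
  fix e :: real assume e: "e > 0"
  have aT: "a summable_on T" using a by (rule abs_summable_summable)
  obtain F where F: "finite F" "F \<subseteq> T" "dist (\<Sum>t\<in>F. norm (a t)) (infsum (\<lambda>t. norm (a t)) T) \<le> e / 2"
    using infsum_finite_approximation[OF a, of "e / 2"] e by auto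
  \<comment> \<open>Larger than every difference occurring in \<open>F\<close>, so inside
    \<open>F\<close> divisibility by \<open>N\<close> forces \<open>n t = m\<close>.\<close>
  define N0 where "N0 = Suc (nat (\<Sum>t\<in>F. \<bar>n t - m\<bar>))"
  have "norm ((\<Sum>s<N. ee (- (of_int m * of_nat s / of_nat N)) *
      infsum (\<lambda>t. a t * ee (of_int (n t) * of_nat s / of_nat N)) T) / of_nat N - infsum a {t \<in> T. n t = m}) < e"
    if N: "N \<ge> N0" for N
  proof -
    have N1: "N > 0" using N by (simp add: N0_def)
    have sm: "(\<lambda>t. a t * ee (of_int (n t) * of_nat s / of_nat N)) summable_on T" for s
      by (rule abs_summable_summable) (simp add: norm_mult norm_ee a)
    have eq1: "(\<Sum>s<N. ee (- (of_int m * of_nat s / of_nat N)) *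
      infsum (\<lambda>t. a t * ee (of_int (n t) * of_nat s / of_nat N)) T) =
      infsum (\<lambda>t. \<Sum>s<N. ee (- (of_int m * of_nat s / of_nat N)) * (a t * ee (of_int (n t) * of_nat s / of_nat N))) T"
      by (rule infsumI[symmetric], rule has_sum_finite_sum)
         (auto intro!: has_sum_cmult_right has_sum_infsum sm)
    have eq2: "(\<Sum>s<N. ee (- (of_int m * of_nat s / of_nat N)) * (a t * ee (of_int (n t) * of_nat s / of_nat N)))
       = of_nat N * (if int N dvd n t - m then a t else 0)" for t
    proof -
      have "ee (- (of_int m * of_nat s / of_nat N)) * (a t * ee (of_int (n t) * of_nat s / of_nat N))
        = a t * ee (of_int (n t - m) * of_nat s / of_nat N)" for s
      proof -
        have "of_int (n t - m) * of_nat s / of_nat N = - (of_int m * of_nat s / of_nat N) + of_int (n t) * of_nat s / (of_nat N :: complex)"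
          by (simp add: algebra_simps diff_divide_distrib)
        then show ?thesis by (simp only: ee_add mult_ac)
      qed
      then have "(\<Sum>s<N. ee (- (of_int m * of_nat s / of_nat N)) * (a t * ee (of_int (n t) * of_nat s / of_nat N)))
         = a t * (\<Sum>s<N. ee (of_int (n t - m) * of_nat s / of_nat N))"
        by (simp only: sum_distrib_left)
      then show ?thesis using average_ee[OF N1, of "n t - m"] by simp
    qed
    define T1 where "T1 = {t \<in> T. int N dvd n t - m}"
    define T0 where "T0 = {t \<in> T. n t = m}"
    have sub: "T0 \<subseteq> T1" "T1 \<subseteq> T" by (auto simp: T0_def T1_def)
    have aT1: "a summable_on T1" using aT sub(2) by (rule summable_on_subset_banach)
    have aT0: "a summable_on T0" using aT1 sub(1) by (rule summable_on_subset_banach)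
    have "infsum (\<lambda>t. of_nat N * (if int N dvd n t - m then a t else 0)) T = of_nat N * infsum a T1"
      unfolding infsum_cmult_right' by (intro arg_cong[where f = "(*) (of_nat N)"] infsum_cong_neutral) (auto simp: T1_def)
    then have "(\<Sum>s<N. ee (- (of_int m * of_nat s / of_nat N)) *
      infsum (\<lambda>t. a t * ee (of_int (n t) * of_nat s / of_nat N)) T) / of_nat N = infsum a T1"
      unfolding eq1 eq2 using N1 by simp
    moreover have "infsum a T1 - infsum a T0 = infsum a (T1 - T0)"
      by (rule infsum_Diff[OF aT1 aT0 sub(1), symmetric])
    moreover have "norm (infsum a (T1 - T0)) \<le> e / 2"
    proof -
      have dj: "T1 - T0 \<subseteq> T - F"
      proof
        fix t assume t: "t \<in> T1 - T0"
        have "t \<notin> F"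
        proof
          assume tF: "t \<in> F"
          have "\<bar>n t - m\<bar> \<le> (\<Sum>t\<in>F. \<bar>n t - m\<bar>)" using member_le_sum[OF tF, of "\<lambda>t. \<bar>n t - m\<bar>"] F by auto
          then have lt: "\<bar>n t - m\<bar> < int N" using N by (simp add: N0_def)
          have "int N dvd n t - m" "n t - m \<noteq> 0" using t by (auto simp: T1_def T0_def)
          then show False using lt dvd_imp_le_int[of "n t - m" "int N"] by simp
        qed
        then show "t \<in> T - F" using t sub by auto
      qed
      have sn: "(\<lambda>t. norm (a t)) summable_on (T - F)" "(\<lambda>t. norm (a t)) summable_on (T1 - T0)"
        using a dj by (meson Diff_subset order_trans summable_on_subset_banach)+
      have "norm (infsum a (T1 - T0)) \<le> infsum (\<lambda>t. norm (a t)) (T1 - T0)"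
        by (rule norm_infsum_bound[OF sn(2)])
      also have "\<dots> \<le> infsum (\<lambda>t. norm (a t)) (T - F)"
        by (rule infsum_mono2[OF sn(2) sn(1) dj]) auto
      also have "\<dots> = infsum (\<lambda>t. norm (a t)) T - (\<Sum>t\<in>F. norm (a t))"
        using infsum_Diff[OF a _ F(2)] F(1) by simp
      also have "\<dots> \<le> e / 2" using F(3) unfolding dist_real_def by linarith
      finally show ?thesis .
    qed
    ultimately show ?thesis using e by (simp add: T0_def)
  qed
  then show "\<exists>no. \<forall>N\<ge>no. norm ((\<Sum>s<N. ee (- (of_int m * of_nat s / of_nat N)) *
      infsum (\<lambda>t. a t * ee (of_int (n t) * of_nat s / of_nat N)) T) / of_nat N - infsum a {t \<in> T. n t = m}) < e"
    by blast
qed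

section \<open>Transformation laws of partial Fourier sums\<close>

definition subsum :: "(real^'g::finite^'g \<Rightarrow> complex) \<Rightarrow> (real^'g^'g) set \<Rightarrow> complex^'g^'g \<Rightarrow> complex" where
  "subsum c T \<tau> = infsum (\<lambda>t. c t * ee (pairing t \<tau>)) T"

definition fsummable :: "(real^'g::finite^'g \<Rightarrow> complex) \<Rightarrow> bool" where
  "fsummable c \<longleftrightarrow> (\<forall>\<tau>\<in>siegel. (\<lambda>t. norm (c t * ee (pairing t \<tau>))) summable_on Collect half_integral)"

lemma fourier_exp_summable:
  assumes "fourier_exp \<Phi> c" shows "fsummable c"
  using assms unfolding fourier_exp_def fsummable_def summable_on_iff_abs_summable_on_complex[symmetric]
  by (blast intro: has_sum_imp_summable)

lemma fsummable_subset:
  "fsummable c \<Longrightarrow> \<tau> \<in> siegel \<Longrightarrow> T \<subseteq> Collect half_integral \<Longrightarrow> (\<lambda>t. norm (c t * ee (pairing t \<tau>))) summable_on T"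
  unfolding fsummable_def by (meson summable_on_subset_banach)

definition law :: "(complex^'g::finite^'g \<Rightarrow> complex^'g^'g) \<Rightarrow> (complex^'g^'g \<Rightarrow> complex) \<Rightarrow>
    (real^'g^'g \<Rightarrow> complex) \<Rightarrow> (real^'g^'g) set \<Rightarrow> bool" where
  "law \<gamma> J c T \<longleftrightarrow> (\<forall>\<tau>\<in>siegel. \<gamma> \<tau> \<in> siegel \<and> subsum c T (\<gamma> \<tau>) = J \<tau> * subsum c T \<tau>)"

text \<open>Since \<open>\<gamma>\<close> commutes with real translations in the coordinate
  \<open>A\<close> and \<open>J\<close> ignores them, the law holds for all translates of the point,
  hence for their averages. In the limit these pick out the indices with exponent \<open>n\<close>
  at \<open>A\<close>.\<close>

lemma law_block_bound:
  fixes n :: int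
  assumes c: "fsummable c" and T: "T \<subseteq> Collect half_integral" and A: "A \<in> pairs"
    and law: "law \<gamma> J c T"
    and comm: "\<And>\<tau> s. \<tau> \<in> siegel \<Longrightarrow> \<gamma> (\<tau> + cscale (of_real s) (unit_sym A)) = \<gamma> \<tau> + cscale (of_real s) (unit_sym A)"
    and J: "\<And>\<tau> s. \<tau> \<in> siegel \<Longrightarrow> J (\<tau> + cscale (of_real s) (unit_sym A)) = J \<tau>"
  shows "law \<gamma> J c {t \<in> T. pair_entry t A = of_int n}"
  unfolding law_def
proof (intro ballI conjI)
  fix \<tau> :: "complex^'a^'a" assume \<tau>: "\<tau> \<in> siegel"
  show \<gamma>: "\<gamma> \<tau> \<in> siegel" using law \<tau> by (auto simp: law_def)
  define D where "D = (\<lambda>\<sigma> N. (\<Sum>s<N. ee (- (of_int n * of_nat s / of_nat N)) *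
     subsum c T (\<sigma> + cscale (of_real (real s / real N)) (unit_sym A))) / of_nat N)"
  have lim: "D \<sigma> \<longlonglongrightarrow> subsum c {t \<in> T. pair_entry t A = of_int n} \<sigma>" if \<sigma>: "\<sigma> \<in> siegel" for \<sigma>
  proof -
    have fl: "pair_entry t A = of_int \<lfloor>pair_entry t A\<rfloor>" if "t \<in> T" for t
      using pair_entry_Ints[of t A] A T that by (auto elim: Ints_cases)
    have 1: "subsum c T (\<sigma> + cscale (of_real (real s / real N)) (unit_sym A)) =
       infsum (\<lambda>t. c t * ee (pairing t \<sigma>) * ee (of_int \<lfloor>pair_entry t A\<rfloor> * of_nat s / of_nat N)) T" for s N
      unfolding subsum_def
    proof (rule infsum_cong)
      fix t assume t: "t \<in> T"
      have "complex_of_real (pair_entry t A) = of_int \<lfloor>pair_entry t A\<rfloor>"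
        using fl[OF t] by (metis of_real_of_int_eq)
      then have "pairing t (\<sigma> + cscale (of_real (real s / real N)) (unit_sym A)) = pairing t \<sigma> + of_int \<lfloor>pair_entry t A\<rfloor> * of_nat s / of_nat N"
        by (simp add: pairing_add pairing_cscale pairing_unit_sym)
      then show "c t * ee (pairing t (\<sigma> + cscale (of_real (real s / real N)) (unit_sym A))) =
         c t * ee (pairing t \<sigma>) * ee (of_int \<lfloor>pair_entry t A\<rfloor> * of_nat s / of_nat N)"
        by (simp only: ee_add mult.assoc)
    qed
    have 2: "{t \<in> T. \<lfloor>pair_entry t A\<rfloor> = n} = {t \<in> T. pair_entry t A = of_int n}"
      using fl by force
    show ?thesis
      unfolding D_def 1 using average_limit[OF fsummable_subset[OF c \<sigma> T], of n "\<lambda>t. \<lfloor>pair_entry t A\<rfloor>"]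
      by (simp only: 2 subsum_def)
  qed
  have "D (\<gamma> \<tau>) = (\<lambda>N. J \<tau> * D \<tau> N)"
  proof
    fix N
    have "subsum c T (\<gamma> \<tau> + cscale (of_real (real s / real N)) (unit_sym A)) = J \<tau> * subsum c T (\<tau> + cscale (of_real (real s / real N)) (unit_sym A))" for s
      using law siegel_shift_of_real[OF \<tau>, of "real s / real N" A] unfolding law_def
      by (metis comm[OF \<tau>] J[OF \<tau>])
    then show "D (\<gamma> \<tau>) N = J \<tau> * D \<tau> N"
      by (simp add: D_def sum_distrib_left mult_ac)
  qed
  then have "D (\<gamma> \<tau>) \<longlonglongrightarrow> J \<tau> * subsum c {t \<in> T. pair_entry t A = of_int n} \<tau>"
    using lim[OF \<tau>] by (auto intro!: tendsto_intros)
  then show "subsum c {t \<in> T. pair_entry t A = of_int n} (\<gamma> \<tau>) = J \<tau> * subsum c {t \<in> T. pair_entry t A = of_int n} \<tau>"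
    using lim[OF \<gamma>] LIMSEQ_unique by blast
qed

lemma law_restrict:
  fixes e :: "'g::finite set \<Rightarrow> int"
  assumes c: "fsummable c" and T: "T \<subseteq> Collect half_integral" and P: "P \<subseteq> pairs"
    and law: "law \<gamma> J c T"
    and comm: "\<And>A \<tau> s. A \<in> P \<Longrightarrow> \<tau> \<in> siegel \<Longrightarrow> \<gamma> (\<tau> + cscale (of_real s) (unit_sym A)) = \<gamma> \<tau> + cscale (of_real s) (unit_sym A)"
    and J: "\<And>A \<tau> s. A \<in> P \<Longrightarrow> \<tau> \<in> siegel \<Longrightarrow> J (\<tau> + cscale (of_real s) (unit_sym A)) = J \<tau>"
  shows "law \<gamma> J c {t \<in> T. \<forall>A\<in>P. pair_entry t A = of_int (e A)}"
  using finite_subset[OF P finite_pairs] P comm J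
proof (induction P)
  case empty
  then show ?case using law by simp
next
  case (insert A P)
  have "law \<gamma> J c {t \<in> {t \<in> T. \<forall>A\<in>P. pair_entry t A = of_int (e A)}. pair_entry t A = of_int (e A)}"
    by (rule law_block_bound) (use c T insert in auto)
  moreover have "{t \<in> {t \<in> T. \<forall>A\<in>P. pair_entry t A = of_int (e A)}. pair_entry t A = of_int (e A)} =
     {t \<in> T. \<forall>A\<in>insert A P. pair_entry t A = of_int (e A)}" by auto
  ultimately show ?case by simp
qed

lemma subsum_zero_imp:
  fixes c :: "real^'g::finite^'g \<Rightarrow> complex"
  assumes c: "fsummable c" and T: "T \<subseteq> Collect half_integral"
    and z: "\<And>\<tau>. \<tau> \<in> siegel \<Longrightarrow> subsum c T \<tau> = 0" and t: "t \<in> T"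
  shows "c t = 0"
proof -
  have hi: "half_integral t" using t T by auto
  \<comment> \<open>Vanishing is a law for the identity with factor 0. Prescribing all exponents
    then isolates the single index \<open>t\<close>.\<close>
  have l: "law id (\<lambda>_. 0) c {s \<in> T. \<forall>A\<in>pairs. pair_entry s A = of_int \<lfloor>pair_entry t A\<rfloor>}"
    by (rule law_restrict[OF c T subset_refl]) (use z in \<open>auto simp: law_def\<close>)
  have "{s \<in> T. \<forall>A\<in>pairs. pair_entry s A = of_int \<lfloor>pair_entry t A\<rfloor>} = {t}"
  proof -
    have fl: "pair_entry t A = of_int \<lfloor>pair_entry t A\<rfloor>" if "A \<in> pairs" for A
      using pair_entry_Ints[OF hi that] by (auto elim: Ints_cases)
    have "s = t" if "s \<in> T" "\<forall>A\<in>pairs. pair_entry s A = of_int \<lfloor>pair_entry t A\<rfloor>" for s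
      by (rule eq_by_entries) (use that fl hi T in \<open>auto simp: half_integral_def\<close>)
    then show ?thesis using t fl by auto
  qed
  with l have l: "law id (\<lambda>_. 0) c {t}" by simp
  have "cscale (\<i> * of_real 1) (mat 1) \<in> (siegel :: (complex^'g^'g) set)"
    by (rule siegel_scalar) simp
  then obtain \<tau> :: "complex^'g^'g" where "\<tau> \<in> siegel" ..
  then have "subsum c {t} \<tau> = 0" using l unfolding law_def by simp
  then show ?thesis by (simp add: subsum_def)
qed

theorem fourier_exp_unique:
  assumes "fourier_exp \<Phi> c" "fourier_exp \<Phi> c'" "half_integral t"
  shows "c t = c' t"
proof -
  have e: "fourier_exp (\<lambda>_. 0) (\<lambda>t. c t - c' t)"
    unfolding fourier_exp_def
  proof
    fix \<tau> :: "complex^'a^'a" assume "\<tau> \<in> siegel"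
    with assms have "((\<lambda>t. c t * ee (pairing t \<tau>)) has_sum \<Phi> \<tau>) (Collect half_integral)"
      "((\<lambda>t. c' t * ee (pairing t \<tau>)) has_sum \<Phi> \<tau>) (Collect half_integral)" by (auto simp: fourier_exp_def)
    from has_sum_add[OF this(1) has_sum_uminusI[OF this(2)]]
    show "((\<lambda>t. (c t - c' t) * ee (pairing t \<tau>)) has_sum 0) (Collect half_integral)"
      by (simp add: algebra_simps)
  qed
  have "c t - c' t = 0"
    by (rule subsum_zero_imp[OF fourier_exp_summable[OF e] subset_refl])
      (use e assms(3) in \<open>auto simp: subsum_def fourier_exp_def infsumI\<close>)
  then show ?thesis by simp
qed

section \<open>The Jacobi group in genus \<open>g\<close>\<close>

lemma sum_UNIV_sum:
  fixes f :: "'a::finite + 'b::finite \<Rightarrow> 'c::comm_monoid_add"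
  shows "(\<Sum>i\<in>UNIV. f i) = (\<Sum>a\<in>UNIV. f (Inl a)) + (\<Sum>b\<in>UNIV. f (Inr b))"
proof -
  have "(\<Sum>i\<in>UNIV. f i) = (\<Sum>i\<in>UNIV <+> UNIV. f i)" by simp
  also have "\<dots> = (\<Sum>a\<in>UNIV. f (Inl a)) + (\<Sum>b\<in>UNIV. f (Inr b))"
    by (subst sum.Plus) (auto simp: o_def)
  finally show ?thesis .
qed

lemma block_nth [simp]:
  "block A B C D $ Inl i $ Inl j = A $ i $ j" "block A B C D $ Inl i $ Inr j' = B $ i $ j'"
  "block A B C D $ Inr i' $ Inl j = C $ i' $ j" "block A B C D $ Inr i' $ Inr j' = D $ i' $ j'"
  by (simp_all add: block_def)

lemma block_parts [simp]:
  "upper_left (block A B C D) = A" "upper_right (block A B C D) = B"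
  "lower_left (block A B C D) = C" "lower_right (block A B C D) = D"
  by (simp_all add: upper_left_def upper_right_def lower_left_def lower_right_def vec_eq_iff)

lemma vec_sum_eq_iff: "(M :: 'a^('n::finite + 'p::finite)^('m::finite + 'q::finite)) = N \<longleftrightarrow>
   (\<forall>i j. M $ Inl i $ Inl j = N $ Inl i $ Inl j) \<and> (\<forall>i j. M $ Inl i $ Inr j = N $ Inl i $ Inr j) \<and>
   (\<forall>i j. M $ Inr i $ Inl j = N $ Inr i $ Inl j) \<and> (\<forall>i j. M $ Inr i $ Inr j = N $ Inr i $ Inr j)"
  unfolding vec_eq_iff by (metis sum.exhaust)

lemma block_mult:
  fixes A B C D A' B' C' D' :: "'a::semiring_1^'n::finite^'n"
  shows "block A B C D ** block A' B' C' D' = block (A ** A' + B ** C') (A ** B' + B ** D') (C ** A' + D ** C') (C ** B' + D ** D')"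
  by (simp add: vec_sum_eq_iff matrix_matrix_mult_def sum_UNIV_sum)

lemma transpose_block: "transpose (block A B C D) = block (transpose A) (transpose C) (transpose B) (transpose D)"
  by (simp add: vec_sum_eq_iff transpose_def)

lemma matrix_neg: "(- X) ** Y = - (X ** Y)" "X ** (- Y) = - (X ** Y)"
  for X Y :: "int^'n::finite^'n"
  by (simp_all add: vec_eq_iff matrix_matrix_mult_def sum_negf)

lemma transpose_zero [simp]: "transpose (0 :: 'a::zero^'n^'m) = 0"
  by (simp add: vec_eq_iff transpose_def)

lemma matrix_mult_zero [simp]:
  "(0 :: 'a::semiring_1^'n::finite^'m::finite) ** X = 0" "Y ** (0 :: 'a::semiring_1^'n::finite^'m::finite) = 0"
  by (simp_all add: vec_eq_iff matrix_matrix_mult_def)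

lemma Sp_intI:
  fixes A B C D :: "int^'n::finite^'n"
  assumes 1: "transpose A ** C = transpose C ** A" and 2: "transpose B ** D = transpose D ** B"
    and 3: "transpose A ** D - transpose C ** B = mat 1"
  shows "block A B C D \<in> Sp_int"
proof -
  have 4: "transpose B ** C + - (transpose D ** A) = - mat 1"
  proof -
    have "transpose (transpose A ** D - transpose C ** B) = transpose D ** A - transpose B ** C"
    proof -
      have "transpose (X - Y) = transpose X - transpose Y" for X Y :: "int^'n^'n"
        by (simp add: transpose_def vec_eq_iff)
      then show ?thesis by (simp add: matrix_transpose_mul)
    qed
    then show ?thesis unfolding 3 transpose_mat by simp
  qed
  have "transpose (block A B C D) ** block 0 (mat 1) (- mat 1) 0 ** block A B C D =
    transpose (block A B C D) ** (block 0 (mat 1) (- mat 1) 0 ** block A B C D)"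
    by (simp add: matrix_mul_assoc)
  also have "block 0 (mat 1) (- mat 1) 0 ** block A B C D = block C D (- A) (- B)"
    by (simp add: block_mult matrix_neg)
  also have "transpose (block A B C D) ** block C D (- A) (- B) = block 0 (mat 1) (- mat 1) 0"
    unfolding transpose_block block_mult matrix_neg 4 using 1 2 3 by simp
  finally show ?thesis by (simp add: Sp_int_def Let_def)
qed

section \<open>Elements of the Jacobi group acting at one diagonal position\<close>

definition row_matrix :: "'g::finite \<Rightarrow> ('g \<Rightarrow> complex) \<Rightarrow> complex^'g^'g" where
  "row_matrix j y = (\<chi> a b. if a = j then y b else if a = b then 1 else 0)"

lemma det_row_matrix: "det (row_matrix j y) = y j"
proof -
  have "row_matrix j y = (\<chi> i. if i = j then (\<Sum>i\<in>UNIV. (\<chi> b. y b) $ i *s row i (mat 1)) else row i (mat 1))"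
  proof -
    have "(\<Sum>i\<in>UNIV. y i * (if i = b then 1 else 0)) = y b" for b
      by (simp add: if_distrib cong: if_cong)
    then show ?thesis
      by (auto simp: row_matrix_def vec_eq_iff row_def mat_def)
  qed
  then show ?thesis using cramer_lemma_transpose[where x = "\<chi> b. y b" and A = "mat 1 :: complex^'a^'a" and k = j]
    by simp
qed

lemma mult_row_matrix: "(T ** row_matrix j y) $ a $ b = T $ a $ j * y b + (if b = j then 0 else T $ a $ b)"
proof -
  have "(T ** row_matrix j y) $ a $ b = (\<Sum>k\<in>UNIV. (if k = j then T $ a $ j * y b else 0) + (if k = b then (if b = j then 0 else T $ a $ b) else 0))"
    unfolding matrix_matrix_mult_def row_matrix_def vec_lambda_beta by (rule sum.cong) auto
  then show ?thesis by (simp add: sum.distrib)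
qed

lemma matrix_inv_right: "invertible A \<Longrightarrow> A ** matrix_inv A = mat 1"
  unfolding invertible_def matrix_inv_def by (rule someI2_ex) auto

text \<open>The inverse in \<open>siegel_action\<close> is never computed: the candidate image is
  checked after multiplication by the automorphy matrix, which is the identity outside one
  row.\<close>

lemma siegel_action_eqI:
  assumes aut: "automorphy M \<tau> = row_matrix j y" and y: "y j \<noteq> 0"
    and eq: "\<tau>' ** row_matrix j y = map_matrix of_int (upper_left M) ** \<tau> + map_matrix of_int (upper_right M)"
  shows "siegel_action M \<tau> = \<tau>'" "det (automorphy M \<tau>) = y j"
proof -
  have "invertible (row_matrix j y)" by (simp add: invertible_det_nz det_row_matrix y)
  then have "row_matrix j y ** matrix_inv (row_matrix j y) = mat 1" by (rule matrix_inv_right)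
  then have "\<tau>' ** row_matrix j y ** matrix_inv (row_matrix j y) = \<tau>'"
    by (simp add: matrix_mul_assoc[symmetric])
  then show "siegel_action M \<tau> = \<tau>'" by (simp add: siegel_action_def aut eq)
  show "det (automorphy M \<tau>) = y j" by (simp add: aut det_row_matrix)
qed

text \<open>For symmetric \<open>\<tau>\<close>, the substitution
  \<open>u ** \<tau> ** transpose u\<close>, where \<open>u\<close> is the identity with
  \<open>x\<close> added to its j-th column.\<close>

definition shear :: "('g::finite \<Rightarrow> int) \<Rightarrow> 'g \<Rightarrow> complex^'g^'g \<Rightarrow> complex^'g^'g" where
  "shear x j \<tau> = (\<chi> a b. \<tau> $ a $ b + of_int (x a) * \<tau> $ j $ b + of_int (x b) * \<tau> $ a $ j + of_int (x a * x b) * \<tau> $ j $ j)"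

text \<open>The inversion of SL(2,Z) embedded at position \<open>j\<close>: the diagonal entry goes
  to its negative reciprocal, the rest of its row and column is divided by it, and the remaining
  block becomes the complex Schur complement.\<close>

definition siegel_inv :: "'g::finite \<Rightarrow> complex^'g^'g \<Rightarrow> complex^'g^'g" where
  "siegel_inv j \<tau> = (\<chi> a b. if a = j \<and> b = j then - 1 / \<tau> $ j $ j else if a = j then \<tau> $ j $ b / \<tau> $ j $ j
     else if b = j then \<tau> $ a $ j / \<tau> $ j $ j else \<tau> $ a $ b - \<tau> $ a $ j * \<tau> $ j $ b / \<tau> $ j $ j)"

lemma one_num1 [simp]: "(i :: 1) = 1 \<longleftrightarrow> True" "1 = (i :: 1) \<longleftrightarrow> True"
  by (simp_all add: num1_eq1)

lemma ex_fun_sum: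
  fixes f :: "'a::finite \<Rightarrow> 'b::semiring_1"
  shows "(\<Sum>k\<in>UNIV. (if k = j then c else 0) * f k) = c * f j"
  by (simp add: if_distrib[of "\<lambda>x. x * _"] cong: if_cong)

text \<open>The part of \<open>x\<close> in the first block comes from the symplectic element
  \<open>block A 0 0 D\<close>, with \<open>D\<close> the inverse transpose of \<open>A\<close>; the
  component at the last position comes from the Heisenberg vector \<open>l\<close>. As
  \<open>x\<close> vanishes at \<open>j\<close>, the automorphy determinant is 1.\<close>

lemma jacobi_shear:
  fixes \<phi> :: "('n::finite) jacobi_fun"
  assumes \<phi>: "\<phi> \<in> jacobi_forms k m" and \<tau>: "\<tau> \<in> siegel" and x: "x (Inl j) = 0"
  shows "jacobi_lift m \<phi> (shear x (Inl j) \<tau>) = jacobi_lift m \<phi> \<tau>"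
proof -
  define A :: "int^'n^'n" where "A = (\<chi> a b. (if a = b then 1 else 0) + (if b = j then x (Inl a) else 0))"
  define D :: "int^'n^'n" where "D = (\<chi> a b. (if a = b then 1 else 0) - (if a = j then x (Inl b) else 0))"
  define l :: "int^1^'n" where "l = (\<chi> a b. if a = j then x (Inr b) else 0)"
  define y where "y = (\<lambda>b. (if b = Inl j then 1 else 0) - complex_of_int (x b))"
  have AD: "transpose A ** D = mat 1"
  proof -
    have "(transpose A ** D) $ a $ b = (mat 1 :: int^'n^'n) $ a $ b" for a b
    proof -
      have "(transpose A ** D) $ a $ b =
        (\<Sum>k\<in>UNIV. (if k = a then (if a = b then 1 else 0) - (if a = j then x (Inl b) else 0) else 0) +
            (if a = j then (if k = b then x (Inl b) else 0) else 0) -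
            (if a = j then (if k = j then x (Inl j) * x (Inl b) else 0) else 0))"
        unfolding matrix_matrix_mult_def transpose_def A_def D_def vec_lambda_beta
        by (rule sum.cong, use x in \<open>auto simp: algebra_simps\<close>)
      then show ?thesis
        using x by (cases "a = j"; cases "a = b") (simp_all add: sum.distrib sum_subtractf mat_def)
    qed
    then show ?thesis by (simp add: vec_eq_iff)
  qed
  have M: "block A 0 0 D \<in> Sp_int"
    by (rule Sp_intI) (simp_all add: AD)
  define G where "G = jacobi_matrix (block A 0 0 D) l 0"
  have Dl: "D ** l = l"
  proof -
    have "(D ** l) $ a $ b = (\<Sum>k\<in>UNIV. (if k = j then x (Inr b) else 0) * D $ a $ k)" for a b
      unfolding matrix_matrix_mult_def l_def vec_lambda_beta by (rule sum.cong) auto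
    then show ?thesis unfolding ex_fun_sum by (auto simp: vec_eq_iff l_def D_def x)
  qed
  have G: "upper_left G = block A 0 (transpose l) (mat 1)" "upper_right G = 0" "lower_left G = 0"
    "lower_right G = block D (- l) 0 (mat 1)"
    by (simp_all add: G_def jacobi_matrix_def Let_def Dl) 
       (simp_all add: vec_sum_eq_iff matrix_matrix_mult_def transpose_def)
  have aut: "automorphy G \<tau> = row_matrix (Inl j) y"
    unfolding automorphy_def G
    by (simp add: vec_sum_eq_iff row_matrix_def y_def map_matrix_def matrix_matrix_mult_def D_def l_def mat_def x)
  have eq: "shear x (Inl j) \<tau> ** row_matrix (Inl j) y = map_matrix of_int (upper_left G) ** \<tau> + map_matrix of_int (upper_right G)"
  proof -
    have "(map_matrix of_int (upper_left G) ** \<tau> + map_matrix of_int (upper_right G)) $ a $ b =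
       \<tau> $ a $ b + of_int (x a) * \<tau> $ Inl j $ b" for a b
    proof -
      have "map_matrix of_int (upper_left G) $ a $ c = (if c = a then 1 else 0) + (if c = Inl j then complex_of_int (x a) else 0)" for c
        unfolding G by (cases a; cases c) (auto simp: map_matrix_def A_def l_def transpose_def mat_def)
      then show ?thesis unfolding G(2)
        by (simp add: matrix_matrix_mult_def map_matrix_def distrib_right sum.distrib ex_fun_sum)
    qed
    moreover have "(shear x (Inl j) \<tau> ** row_matrix (Inl j) y) $ a $ b = \<tau> $ a $ b + of_int (x a) * \<tau> $ Inl j $ b" for a b
      unfolding mult_row_matrix by (auto simp: shear_def y_def x algebra_simps)
    ultimately show ?thesis by (simp add: vec_eq_iff)
  qed
  have "jacobi_lift m \<phi> (siegel_action G \<tau>) = det (automorphy G \<tau>) ^ k * jacobi_lift m \<phi> \<tau>"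
    using \<phi> M \<tau> unfolding G_def jacobi_forms_def by blast
  then show ?thesis using siegel_action_eqI[OF aut _ eq] by (simp add: y_def x)
qed

text \<open>\<open>A\<close> and \<open>C\<close> are the complementary projections away from and
  onto position \<open>j\<close>, so \<open>block A (- C) C A\<close> is the standard inversion in
  one pair of variables and the identity in the others. The only nontrivial row of the automorphy
  matrix is the j-th row of \<open>\<tau>\<close>.\<close>

lemma jacobi_siegel_inv:
  fixes \<phi> :: "('n::finite) jacobi_fun"
  assumes \<phi>: "\<phi> \<in> jacobi_forms k m" and \<tau>: "\<tau> \<in> siegel" and nz: "\<tau> $ Inl j $ Inl j \<noteq> 0"
  shows "jacobi_lift m \<phi> (siegel_inv (Inl j) \<tau>) = (\<tau> $ Inl j $ Inl j) ^ k * jacobi_lift m \<phi> \<tau>"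
proof -
  define A :: "int^'n^'n" where "A = (\<chi> a b. if a = b \<and> a \<noteq> j then 1 else 0)"
  define C :: "int^'n^'n" where "C = (\<chi> a b. if a = j \<and> b = j then 1 else 0)"
  define y where "y = (\<lambda>b. \<tau> $ Inl j $ b)"
  have tr: "transpose A = A" "transpose C = C" "transpose (- C) = - C" by (auto simp: A_def C_def transpose_def vec_eq_iff)
  have pr: "A ** C = 0" "C ** A = 0" "A ** A = A" "C ** C = C"
  proof -
    have 1: "(A ** X) $ a $ b = (if a = j then 0 else X $ a $ b)" for X a b
    proof -
      have "(A ** X) $ a $ b = (\<Sum>k\<in>UNIV. (if k = a then (if a = j then 0 else 1) else 0) * X $ k $ b)"
        unfolding matrix_matrix_mult_def A_def vec_lambda_beta by (rule sum.cong) auto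
      then show ?thesis unfolding ex_fun_sum by simp
    qed
    have 2: "(C ** X) $ a $ b = (if a = j then X $ j $ b else 0)" for X a b
    proof -
      have "(C ** X) $ a $ b = (\<Sum>k\<in>UNIV. (if k = j then (if a = j then 1 else 0) else 0) * X $ k $ b)"
        unfolding matrix_matrix_mult_def C_def vec_lambda_beta by (rule sum.cong) auto
      then show ?thesis unfolding ex_fun_sum by simp
    qed
    show "A ** C = 0" "C ** A = 0" "A ** A = A" "C ** C = C"
      by (auto simp: vec_eq_iff 1 2) (auto simp: A_def C_def)
  qed
  have AC: "A + C = mat 1" by (auto simp: vec_eq_iff A_def C_def mat_def)
  have M: "block A (- C) C A \<in> Sp_int"
    by (rule Sp_intI) (simp_all add: tr pr matrix_neg AC)
  define G where "G = jacobi_matrix (block A (- C) C A) 0 0"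
  have G: "upper_left G = block A 0 0 (mat 1)" "upper_right G = block (- C) 0 0 0" "lower_left G = block C 0 0 0"
    "lower_right G = block A 0 0 (mat 1)"
    by (simp_all add: G_def jacobi_matrix_def Let_def)
  have Cs: "of_int (block C 0 0 0 $ a $ c) = (if c = Inl j then (if a = Inl j then 1 else 0) else (0::complex))" for a and c :: "'n + 1"
    by (cases a; cases c) (auto simp: C_def)
  have As: "of_int (block A 0 0 (mat 1) $ a $ c) = (if c = a then (if a = Inl j then 0 else 1) else (0::complex))" for a and c :: "'n + 1"
    by (cases a; cases c) (auto simp: A_def mat_def)
  have Bs: "of_int (block (- C) 0 0 0 $ a $ c) = (if a = Inl j \<and> c = Inl j then - 1 else (0::complex))" for a and c :: "'n + 1"
    by (cases a; cases c) (auto simp: C_def)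
  have aut: "automorphy G \<tau> = row_matrix (Inl j) y"
    unfolding automorphy_def G vec_eq_iff
    by (simp add: matrix_matrix_mult_def Cs As ex_fun_sum row_matrix_def y_def)
  have eq: "siegel_inv (Inl j) \<tau> ** row_matrix (Inl j) y = map_matrix of_int (upper_left G) ** \<tau> + map_matrix of_int (upper_right G)"
  proof -
    have "(map_matrix of_int (upper_left G) ** \<tau> + map_matrix of_int (upper_right G)) $ a $ b =
       (if a = Inl j then (if b = Inl j then - 1 else 0) else \<tau> $ a $ b)" for a b
      unfolding G by (simp add: matrix_matrix_mult_def As Bs ex_fun_sum)
    moreover have "(siegel_inv (Inl j) \<tau> ** row_matrix (Inl j) y) $ a $ b = (if a = Inl j then (if b = Inl j then - 1 else 0) else \<tau> $ a $ b)" for a b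
      unfolding mult_row_matrix using nz by (auto simp: siegel_inv_def y_def)
    ultimately show ?thesis by (simp add: vec_eq_iff)
  qed
  have "jacobi_lift m \<phi> (siegel_action G \<tau>) = det (automorphy G \<tau>) ^ k * jacobi_lift m \<phi> \<tau>"
    using \<phi> M \<tau> unfolding G_def jacobi_forms_def by blast
  then show ?thesis using siegel_action_eqI[OF aut _ eq] nz by (simp add: y_def)
qed

lemma e_tr_lower_right: "e_tr (real m *\<^sub>R lower_right \<tau>) = ee (of_nat m * \<tau> $ Inr (1::1) $ Inr (1::1))"
  for \<tau> :: "complex^('n::finite + 1)^('n + 1)"
proof -
  have "trace (real m *\<^sub>R lower_right \<tau>) = real m *\<^sub>R \<tau> $ Inr (1::1) $ Inr (1::1)"
    by (simp add: trace_def lower_right_def)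
  then show ?thesis by (simp add: e_tr_def ee_def scaleR_conv_of_real)
qed

lemma jacobi_translate:
  fixes \<phi> :: "('n::finite) jacobi_fun" and A :: "('n + 1) set"
  assumes \<phi>: "\<phi> \<in> jacobi_forms k m" and \<tau>: "\<tau> \<in> siegel" and A: "A \<in> pairs"
  shows "jacobi_lift m \<phi> (\<tau> + unit_sym A) = jacobi_lift m \<phi> \<tau>"
\<comment> \<open>The translation part of a Jacobi matrix has 0 in the last diagonal place, so this
  direction is not one of its translations. The invariance comes from the exponential factor,
  \<open>m\<close> being an integer.\<close>
proof (cases "A = {Inr 1}")
  case True
  have "upper_left (\<tau> + unit_sym A) = upper_left \<tau>" "upper_right (\<tau> + unit_sym A) = upper_right \<tau>"
    by (simp_all add: upper_left_def upper_right_def unit_sym_def True vec_eq_iff)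
  moreover have "ee (of_nat m * (\<tau> + unit_sym A) $ Inr 1 $ Inr 1) = ee (of_nat m * \<tau> $ Inr 1 $ Inr 1)"
    using ee_of_int[of "int m"] by (simp add: unit_sym_def True distrib_left ee_add)
  ultimately show ?thesis by (simp add: jacobi_lift_def e_tr_lower_right)
next
  case False
  define b :: "int^'n^'n" where "b = upper_left (unit_sym A)"
  define \<mu> :: "int^1^'n" where "\<mu> = upper_right (unit_sym A)"
  have bs: "transpose b = b" by (auto simp: b_def upper_left_def transpose_def unit_sym_def vec_eq_iff insert_commute)
  have M: "block (mat 1) b 0 (mat 1) \<in> Sp_int"
    by (rule Sp_intI) (simp_all add: bs)
  define G where "G = jacobi_matrix (block (mat 1) b 0 (mat 1)) 0 \<mu>"
  have zr: "X ** (0 :: int^1^'n) = 0" for X :: "int^'n^'n" by (simp add: vec_eq_iff matrix_matrix_mult_def)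
  have one: "block (mat 1) 0 0 (mat 1) = (mat 1 :: int^('n + 1)^('n + 1))"
    by (simp add: vec_sum_eq_iff mat_def)
  have zero: "block 0 0 0 0 = (0 :: int^('n + 1)^('n + 1))" by (simp add: vec_sum_eq_iff)
  have B: "block b \<mu> (transpose \<mu>) 0 = (unit_sym A :: int^('n + 1)^('n + 1))"
    using False by (auto simp: vec_sum_eq_iff b_def \<mu>_def upper_left_def upper_right_def transpose_def unit_sym_def insert_commute)
  have z0: "transpose (0 :: int^1^'n) = 0" "(0 :: int^'n^'n) ** \<mu> = 0" by (simp_all add: vec_eq_iff transpose_def matrix_matrix_mult_def)
  have G: "upper_left G = mat 1" "upper_right G = unit_sym A" "lower_left G = 0" "lower_right G = mat 1"
    by (simp_all add: G_def jacobi_matrix_def Let_def zr B one zero z0)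
  have m1: "map_matrix of_int (mat 1) = (mat 1 :: complex^('n + 1)^('n + 1))" "map_matrix of_int (unit_sym A) = (unit_sym A :: complex^('n + 1)^('n + 1))"
     "map_matrix of_int 0 = (0 :: complex^('n + 1)^('n + 1))"
    by (auto simp: map_matrix_def mat_def unit_sym_def vec_eq_iff)
  have aut: "automorphy G \<tau> = mat 1"
    by (simp add: automorphy_def G m1)
  have "matrix_inv (mat 1) = (mat 1 :: complex^('n + 1)^('n + 1))"
    using matrix_inv_right[of "mat 1 :: complex^('n + 1)^('n + 1)"] by (simp add: invertible_def)
  then have "siegel_action G \<tau> = \<tau> + unit_sym A"
    by (simp add: siegel_action_def aut G m1)
  moreover have "jacobi_lift m \<phi> (siegel_action G \<tau>) = det (automorphy G \<tau>) ^ k * jacobi_lift m \<phi> \<tau>"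
    using \<phi> M \<tau> unfolding G_def jacobi_forms_def by blast
  ultimately show ?thesis by (simp add: aut)
qed

lemma upper_left_siegel:
  assumes "\<tau> \<in> (siegel :: (complex^('n::finite + 1)^('n + 1)) set)" shows "upper_left \<tau> \<in> siegel"
proof -
  have "transpose (upper_left \<tau>) = upper_left \<tau>"
    using sym_nth[OF siegelD_sym[OF assms]] by (simp add: transpose_def upper_left_def vec_eq_iff)
  moreover have "(\<Sum>a\<in>UNIV. \<Sum>b\<in>UNIV. Im (upper_left \<tau> $ a $ b) * (v $ a * v $ b)) > 0" if v: "v \<noteq> 0" for v
  proof -
    define w :: "real^('n + 1)" where "w = (\<chi> i. case i of Inl a \<Rightarrow> v $ a | Inr _ \<Rightarrow> 0)"
    have "w \<noteq> 0"
    proof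
      assume "w = 0"
      then have "w $ Inl a = 0" for a by simp
      then show False using v by (simp add: w_def vec_eq_iff)
    qed
    then have "(\<Sum>a\<in>UNIV. \<Sum>b\<in>UNIV. Im (\<tau> $ a $ b) * (w $ a * w $ b)) > 0" using assms by (simp add: siegel_iff)
    then show ?thesis by (simp add: sum_UNIV_sum w_def upper_left_def)
  qed
  ultimately show ?thesis by (simp add: siegel_iff)
qed

lemma bounded_linear_cscale: "bounded_linear (\<lambda>z. cscale z M)"
  unfolding linear_conv_bounded_linear[symmetric]
  by (rule linearI) (simp_all add: cscale_def vec_eq_iff distrib_right)

lemma siegel_periodic_jacobi_lift:
  fixes \<phi> :: "('n::finite) jacobi_fun"
  assumes \<phi>: "\<phi> \<in> jacobi_forms k m"
  shows "siegel_periodic (jacobi_lift m \<phi>)"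
  unfolding siegel_periodic_def
proof (intro conjI ballI)
  have hol: "jacobi_holomorphic \<phi>" using \<phi> by (simp add: jacobi_forms_def)
  have cont: "continuous_on jacobi_domain \<phi>"
    unfolding continuous_on_eq_continuous_within
    using hol has_derivative_continuous unfolding jacobi_holomorphic_def by blast
  have lin: "continuous_on siegel (\<lambda>\<tau>::complex^('n+1)^('n+1). (upper_left \<tau> :: complex^'n^'n, upper_right \<tau> :: complex^1^'n))"
    unfolding upper_left_def upper_right_def by (intro continuous_intros)
  show "continuous_on siegel (jacobi_lift m \<phi>)"
    unfolding jacobi_lift_def e_tr_lower_right
    by (intro continuous_intros continuous_on_compose2[OF cont lin])
       (auto simp: jacobi_domain_def upper_left_siegel)
  fix \<tau> :: "complex^('n+1)^('n+1)" and A :: "('n + 1) set" assume \<tau>: "\<tau> \<in> siegel" and A: "A \<in> pairs"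
  show "jacobi_lift m \<phi> (\<tau> + unit_sym A) = jacobi_lift m \<phi> \<tau>" by (rule jacobi_translate[OF \<phi> \<tau> A])
  \<comment> \<open>The coordinate line is affine in the variables of \<open>\<phi>\<close>, so the
    chain rule within the domain applies; homogeneity of the derivative under complex scalars turns
    it into multiplication by a complex number.\<close>
  define X where "X = (\<lambda>\<zeta>. (upper_left \<tau> + cscale \<zeta> (upper_left (unit_sym A)) :: complex^'n^'n,
      upper_right \<tau> + cscale \<zeta> (upper_right (unit_sym A)) :: complex^1^'n))"
  have X: "X \<zeta> = (upper_left (\<tau> + cscale \<zeta> (unit_sym A)), upper_right (\<tau> + cscale \<zeta> (unit_sym A)))" for \<zeta>
    by (simp add: X_def upper_left_def upper_right_def cscale_def vec_eq_iff)
  have XD: "X \<zeta> \<in> jacobi_domain" if "\<zeta> \<in> siegel_line \<tau> A" for \<zeta>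
    using that by (auto simp: X siegel_line_def jacobi_domain_def upper_left_siegel)
  have "(\<lambda>\<zeta>. \<phi> (X \<zeta>)) holomorphic_on siegel_line \<tau> A"
    unfolding holomorphic_on_def field_differentiable_def
  proof
    fix \<zeta> assume z: "\<zeta> \<in> siegel_line \<tau> A"
    obtain \<phi>' where \<phi>': "(\<phi> has_derivative \<phi>') (at (X \<zeta>) within jacobi_domain)"
      "\<And>c A w. \<phi>' (map_matrix ((*) c) A, map_matrix ((*) c) w) = c * \<phi>' (A, w)"
      using hol XD[OF z] unfolding jacobi_holomorphic_def by blast
    have dX: "(X has_derivative (\<lambda>h. (cscale h (upper_left (unit_sym A)), cscale h (upper_right (unit_sym A))))) (at \<zeta> within siegel_line \<tau> A)"
    proof -
      have c: "((\<lambda>\<zeta>. M + cscale \<zeta> N) has_derivative (\<lambda>h. cscale h N)) F" for M N :: "complex^'c::finite^'d::finite" and F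
        using has_derivative_add[OF has_derivative_const bounded_linear_imp_has_derivative[OF bounded_linear_cscale]] by fastforce
      show ?thesis unfolding X_def by (intro has_derivative_Pair c)
    qed
    have "(\<phi> has_derivative \<phi>') (at (X \<zeta>) within X ` siegel_line \<tau> A)"
      by (rule has_derivative_subset[OF \<phi>'(1)]) (use XD in auto)
    from has_derivative_in_compose[OF dX this]
    have "((\<lambda>\<zeta>. \<phi> (X \<zeta>)) has_derivative (\<lambda>h. \<phi>' (cscale h (upper_left (unit_sym A)), cscale h (upper_right (unit_sym A))))) (at \<zeta> within siegel_line \<tau> A)" .
    moreover have "\<phi>' (cscale h (upper_left (unit_sym A)), cscale h (upper_right (unit_sym A))) = \<phi>' (upper_left (unit_sym A), upper_right (unit_sym A)) * h" for h
      using \<phi>'(2)[of h "upper_left (unit_sym A)" "upper_right (unit_sym A)"] by (simp add: cscale_def map_matrix_def mult.commute)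
    ultimately show "\<exists>f'. ((\<lambda>\<zeta>. \<phi> (X \<zeta>)) has_field_derivative f') (at \<zeta> within siegel_line \<tau> A)"
      unfolding has_field_derivative_def by auto
  qed
  then have "(\<lambda>\<zeta>. \<phi> (X \<zeta>) * ee (of_nat m * (\<tau> $ Inr 1 $ Inr 1 + \<zeta> * unit_sym A $ Inr 1 $ Inr 1))) holomorphic_on siegel_line \<tau> A"
    by (intro holomorphic_intros)
  then show "(\<lambda>\<zeta>. jacobi_lift m \<phi> (\<tau> + cscale \<zeta> (unit_sym A))) holomorphic_on siegel_line \<tau> A"
    by (simp add: jacobi_lift_def e_tr_lower_right X cscale_def)
qed

section \<open>Coordinates along one diagonal pair_entry\<close>

definition quad :: "real^'g::finite^'g \<Rightarrow> ('g \<Rightarrow> real) \<Rightarrow> real" where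
  "quad t x = (\<Sum>a\<in>UNIV. \<Sum>b\<in>UNIV. t $ a $ b * (x a * x b))"

definition slope :: "complex^'g::finite^'g \<Rightarrow> 'g \<Rightarrow> 'g \<Rightarrow> real" where
  "slope \<tau> j a = Im (\<tau> $ a $ j) / Im (\<tau> $ j $ j)"

text \<open>The imaginary part is \<open>Im (\<tau> $ j $ j)\<close> times the rank one matrix of
  the slopes plus this matrix. Shears and the inversion at \<open>j\<close> may move the height and
  the slopes but leave it fixed, so it is an invariant of the group at \<open>j\<close>.\<close>

definition schur_compl :: "complex^'g::finite^'g \<Rightarrow> 'g \<Rightarrow> real^'g^'g" where
  "schur_compl \<tau> j = (\<chi> a b. Im (\<tau> $ a $ b) - Im (\<tau> $ a $ j) * Im (\<tau> $ j $ b) / Im (\<tau> $ j $ j))"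

lemma schur_compl_zero:
  assumes "Im (\<tau> $ j $ j) \<noteq> 0" shows "schur_compl \<tau> j $ j $ b = 0" "schur_compl \<tau> j $ a $ j = 0"
  using assms by (simp_all add: schur_compl_def)

lemma Im_decomp:
  assumes "transpose \<tau> = \<tau>" "Im (\<tau> $ j $ j) \<noteq> 0"
  shows "Im (\<tau> $ a $ b) = Im (\<tau> $ j $ j) * (slope \<tau> j a * slope \<tau> j b) + schur_compl \<tau> j $ a $ b"
  using assms(2) sym_nth[OF assms(1), of j b] by (simp add: slope_def schur_compl_def)

lemma siegel_jj: assumes "\<tau> \<in> siegel" shows "Im (\<tau> $ j $ j) > 0"
proof -
  have "axis j (1::real) \<noteq> 0" by (simp add: axis_eq_0_iff)
  then have "(\<Sum>a\<in>UNIV. \<Sum>b\<in>UNIV. Im (\<tau> $ a $ b) * (axis j 1 $ a * axis j 1 $ b)) > (0::real)"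
    using assms unfolding siegel_iff by blast
  also have "(\<Sum>a\<in>UNIV. \<Sum>b\<in>UNIV. Im (\<tau> $ a $ b) * (axis j 1 $ a * axis j 1 $ b)) =
     (\<Sum>a\<in>UNIV. \<Sum>b\<in>UNIV. if a = j then if b = j then Im (\<tau> $ j $ j) else 0 else 0)"
    by (intro sum.cong refl) (auto simp: axis_def)
  finally show ?thesis by (simp only: sum_delta2)
qed

lemma quad_rank_one: "quad (\<chi> a b. v * (l a * l b)) x = v * (\<Sum>a\<in>UNIV. l a * x a)\<^sup>2"
  by (simp add: quad_def power2_eq_square sum_product sum_distrib_left mult_ac)

text \<open>Completing the square in the j-th variable splits the imaginary form into a square
  weighted by the height and a form in the other variables.\<close>

lemma siegel_schur_compl_iff:
  "\<tau> \<in> siegel \<longleftrightarrow> transpose \<tau> = \<tau> \<and> Im (\<tau> $ j $ j) > 0 \<and> (\<forall>u. (\<exists>a. a \<noteq> j \<and> u a \<noteq> 0) \<longrightarrow> quad (schur_compl \<tau> j) u > 0)"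
proof
  assume R: "transpose \<tau> = \<tau> \<and> Im (\<tau> $ j $ j) > 0 \<and> (\<forall>u. (\<exists>a. a \<noteq> j \<and> u a \<noteq> 0) \<longrightarrow> quad (schur_compl \<tau> j) u > 0)"
  have q: "(\<Sum>a\<in>UNIV. \<Sum>b\<in>UNIV. Im (\<tau> $ a $ b) * (u a * u b)) =
     Im (\<tau> $ j $ j) * (\<Sum>a\<in>UNIV. slope \<tau> j a * u a)\<^sup>2 + quad (schur_compl \<tau> j) u" for u
    using R by (subst Im_decomp[of \<tau> j])
      (auto simp: quad_rank_one[symmetric] quad_def sum.distrib distrib_right)
  have "(\<Sum>a\<in>UNIV. \<Sum>b\<in>UNIV. Im (\<tau> $ a $ b) * (u $ a * u $ b)) > 0" if u: "u \<noteq> 0" for u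
  proof (cases "\<exists>a. a \<noteq> j \<and> u $ a \<noteq> 0")
    case True
    then have "quad (schur_compl \<tau> j) (\<lambda>a. u $ a) > 0" using R by blast
    then show ?thesis unfolding q using R by (auto intro!: add_nonneg_pos)
  next
    case False
    then have u0: "u $ a = 0" if "a \<noteq> j" for a using that by blast
    then have uj: "u $ j \<noteq> 0" using u by (metis vec_eq_iff zero_index)
    have "(\<Sum>a\<in>UNIV. slope \<tau> j a * u $ a) = (\<Sum>a\<in>UNIV. if a = j then u $ j else 0)"
      by (rule sum.cong) (use R u0 in \<open>auto simp: slope_def\<close>)
    moreover have "quad (schur_compl \<tau> j) (\<lambda>a. u $ a) = 0"
      unfolding quad_def
    proof (intro sum.neutral ballI)
      fix a b show "schur_compl \<tau> j $ a $ b * (u $ a * u $ b) = 0"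
        using R u0[of a] schur_compl_zero(1)[of \<tau> j b] by (cases "a = j") auto
    qed
    ultimately show ?thesis unfolding q using R uj by simp
  qed
  then show "\<tau> \<in> siegel" using R by (simp add: siegel_iff)
next
  assume \<tau>: "\<tau> \<in> siegel"
  have s: "transpose \<tau> = \<tau>" by (rule siegelD_sym[OF \<tau>])
  have v: "Im (\<tau> $ j $ j) > 0" by (rule siegel_jj[OF \<tau>])
  have q: "(\<Sum>a\<in>UNIV. \<Sum>b\<in>UNIV. Im (\<tau> $ a $ b) * (u a * u b)) =
     Im (\<tau> $ j $ j) * (\<Sum>a\<in>UNIV. slope \<tau> j a * u a)\<^sup>2 + quad (schur_compl \<tau> j) u" for u
    using s v by (subst Im_decomp[of \<tau> j])
      (auto simp: quad_rank_one[symmetric] quad_def sum.distrib distrib_right)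
  have "quad (schur_compl \<tau> j) u > 0" if a: "a \<noteq> j" "u a \<noteq> 0" for u a
  proof -
    \<comment> \<open>Only the component at \<open>j\<close> is changed, so as to annihilate the
      linear form given by the slopes; the Schur complement does not see that component.\<close>
    define w where "w = (\<lambda>a. if a = j then u j - (\<Sum>a\<in>UNIV. slope \<tau> j a * u a) else u a)"
    have "(\<Sum>a\<in>UNIV. slope \<tau> j a * w a) = (\<Sum>a\<in>UNIV. slope \<tau> j a * u a + (if a = j then - (\<Sum>a\<in>UNIV. slope \<tau> j a * u a) else 0))"
      by (rule sum.cong) (use v in \<open>auto simp: w_def slope_def\<close>)
    then have l0: "(\<Sum>a\<in>UNIV. slope \<tau> j a * w a) = 0" by (simp add: sum.distrib)
    have "schur_compl \<tau> j $ a $ b * (w a * w b) = schur_compl \<tau> j $ a $ b * (u a * u b)" for a b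
      using schur_compl_zero[of \<tau> j] v by (cases "a = j"; cases "b = j") (auto simp: w_def)
    then have "quad (schur_compl \<tau> j) u = quad (schur_compl \<tau> j) w" by (simp only: quad_def)
    also have "\<dots> = (\<Sum>a\<in>UNIV. \<Sum>b\<in>UNIV. Im (\<tau> $ a $ b) * ((\<chi> a. w a) $ a * (\<chi> a. w a) $ b))"
      using q[of w] l0 by simp
    also have "\<dots> > 0"
    proof -
      have "(\<chi> a. w a) $ a \<noteq> 0" using a by (simp add: w_def)
      then have "(\<chi> a. w a) \<noteq> 0" by (metis zero_index)
      then show ?thesis using \<tau> unfolding siegel_iff by blast
    qed
    finally show ?thesis .
  qed
  then show "transpose \<tau> = \<tau> \<and> Im (\<tau> $ j $ j) > 0 \<and> (\<forall>u. (\<exists>a. a \<noteq> j \<and> u a \<noteq> 0) \<longrightarrow> quad (schur_compl \<tau> j) u > 0)"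
    using s v by blast
qed

lemma siegel_by_schur_compl:
  assumes "\<tau> \<in> siegel" "transpose \<sigma> = \<sigma>" "Im (\<sigma> $ j $ j) > 0" "schur_compl \<sigma> j = schur_compl \<tau> j"
  shows "\<sigma> \<in> siegel"
  using assms siegel_schur_compl_iff[of \<tau> j] siegel_schur_compl_iff[of \<sigma> j] by simp

lemma shear_facts:
  assumes \<tau>: "\<tau> \<in> siegel" and x: "x j = 0"
  shows "shear x j \<tau> \<in> siegel" "schur_compl (shear x j \<tau>) j = schur_compl \<tau> j" "slope (shear x j \<tau>) j a = slope \<tau> j a + of_int (x a)"
    "shear x j \<tau> $ j $ j = \<tau> $ j $ j"
proof -
  have v: "Im (\<tau> $ j $ j) > 0" by (rule siegel_jj[OF \<tau>])
  show jj: "shear x j \<tau> $ j $ j = \<tau> $ j $ j" by (simp add: shear_def x)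
  show sc: "schur_compl (shear x j \<tau>) j = schur_compl \<tau> j"
    using v by (simp add: schur_compl_def shear_def vec_eq_iff x field_simps)
  show "slope (shear x j \<tau>) j a = slope \<tau> j a + of_int (x a)"
    using v by (simp add: slope_def shear_def x field_simps)
  have "transpose (shear x j \<tau>) = shear x j \<tau>"
    using sym_nth[OF siegelD_sym[OF \<tau>]] by (simp add: transpose_def shear_def vec_eq_iff mult.commute)
  then show "shear x j \<tau> \<in> siegel"
    using siegel_by_schur_compl[OF \<tau> _ _ sc] v jj by simp
qed

text \<open>What \<open>siegel_inv_facts\<close> needs for one entry of the Schur complement:
  \<open>z\<close> is the diagonal entry, \<open>p\<close> and \<open>q\<close> are entries of its
  column and row. Clearing the squared norm of \<open>z\<close> leaves a polynomial
  identity.\<close>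

lemma Im_inversion:
  assumes "Im z > 0"
  shows "Im (p * q / z) + Im (p / z) * Im (q / z) / Im (- 1 / z) = Im p * Im q / Im z"
proof -
  define D where "D = (Re z)\<^sup>2 + (Im z)\<^sup>2"
  have D: "D > 0" using assms by (simp add: D_def add_nonneg_pos)
  have 1: "Im (w / z) = (Im w * Re z - Re w * Im z) / D" for w by (simp add: Im_divide D_def)
  have 2: "Im (- 1 / z) = Im z / D" by (simp add: 1)
  have "Im (p * q / z) + Im (p / z) * Im (q / z) / Im (- 1 / z) =
     (Im z * (Im (p * q) * Re z - Re (p * q) * Im z) + (Im p * Re z - Re p * Im z) * (Im q * Re z - Re q * Im z)) / (D * Im z)"
    unfolding 2 unfolding 1 using D assms by (simp add: field_simps)
  also have "Im z * (Im (p * q) * Re z - Re (p * q) * Im z) + (Im p * Re z - Re p * Im z) * (Im q * Re z - Re q * Im z) = D * (Im p * Im q)"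
    by (simp add: D_def power2_eq_square algebra_simps)
  finally show ?thesis using D by simp
qed

lemma siegel_inv_facts:
  assumes \<tau>: "\<tau> \<in> siegel"
  shows "siegel_inv j \<tau> \<in> siegel" "schur_compl (siegel_inv j \<tau>) j = schur_compl \<tau> j"
    "Im (siegel_inv j \<tau> $ j $ j) = Im (\<tau> $ j $ j) / (norm (\<tau> $ j $ j))\<^sup>2"
proof -
  have v: "Im (\<tau> $ j $ j) > 0" by (rule siegel_jj[OF \<tau>])
  have jj: "siegel_inv j \<tau> $ j $ j = - 1 / \<tau> $ j $ j" by (simp add: siegel_inv_def)
  show im: "Im (siegel_inv j \<tau> $ j $ j) = Im (\<tau> $ j $ j) / (norm (\<tau> $ j $ j))\<^sup>2"
    by (simp add: jj Im_divide cmod_power2)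
  have nz: "\<tau> $ j $ j \<noteq> 0" using v by auto
  have v': "Im (siegel_inv j \<tau> $ j $ j) > 0" unfolding im using v nz by simp
  have s: "\<tau> $ a $ b = \<tau> $ b $ a" for a b by (rule sym_nth[OF siegelD_sym[OF \<tau>]])
  show sc: "schur_compl (siegel_inv j \<tau>) j = schur_compl \<tau> j"
  proof -
    have "schur_compl (siegel_inv j \<tau>) j $ a $ b = schur_compl \<tau> j $ a $ b" for a b
    proof (cases "a = j \<or> b = j")
      case True
      then show ?thesis using schur_compl_zero[of \<tau> j] schur_compl_zero[of "siegel_inv j \<tau>" j] v v' by auto
    next
      case False
      then show ?thesis
        using Im_inversion[OF v, of "\<tau> $ a $ j" "\<tau> $ j $ b"] by (simp add: schur_compl_def siegel_inv_def)
    qed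
    then show ?thesis by (simp add: vec_eq_iff)
  qed
  have "transpose (siegel_inv j \<tau>) = siegel_inv j \<tau>"
    using s[of j] s by (auto simp: transpose_def siegel_inv_def vec_eq_iff mult.commute)
  then show "siegel_inv j \<tau> \<in> siegel"
    by (rule siegel_by_schur_compl[OF \<tau> _ v' sc])
qed

definition rank_one :: "('g::finite \<Rightarrow> real) \<Rightarrow> complex^'g^'g" where
  "rank_one x = (\<chi> a b. of_real (x a * x b))"

text \<open>In the direction of the rank one matrix of the slopes the imaginary part changes only
  through the height. The resulting half plane in \<open>s\<close> carries the maximum principle,
  and on it the term of index \<open>t\<close> has frequency
  \<open>quad t (slope \<tau> j)\<close>.\<close>

lemma rank_one_facts:
  assumes \<tau>: "\<tau> \<in> siegel" and s: "Im (\<tau> $ j $ j) + Im s > 0"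
  defines "\<sigma> \<equiv> \<tau> + cscale s (rank_one (slope \<tau> j))"
  shows "\<sigma> \<in> siegel" "schur_compl \<sigma> j = schur_compl \<tau> j" "Im (\<sigma> $ j $ j) = Im (\<tau> $ j $ j) + Im s"
proof -
  have v: "Im (\<tau> $ j $ j) > 0" by (rule siegel_jj[OF \<tau>])
  have lj: "slope \<tau> j j = 1" using v by (simp add: slope_def)
  have I: "Im (\<sigma> $ a $ b) = (Im (\<tau> $ j $ j) + Im s) * (slope \<tau> j a * slope \<tau> j b) + schur_compl \<tau> j $ a $ b" for a b
    using Im_decomp[OF siegelD_sym[OF \<tau>], of j a b] v
    by (simp add: \<sigma>_def cscale_def rank_one_def algebra_simps)
  show jj: "Im (\<sigma> $ j $ j) = Im (\<tau> $ j $ j) + Im s"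
    using I[of j j] v by (simp add: lj schur_compl_zero)
  show sc: "schur_compl \<sigma> j = schur_compl \<tau> j"
  proof -
    have "schur_compl \<sigma> j $ a $ b = schur_compl \<tau> j $ a $ b" for a b
      using I[of a j] I[of j b] I[of a b] v s by (simp add: schur_compl_def[of \<sigma>] jj lj schur_compl_zero)
    then show ?thesis by (simp add: vec_eq_iff)
  qed
  have "transpose \<sigma> = \<sigma>"
    using sym_nth[OF siegelD_sym[OF \<tau>]] by (simp add: \<sigma>_def transpose_def cscale_def rank_one_def vec_eq_iff mult.commute)
  then show "\<sigma> \<in> siegel"
    using siegel_by_schur_compl[OF \<tau> _ _ sc] jj s by simp
qed

lemma pairing_rank_one: "pairing t (rank_one x) = of_real (quad t x)"
  by (simp add: pairing_def rank_one_def quad_def)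

lemma Im_pairing: "Im (pairing t \<tau>) = (\<Sum>a\<in>UNIV. \<Sum>b\<in>UNIV. t $ a $ b * Im (\<tau> $ a $ b))"
  by (simp add: pairing_def)

lemma Im_pairing_decomp:
  assumes \<tau>: "\<tau> \<in> siegel"
  shows "Im (pairing t \<tau>) = Im (\<tau> $ j $ j) * quad t (slope \<tau> j) + (\<Sum>a\<in>UNIV. \<Sum>b\<in>UNIV. t $ a $ b * schur_compl \<tau> j $ a $ b)"
proof -
  have v: "Im (\<tau> $ j $ j) \<noteq> 0" using siegel_jj[OF \<tau>, of j] by simp
  show ?thesis
  proof -
    have "t $ a $ b * Im (\<tau> $ a $ b) = Im (\<tau> $ j $ j) * (t $ a $ b * (slope \<tau> j a * slope \<tau> j b)) + t $ a $ b * schur_compl \<tau> j $ a $ b" for a b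
      by (subst Im_decomp[OF siegelD_sym[OF \<tau>] v]) (simp only: distrib_left mult_ac)
    then show ?thesis
      unfolding Im_pairing by (simp only: quad_def sum.distrib sum_distrib_left)
  qed
qed

section \<open>A Phragmen-Lindelof principle for sums with nonnegative frequencies\<close>

lemma half_plane_max_finite:
  fixes a :: "'i \<Rightarrow> complex" and e :: "'i \<Rightarrow> real"
  assumes fin: "finite I" and e: "\<And>i. i \<in> I \<Longrightarrow> e i \<ge> 0" and eps: "\<epsilon> > 0"
    and B: "\<And>x::real. norm (\<Sum>i\<in>I. a i * ee (of_real (e i) * (of_real x - \<i> * of_real \<epsilon>))) \<le> B"
  shows "norm (\<Sum>i\<in>I. a i) \<le> B"
proof -
  define h where "h = (\<lambda>s. \<Sum>i\<in>I. a i * ee (of_real (e i) * s))"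
  define A where "A = (\<Sum>i\<in>I. norm (a i) * exp (2 * pi * \<epsilon> * e i))"
  have B0: "B \<ge> 0" using order_trans[OF norm_ge_zero B] .
  have A0: "A \<ge> 0" unfolding A_def by (intro sum_nonneg) auto
  have hA: "norm (h s) \<le> A" if "Im s \<ge> - \<epsilon>" for s
    unfolding h_def A_def
  proof (rule order_trans[OF norm_sum sum_mono])
    fix i assume i: "i \<in> I"
    have "- (2 * pi * (e i * Im s)) \<le> 2 * pi * \<epsilon> * e i"
      using mult_left_mono[OF that, of "2 * pi * e i"] e[OF i] by (simp add: algebra_simps)
    then show "norm (a i * ee (of_real (e i) * s)) \<le> norm (a i) * exp (2 * pi * \<epsilon> * e i)"
      by (simp add: norm_mult norm_ee mult_left_mono)
  qed
  have main: "norm (h 0) \<le> (B + \<eta>) * (1 + \<eta> * \<epsilon>)" if \<eta>: "\<eta> > 0" for \<eta>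
  proof -
    \<comment> \<open>The first bound puts the origin inside the half disc; the second makes
      \<open>A / (\<eta> * R)\<close> at most \<open>\<eta>\<close>, which controls the arc.\<close>
    define R where "R = max (2 * \<epsilon>) (A / \<eta>\<^sup>2 + 1)"
    define p where "p = - \<i> * of_real \<epsilon>"
    define S where "S = {s. Im s > - \<epsilon>} \<inter> ball p R"
    \<comment> \<open>The sum is bounded on the half plane but need not decay. Dividing by this
      linear factor, of real part at least 1, makes it small on large arcs; the price
      \<open>1 + \<eta> * \<epsilon>\<close> at the origin tends to 1 with \<open>\<eta>\<close>
      tending to 0.\<close>
    define d where "d = (\<lambda>s. 1 - \<i> * of_real \<eta> * (s - p))"
    have oS: "open S" unfolding S_def by (intro open_Int open_ball open_Collect_less continuous_intros)
    have clS: "closure S \<subseteq> {s. Im s \<ge> - \<epsilon>} \<inter> cball p R"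
      unfolding S_def by (rule closure_minimal) (auto intro!: closed_Int closed_Collect_le continuous_intros)
    have red: "Re (d s) = 1 + \<eta> * (Im s + \<epsilon>)" for s by (simp add: d_def p_def algebra_simps)
    have d1: "norm (d s) \<ge> 1" if "Im s \<ge> - \<epsilon>" for s
    proof -
      have "1 \<le> Re (d s)" unfolding red using that \<eta> by simp
      then show ?thesis using complex_Re_le_cmod[of "d s"] by linarith
    qed
    have d2: "norm (d s) \<ge> \<eta> * norm (s - p)" if s: "Im s \<ge> - \<epsilon>" for s
    proof -
      define u where "u = Im s + \<epsilon>"
      have u: "u \<ge> 0" using s by (simp add: u_def)
      have "(\<eta> * norm (s - p))\<^sup>2 = (\<eta> * Re s)\<^sup>2 + (\<eta> * u)\<^sup>2"
        by (simp only: power_mult_distrib cmod_power2 distrib_left) (simp add: p_def u_def)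
      also have "\<dots> \<le> (\<eta> * Re s)\<^sup>2 + (1 + \<eta> * u)\<^sup>2"
        using u \<eta> by (intro add_left_mono power_mono) auto
      also have "\<dots> = (norm (d s))\<^sup>2" by (simp add: cmod_power2 d_def p_def u_def algebra_simps)
      finally show ?thesis by (rule power2_le_imp_le) simp
    qed
    have dnz: "d s \<noteq> 0" if "Im s \<ge> - \<epsilon>" for s using d1[OF that] by auto
    have "norm (h 0 / d 0) \<le> B + \<eta>"
    proof (rule maximum_modulus_frontier[of "\<lambda>s. h s / d s" S])
      have hol: "(\<lambda>s. h s / d s) holomorphic_on {s. Im s > - 2 * \<epsilon>} \<inter> {s. d s \<noteq> 0}"
        unfolding h_def d_def by (intro holomorphic_intros) auto
      show "(\<lambda>s. h s / d s) holomorphic_on interior S"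
        unfolding interior_open[OF oS]
        by (rule holomorphic_on_subset[OF hol]) (use dnz eps in \<open>force simp: S_def\<close>)
      show "continuous_on (closure S) (\<lambda>s. h s / d s)"
        by (rule continuous_on_subset[OF holomorphic_on_imp_continuous_on[OF hol]])
          (use clS dnz eps in force)
      show "bounded S" unfolding S_def by (meson bounded_Int bounded_ball)
      show "0 \<in> S" using eps by (auto simp: S_def p_def R_def dist_norm norm_mult)
      fix z assume "z \<in> frontier S"
      then have z: "z \<in> closure S" "z \<notin> S" using oS by (auto simp: frontier_def interior_open)
      then have zi: "Im z \<ge> - \<epsilon>" and zc: "z \<in> cball p R" using clS by auto
      show "norm (h z / d z) \<le> B + \<eta>"
      proof (cases "Im z = - \<epsilon>")
        case True
        then have "z = of_real (Re z) - \<i> * of_real \<epsilon>" by (simp add: complex_eq_iff)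
        then have "norm (h z) \<le> B" unfolding h_def using B[of "Re z"] by metis
        then have "norm (h z) / norm (d z) \<le> B / 1" by (intro frac_le) (use d1[OF zi] B0 in auto)
        then show ?thesis using \<eta> by (simp add: norm_divide)
      next
        case False
        then have "norm (z - p) = R"
          using z(2) zi zc by (auto simp: S_def dist_norm norm_minus_commute)
        then have dR: "norm (d z) \<ge> \<eta> * R" using d2[OF zi] by simp
        have R1: "R \<ge> A / \<eta>\<^sup>2 + 1" by (simp add: R_def)
        have "R > 0" using eps by (simp add: R_def)
        have "norm (h z) / norm (d z) \<le> A / (\<eta> * R)"
          by (intro frac_le hA zi dR A0) (use \<eta> \<open>R > 0\<close> in auto)
        also have "\<dots> \<le> \<eta>"
        proof -
          have "A \<le> R * \<eta>\<^sup>2" using R1 \<eta> by (simp add: field_simps) (smt (verit) zero_less_power)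
          then show ?thesis using \<eta> \<open>R > 0\<close> by (simp add: field_simps power2_eq_square)
        qed
        finally show ?thesis using B0 by (simp add: norm_divide)
      qed
    qed
    moreover have "norm (d 0) = 1 + \<eta> * \<epsilon>"
    proof -
      have "d 0 = of_real (1 + \<eta> * \<epsilon>)" by (simp add: d_def p_def complex_eq_iff)
      then show ?thesis using \<eta> eps by (simp only: norm_of_real) auto
    qed
    moreover have "1 + \<eta> * \<epsilon> > 0" using \<eta> eps by (simp add: add_pos_pos)
    ultimately show ?thesis by (simp only: norm_divide pos_divide_le_eq)
  qed
  have lim: "((\<lambda>\<eta>. (B + \<eta>) * (1 + \<eta> * \<epsilon>)) \<longlongrightarrow> (B + 0) * (1 + 0 * \<epsilon>)) (at_right 0)"
    by (intro tendsto_intros)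
  have "norm (h 0) \<le> (B + 0) * (1 + 0 * \<epsilon>)"
    by (rule tendsto_lowerbound[OF lim]) (auto simp: eventually_at_filter main intro!: always_eventually)
  then show ?thesis by (simp add: h_def)
qed

text \<open>The weights \<open>exp (2 * pi * \<epsilon> * e t)\<close> dominate the terms both on
  the lower line and at the origin, so one finite truncation is accurate to
  \<open>\<delta> / 2\<close> at all these points, and for it the finite case applies.\<close>

lemma half_plane_max:
  fixes a :: "'i \<Rightarrow> complex" and e :: "'i \<Rightarrow> real"
  assumes sm: "(\<lambda>t. norm (a t) * exp (2 * pi * \<epsilon> * e t)) summable_on T"
    and e: "\<And>t. t \<in> T \<Longrightarrow> e t \<ge> 0" and eps: "\<epsilon> > 0"
    and B: "\<And>x::real. norm (infsum (\<lambda>t. a t * ee (of_real (e t) * (of_real x - \<i> * of_real \<epsilon>))) T) \<le> B"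
  shows "norm (infsum a T) \<le> B"
proof (rule field_le_epsilon)
  fix \<delta> :: real assume \<delta>: "\<delta> > 0"
  let ?w = "\<lambda>t. norm (a t) * exp (2 * pi * \<epsilon> * e t)"
  obtain F where F: "finite F" "F \<subseteq> T" "dist (sum ?w F) (infsum ?w T) \<le> \<delta> / 2"
    using infsum_finite_approximation[OF sm, of "\<delta> / 2"] \<delta> by auto
  have smF: "?w summable_on (T - F)" by (rule summable_on_subset_banach[OF sm]) auto
  have tail: "infsum ?w (T - F) \<le> \<delta> / 2"
  proof -
    have "infsum ?w (T - F) = infsum ?w T - sum ?w F" using infsum_Diff[OF sm _ F(2)] F(1) by simp
    then show ?thesis using F(3) unfolding dist_real_def by linarith
  qed
  have approx: "norm (infsum b T - sum b F) \<le> \<delta> / 2" if b: "\<And>t. t \<in> T \<Longrightarrow> norm (b t) \<le> ?w t" for b :: "'i \<Rightarrow> complex"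
  proof -
    have nb: "(\<lambda>t. norm (b t)) summable_on T" by (rule summable_on_comparison_test[OF sm]) (use b in auto)
    have nbF: "(\<lambda>t. norm (b t)) summable_on (T - F)" by (rule summable_on_subset_banach[OF nb]) auto
    have "infsum b T - sum b F = infsum b (T - F)"
      using infsum_Diff[OF abs_summable_summable[OF nb] _ F(2)] F(1) by simp
    also have "norm \<dots> \<le> infsum (\<lambda>t. norm (b t)) (T - F)" by (rule norm_infsum_bound[OF nbF])
    also have "\<dots> \<le> infsum ?w (T - F)" by (rule infsum_mono[OF nbF smF]) (use b in auto)
    finally show ?thesis using tail by linarith
  qed
  have "norm (\<Sum>t\<in>F. a t) \<le> B + \<delta> / 2"
  proof (rule half_plane_max_finite[OF F(1) _ eps])
    show "e t \<ge> 0" if "t \<in> F" for t using e F(2) that by auto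
    fix x :: real
    have "norm (infsum (\<lambda>t. a t * ee (of_real (e t) * (of_real x - \<i> * of_real \<epsilon>))) T -
       (\<Sum>t\<in>F. a t * ee (of_real (e t) * (of_real x - \<i> * of_real \<epsilon>)))) \<le> \<delta> / 2"
      by (rule approx) (simp add: norm_mult norm_ee mult_ac)
    then show "norm (\<Sum>t\<in>F. a t * ee (of_real (e t) * (of_real x - \<i> * of_real \<epsilon>))) \<le> B + \<delta> / 2"
      using B[of x] by (smt (verit) norm_triangle_ineq3)
  qed
  moreover have "norm (infsum a T - sum a F) \<le> \<delta> / 2"
  proof (rule approx)
    fix t assume "t \<in> T"
    then have "exp (2 * pi * \<epsilon> * e t) \<ge> 1" using e eps by simp
    then show "norm (a t) \<le> ?w t" using mult_left_mono[of 1 "exp (2 * pi * \<epsilon> * e t)" "norm (a t)"] by simp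
  qed
  ultimately show "norm (infsum a T) \<le> B + \<delta>"
    by (smt (verit) norm_triangle_ineq2 field_sum_of_halves)
qed

section \<open>A short vector in every block\<close>

definition same_block :: "real^'g::finite^'g \<Rightarrow> 'g \<Rightarrow> (real^'g^'g) set" where
  "same_block t0 j = {t. half_integral t \<and> (\<forall>a b. a \<noteq> j \<longrightarrow> b \<noteq> j \<longrightarrow> t $ a $ b = t0 $ a $ b)}"

text \<open>Describes the block by prescribed exponents at the coordinates avoiding
  \<open>j\<close>, the form in which \<open>law_restrict\<close> accepts it.\<close>

lemma same_block_entries:
  assumes t0: "half_integral t0"
  shows "same_block t0 j = {t \<in> Collect half_integral. \<forall>A\<in>{A \<in> pairs. j \<notin> A}. pair_entry t A = of_int \<lfloor>pair_entry t0 A\<rfloor>}"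
proof -
  have fl: "of_int \<lfloor>pair_entry t0 A\<rfloor> = pair_entry t0 A" if "A \<in> pairs" for A
    using pair_entry_Ints[OF t0 that] by (auto elim: Ints_cases)
  have s0: "transpose t0 = t0" using t0 by (simp add: half_integral_def)
  show ?thesis
  proof (intro set_eqI iffI)
    fix t assume t: "t \<in> same_block t0 j"
    then have s: "transpose t = t" by (simp add: same_block_def half_integral_def)
    have "pair_entry t A = pair_entry t0 A" if A: "A \<in> pairs" "j \<notin> A" for A
    proof -
      obtain a b where ab: "A = {a, b}" using A by (auto simp: pairs_iff)
      then have "t $ a $ b = t0 $ a $ b" using t A by (auto simp: same_block_def)
      then show ?thesis unfolding ab
        by (cases "a = b") (simp_all add: pair_entry_single pair_entry_pair[OF s] pair_entry_pair[OF s0])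
    qed
    then have "\<forall>A\<in>{A \<in> pairs. j \<notin> A}. pair_entry t A = of_int \<lfloor>pair_entry t0 A\<rfloor>"
      by (metis (mono_tags, lifting) fl mem_Collect_eq)
    then show "t \<in> {t \<in> Collect half_integral. \<forall>A\<in>{A \<in> pairs. j \<notin> A}. pair_entry t A = of_int \<lfloor>pair_entry t0 A\<rfloor>}"
      using t by (simp add: same_block_def)
  next
    fix t assume t: "t \<in> {t \<in> Collect half_integral. \<forall>A\<in>{A \<in> pairs. j \<notin> A}. pair_entry t A = of_int \<lfloor>pair_entry t0 A\<rfloor>}"
    then have s: "transpose t = t" by (simp add: half_integral_def)
    have "t $ a $ b = t0 $ a $ b" if "a \<noteq> j" "b \<noteq> j" for a b
    proof -
      have "pair_entry t {a, b} = pair_entry t0 {a, b}" using t fl[of "{a, b}"] that by auto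
      then show ?thesis
        by (cases "a = b") (simp_all add: pair_entry_single pair_entry_pair[OF s] pair_entry_pair[OF s0])
    qed
    then show "t \<in> same_block t0 j" using t by (simp add: same_block_def)
  qed
qed

text \<open>The Schur complement vanishes in row and column \<open>j\<close>, the only places where
  members of a block differ. This part of the exponent is thus common to the whole block and can be
  divided out.\<close>

lemma schur_compl_pairing_same_block:
  assumes "t \<in> same_block t0 j" "Im (\<tau> $ j $ j) \<noteq> 0"
  shows "(\<Sum>a\<in>UNIV. \<Sum>b\<in>UNIV. t $ a $ b * schur_compl \<tau> j $ a $ b) = (\<Sum>a\<in>UNIV. \<Sum>b\<in>UNIV. t0 $ a $ b * schur_compl \<tau> j $ a $ b)"
proof (intro sum.cong refl)
  fix a b show "t $ a $ b * schur_compl \<tau> j $ a $ b = t0 $ a $ b * schur_compl \<tau> j $ a $ b"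
    using assms schur_compl_zero[of \<tau> j] by (cases "a = j \<or> b = j") (auto simp: same_block_def)
qed

lemma cscale_unit_sym_nth: "j \<notin> A \<Longrightarrow> cscale s (unit_sym A) $ j $ b = 0" "j \<notin> A \<Longrightarrow> cscale s (unit_sym A) $ a $ j = 0"
  by (auto simp: cscale_def unit_sym_def)

lemma shear_comm: "j \<notin> A \<Longrightarrow> shear x j (\<tau> + cscale s (unit_sym A)) = shear x j \<tau> + cscale s (unit_sym A)"
  by (simp add: shear_def vec_eq_iff cscale_unit_sym_nth)

lemma siegel_inv_comm: "j \<notin> A \<Longrightarrow> siegel_inv j (\<tau> + cscale s (unit_sym A)) = siegel_inv j \<tau> + cscale s (unit_sym A)"
  by (simp add: siegel_inv_def vec_eq_iff cscale_unit_sym_nth)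

lemma quad_double: "quad t (\<lambda>a. x a + y a) + quad t (\<lambda>a. x a - y a) = 2 * quad t x + 2 * quad t y"
  by (simp add: quad_def sum_distrib_left sum.distrib[symmetric] algebra_simps)

lemma quad_axis: "quad t (\<lambda>a. if a = j then 1 else 0) = t $ j $ j"
proof -
  have "t $ a $ b * ((if a = j then 1 else 0) * (if b = j then 1 else 0)) = (if a = j then if b = j then t $ j $ j else 0 else 0)" for a b
    by auto
  then show ?thesis unfolding quad_def by (simp only: sum_delta2)
qed

lemma round_bound: "\<bar>x + real_of_int (- round x)\<bar> \<le> 1 / 2"
  using of_int_round_abs_le[of x] by (simp add: abs_minus_commute)

text \<open>The contraction constant of the maximum argument: \<open>sqrt 2\<close> bounds the ratio
  of the square roots of the two heights, and \<open>exp (- (pi / 2))\<close> is the gain from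
  moving by 1/4, both per unit of weight.\<close>

lemma sqrt2_exp: "sqrt 2 * exp (- (pi / 2)) \<le> 1 / 2"
proof -
  have "27 / 8 \<le> (1 + 1 / 2 :: real) ^ 3" by (simp add: power3_eq_cube)
  also have "\<dots> \<le> exp (1 / 2) ^ 3" by (intro power_mono exp_ge_add_one_self) auto
  also have "\<dots> = exp (3 / 2)" by (simp add: exp_of_nat_mult[symmetric])
  also have "\<dots> \<le> exp (pi / 2)" using pi_gt3 by simp
  finally have 1: "3 \<le> exp (pi / 2)" by simp
  have "sqrt 2 \<le> 3 / 2" by (rule real_le_lsqrt) (auto simp: power2_eq_square)
  then show ?thesis using 1 by (simp add: exp_minus field_simps)
qed

text \<open>Set up for a contradiction: \<open>big\<close> denies that an index of the block with
  nonzero coefficient has a value below \<open>k\<close> at a vector with j-th component 1, and the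
  outcome is that the coefficient at \<open>t0\<close> vanishes.\<close>

locale block_bound =
  fixes c :: "real^'g::finite^'g \<Rightarrow> complex" and j :: 'g and k :: nat and t0 :: "real^'g^'g"
  assumes c: "fsummable c" and k: "k > 0" and t0: "half_integral t0"
    and law_shear: "\<And>x. x j = 0 \<Longrightarrow> law (shear x j) (\<lambda>_. 1) c (Collect half_integral)"
    and law_siegel_inv: "law (siegel_inv j) (\<lambda>\<tau>. (\<tau> $ j $ j) ^ k) c (Collect half_integral)"
    and big: "\<And>t x. t \<in> same_block t0 j \<Longrightarrow> c t \<noteq> 0 \<Longrightarrow> x j = 1 \<Longrightarrow> quad t x \<ge> real k"
    and psd: "\<And>t x. t \<in> same_block t0 j \<Longrightarrow> c t \<noteq> 0 \<Longrightarrow> quad t x \<ge> 0"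
begin

abbreviation "T \<equiv> same_block t0 j"
abbreviation "\<psi> \<equiv> subsum c T"

lemma T_sub: "T \<subseteq> Collect half_integral" by (auto simp: same_block_def)

lemma psi_shear: "x j = 0 \<Longrightarrow> \<tau> \<in> siegel \<Longrightarrow> \<psi> (shear x j \<tau>) = \<psi> \<tau>"
proof -
  assume x: "x j = 0" and \<tau>: "\<tau> \<in> siegel"
  have "law (shear x j) (\<lambda>_. 1) c T"
    unfolding same_block_entries[OF t0]
    by (rule law_restrict[OF c subset_refl _ law_shear[of x, OF x]]) (auto simp: shear_comm)
  then show ?thesis using \<tau> by (simp add: law_def)
qed

lemma psi_siegel_inv: "\<tau> \<in> siegel \<Longrightarrow> \<psi> (siegel_inv j \<tau>) = (\<tau> $ j $ j) ^ k * \<psi> \<tau>"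
proof -
  assume \<tau>: "\<tau> \<in> siegel"
  have "law (siegel_inv j) (\<lambda>\<tau>. (\<tau> $ j $ j) ^ k) c T"
    unfolding same_block_entries[OF t0]
    by (rule law_restrict[OF c subset_refl _ law_siegel_inv]) (auto simp: siegel_inv_comm cscale_unit_sym_nth)
  then show ?thesis using \<tau> by (simp add: law_def)
qed

lemma psi_translate: "\<psi> (\<tau> + cscale (of_int n) (unit_sym {j})) = \<psi> \<tau>"
  unfolding subsum_def
proof (rule infsum_cong)
  fix t assume "t \<in> T"
  then have "pair_entry t {j} \<in> \<int>" using pair_entry_Ints[of t "{j}"] pairsI[of j j] by (simp add: same_block_def)
  then obtain m where "pair_entry t {j} = of_int m" by (rule Ints_cases)
  then have "pairing t (\<tau> + cscale (of_int n) (unit_sym {j})) = pairing t \<tau> + of_int (n * m)"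
    by (simp add: pairing_add pairing_cscale pairing_unit_sym)
  then show "c t * ee (pairing t (\<tau> + cscale (of_int n) (unit_sym {j}))) = c t * ee (pairing t \<tau>)"
    by (simp only: ee_add ee_of_int mult_1_right)
qed

text \<open>Together with this factor, \<open>F\<close> below is the analogue of the invariant norm
  of a modular form of weight \<open>k\<close>, absolute value times height to the power k/2.
  \<open>E\<close> cancels the part of every Fourier term that depends on the Schur complement, so
  that \<open>F\<close> can be bounded uniformly in it.\<close>

definition E :: "complex^'g^'g \<Rightarrow> real" where
  "E \<tau> = exp (2 * pi * (\<Sum>a\<in>UNIV. \<Sum>b\<in>UNIV. t0 $ a $ b * schur_compl \<tau> j $ a $ b))"

definition F :: "complex^'g^'g \<Rightarrow> real" where
  "F \<tau> = norm (\<psi> \<tau>) * sqrt (Im (\<tau> $ j $ j)) ^ k * E \<tau>"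

lemma E_pos: "E \<tau> > 0" by (simp add: E_def)

lemma F_nonneg: "\<tau> \<in> siegel \<Longrightarrow> F \<tau> \<ge> 0"
  using siegel_jj[of \<tau> j] E_pos[of \<tau>] by (simp add: F_def)

lemma F_shear: "x j = 0 \<Longrightarrow> \<tau> \<in> siegel \<Longrightarrow> F (shear x j \<tau>) = F \<tau>"
  using shear_facts[of \<tau> x j] by (simp add: F_def E_def psi_shear)

lemma F_siegel_inv:
  assumes \<tau>: "\<tau> \<in> siegel" shows "F (siegel_inv j \<tau>) = F \<tau>"
proof -
  have "\<tau> $ j $ j \<noteq> 0" using siegel_jj[OF \<tau>, of j] by auto
  then have "norm ((\<tau> $ j $ j) ^ k) * sqrt (Im (\<tau> $ j $ j) / (norm (\<tau> $ j $ j))\<^sup>2) ^ k = sqrt (Im (\<tau> $ j $ j)) ^ k"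
    by (simp add: norm_power real_sqrt_divide power_divide)
  then show ?thesis
    unfolding F_def E_def siegel_inv_facts[OF \<tau>] psi_siegel_inv[OF \<tau>] norm_mult
    by (simp add: mult_ac)
qed

lemma translate_facts:
  fixes n :: int
  assumes \<tau>: "\<tau> \<in> siegel"
  defines "\<sigma> \<equiv> \<tau> + cscale (of_int n) (unit_sym {j})"
  shows "\<sigma> \<in> siegel" "F \<sigma> = F \<tau>" "\<sigma> $ j $ j = \<tau> $ j $ j + of_int n"
proof -
  show "\<sigma> \<in> siegel" unfolding \<sigma>_def using siegel_shift_of_real[OF \<tau>, of "of_int n"] by simp
  have I: "Im (\<sigma> $ a $ b) = Im (\<tau> $ a $ b)" for a b by (simp add: \<sigma>_def cscale_def unit_sym_def)
  then have "schur_compl \<sigma> j = schur_compl \<tau> j" by (simp add: schur_compl_def)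
  then show "F \<sigma> = F \<tau>" by (simp add: F_def E_def I) (simp add: \<sigma>_def psi_translate)
  show "\<sigma> $ j $ j = \<tau> $ j $ j + of_int n" by (simp add: \<sigma>_def cscale_def unit_sym_def)
qed

text \<open>After translation the real part is at most 1/2 in absolute value. If the height is below
  1/2, the squared norm is at most 1/2 and the inversion at least doubles the height. The threshold
  1/2, below the sqrt 3 / 2 of the fundamental domain, thus gives an induction on the number of
  doublings.\<close>

lemma reduce_height:
  "\<tau> \<in> siegel \<Longrightarrow> Im (\<tau> $ j $ j) * 2 ^ n \<ge> 1 / 2 \<Longrightarrow> \<exists>\<sigma>\<in>siegel. F \<sigma> = F \<tau> \<and> Im (\<sigma> $ j $ j) \<ge> 1 / 2"
proof (induction n arbitrary: \<tau>)
  case (Suc n)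
  show ?case
  proof (cases "Im (\<tau> $ j $ j) \<ge> 1 / 2")
    case False
    define \<sigma> where "\<sigma> = \<tau> + cscale (of_int (- round (Re (\<tau> $ j $ j)))) (unit_sym {j})"
    have \<sigma>: "\<sigma> \<in> siegel" "F \<sigma> = F \<tau>" "\<sigma> $ j $ j = \<tau> $ j $ j + of_int (- round (Re (\<tau> $ j $ j)))"
      unfolding \<sigma>_def by (rule translate_facts[OF Suc.prems(1)])+
    have v: "Im (\<sigma> $ j $ j) > 0" by (rule siegel_jj[OF \<sigma>(1)])
    have Im: "Im (\<sigma> $ j $ j) = Im (\<tau> $ j $ j)" using \<sigma>(3) by simp
    have "\<bar>Re (\<sigma> $ j $ j)\<bar> \<le> 1 / 2" using round_bound[of "Re (\<tau> $ j $ j)"] \<sigma>(3) by simp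
    then have "(Re (\<sigma> $ j $ j))\<^sup>2 \<le> (1 / 2)\<^sup>2" by (intro abs_le_square_iff[THEN iffD1]) simp
    moreover have "(Im (\<sigma> $ j $ j))\<^sup>2 \<le> (1 / 2)\<^sup>2" using False v Im by (intro power_mono) auto
    ultimately have n2: "(norm (\<sigma> $ j $ j))\<^sup>2 \<le> 1 / 2"
      unfolding cmod_power2 by (simp add: power2_eq_square)
    have n0: "(norm (\<sigma> $ j $ j))\<^sup>2 > 0" using v by auto
    have "2 * Im (\<sigma> $ j $ j) \<le> Im (siegel_inv j \<sigma> $ j $ j)"
      unfolding siegel_inv_facts(3)[OF \<sigma>(1)] using n0 mult_left_mono[OF n2, of "Im (\<sigma> $ j $ j)"] v by (simp add: field_simps)
    then have "2 * Im (\<sigma> $ j $ j) * 2 ^ n \<le> Im (siegel_inv j \<sigma> $ j $ j) * 2 ^ n"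
      by (rule mult_right_mono) simp
    moreover have "1 / 2 \<le> 2 * Im (\<sigma> $ j $ j) * 2 ^ n" using Suc.prems(2) Im by (simp add: mult_ac)
    ultimately have "Im (siegel_inv j \<sigma> $ j $ j) * 2 ^ n \<ge> 1 / 2" by (rule order_trans[rotated])
    from Suc.IH[OF siegel_inv_facts(1)[OF \<sigma>(1)] this] show ?thesis
      by (simp add: F_siegel_inv \<sigma>)
  qed (use Suc.prems in blast)
qed auto

lemma reduce:
  assumes \<tau>: "\<tau> \<in> siegel"
  obtains \<sigma> where "\<sigma> \<in> siegel" "F \<sigma> = F \<tau>" "Im (\<sigma> $ j $ j) \<ge> 1 / 2" "\<And>a. a \<noteq> j \<Longrightarrow> \<bar>slope \<sigma> j a\<bar> \<le> 1 / 2"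
proof -
  have v: "Im (\<tau> $ j $ j) > 0" by (rule siegel_jj[OF \<tau>])
  obtain n where n: "1 / Im (\<tau> $ j $ j) < 2 ^ n" using real_arch_pow[of 2 "1 / Im (\<tau> $ j $ j)"] by auto
  then have "Im (\<tau> $ j $ j) * 2 ^ n \<ge> 1 / 2" using v by (simp add: field_simps)
  from reduce_height[OF \<tau> this] obtain \<rho> where \<rho>: "\<rho> \<in> siegel" "F \<rho> = F \<tau>" "Im (\<rho> $ j $ j) \<ge> 1 / 2" by blast
  \<comment> \<open>Slopes are rounded after the height has been settled: shears keep the diagonal
    entry, whereas an inversion would disturb the slopes.\<close>
  define x where "x = (\<lambda>a. if a = j then 0 else - round (slope \<rho> j a))"
  have xj: "x j = 0" by (simp add: x_def)
  show ?thesis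
  proof (rule that[of "shear x j \<rho>"])
    show "\<bar>slope (shear x j \<rho>) j a\<bar> \<le> 1 / 2" if "a \<noteq> j" for a
      unfolding shear_facts(3)[of \<rho> x j, OF \<rho>(1) xj]
      using round_bound[of "slope \<rho> j a"] that by (simp add: x_def)
  qed (use shear_facts[of \<rho> x j] \<rho> xj in \<open>auto simp: F_shear\<close>)
qed

lemma norm_term:
  assumes t: "t \<in> T" and \<tau>: "\<tau> \<in> siegel"
  shows "norm (c t * ee (pairing t \<tau>)) * E \<tau> = norm (c t) * exp (- (2 * pi * (Im (\<tau> $ j $ j) * quad t (slope \<tau> j))))"
proof -
  have v: "Im (\<tau> $ j $ j) \<noteq> 0" using siegel_jj[OF \<tau>, of j] by simp
  show ?thesis
    unfolding norm_mult norm_ee Im_pairing_decomp[OF \<tau>, of t j] schur_compl_pairing_same_block[OF t v] E_def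
    by (simp add: exp_add[symmetric] distrib_left mult.assoc)
qed

lemma slope_jj: "\<tau> \<in> siegel \<Longrightarrow> slope \<tau> j j = 1"
  using siegel_jj[of \<tau> j] by (simp add: slope_def)

lemma F_bounded: "\<exists>M. \<forall>\<tau>\<in>siegel. F \<tau> \<le> M"
proof -
  \<comment> \<open>Bounds the contribution of the entries fixed by the block when all slopes are at
    most 1 in absolute value.\<close>
  define CL where "CL = (\<Sum>a\<in>UNIV. \<Sum>b\<in>UNIV. if a = j \<or> b = j then 0 else \<bar>t0 $ a $ b\<bar>)"
  \<comment> \<open>Height 1/4 is dictated by the estimate below: an exponent \<open>Q / 2\<close>
    is available and \<open>t $ j $ j\<close> is at most \<open>2 * Q\<close> plus a constant, which
    leaves \<open>t $ j $ j / 4\<close>.\<close>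
  define \<tau>1 :: "complex^'g^'g" where "\<tau>1 = cscale (\<i> * of_real (1 / 4)) (mat 1)"
  have I1: "Im (\<tau>1 $ a $ b) = (if b = a then 1 / 4 else 0)" for a b by (auto simp: \<tau>1_def cscale_def mat_def)
  have \<tau>1: "\<tau>1 \<in> siegel" unfolding \<tau>1_def by (rule siegel_scalar) simp
  define tr where "tr = (\<Sum>a\<in>UNIV - {j}. t0 $ a $ a)"
  have ntau1: "norm (ee (pairing t \<tau>1)) = exp (- (pi / 2 * t $ j $ j)) * exp (- (pi / 2 * tr))" if t: "t \<in> T" for t
  proof -
    have "Im (pairing t \<tau>1) = (\<Sum>a\<in>UNIV. t $ a $ a) / 4"
      unfolding Im_pairing I1 by (simp add: if_distrib[of "\<lambda>x. _ * x"] sum_divide_distrib cong: if_cong)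
    also have "(\<Sum>a\<in>UNIV. t $ a $ a) = t $ j $ j + (\<Sum>a\<in>UNIV - {j}. t $ a $ a)"
      by (rule sum.remove) auto
    also have "(\<Sum>a\<in>UNIV - {j}. t $ a $ a) = tr"
      unfolding tr_def by (rule sum.cong) (use t in \<open>auto simp: same_block_def\<close>)
    finally have I: "Im (pairing t \<tau>1) = (t $ j $ j + tr) / 4" .
    show ?thesis unfolding norm_ee I exp_add[symmetric] by (simp add: algebra_simps)
  qed
  have s1: "(\<lambda>t. norm (c t * ee (pairing t \<tau>1))) summable_on T"
    by (rule fsummable_subset[OF c \<tau>1 T_sub])
  define W where "W = exp (pi * k) * (exp (pi * CL) * exp (pi / 2 * tr))"
  have W: "W > 0" by (simp add: W_def)
  have key: "norm (\<psi> \<tau>) * sqrt (Im (\<tau> $ j $ j)) ^ k * E \<tau> \<le> W * infsum (\<lambda>t. norm (c t * ee (pairing t \<tau>1))) T"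
    if \<tau>: "\<tau> \<in> siegel" and v: "Im (\<tau> $ j $ j) \<ge> 1 / 2" and l: "\<And>a. a \<noteq> j \<Longrightarrow> \<bar>slope \<tau> j a\<bar> \<le> 1 / 2" for \<tau>
  proof -
    define v where "v = Im (\<tau> $ j $ j)"
    have v12: "v \<ge> 1 / 2" using that by (simp add: v_def)
    have st: "(\<lambda>t. norm (c t * ee (pairing t \<tau>))) summable_on T" by (rule fsummable_subset[OF c \<tau> T_sub])
    have tm: "norm (c t * ee (pairing t \<tau>)) * (sqrt v ^ k * E \<tau>) \<le> W * norm (c t * ee (pairing t \<tau>1))" if t: "t \<in> T" for t
    proof (cases "c t = 0")
      case False
      define Q where "Q = quad t (slope \<tau> j)"
      have Qk: "Q \<ge> k" unfolding Q_def by (rule big[of t "slope \<tau> j", OF t False slope_jj[OF \<tau>]])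
      \<comment> \<open>Parallelogram identity: the unit vector at \<open>j\<close> is the slope
        vector minus its part away from \<open>j\<close>, and the form is nonnegative at their
        sum.\<close>
      have QC: "t $ j $ j \<le> 2 * Q + 2 * CL"
      proof -
        define y where "y = (\<lambda>a. if a = j then 0 else slope \<tau> j a)"
        have e: "(\<lambda>a. slope \<tau> j a - y a) = (\<lambda>a. if a = j then 1 else 0)"
          using slope_jj[OF \<tau>] by (auto simp: y_def)
        have "t $ j $ j \<le> 2 * Q + 2 * quad t y"
          using quad_double[of t "slope \<tau> j" y] psd[OF t False, of "\<lambda>a. slope \<tau> j a + y a"]
          unfolding e quad_axis Q_def by simp
        moreover have "quad t y \<le> CL"
          unfolding quad_def CL_def
        proof (intro sum_mono)
          fix a b
          show "t $ a $ b * (y a * y b) \<le> (if a = j \<or> b = j then 0 else \<bar>t0 $ a $ b\<bar>)"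
          proof (cases "a = j \<or> b = j")
            case False
            have "\<bar>y a * y b\<bar> \<le> 1 * 1" unfolding abs_mult
              by (intro mult_mono) (use l[of a] l[of b] False in \<open>auto simp: y_def\<close>)
            then have "\<bar>t $ a $ b\<bar> * \<bar>y a * y b\<bar> \<le> \<bar>t $ a $ b\<bar> * 1" by (intro mult_left_mono) auto
            then show ?thesis using t False abs_ge_self[of "t $ a $ b * (y a * y b)"]
              by (simp add: same_block_def abs_mult)
          qed (auto simp: y_def)
        qed
        ultimately show ?thesis by simp
      qed
      \<comment> \<open>The exponent \<open>v * Q\<close> is split as
        \<open>(v - 1 / 2) * Q + Q / 2\<close>. The first part pays for the power of the height
        through \<open>Q \<ge> k\<close>; the second gives a bound by the series at the fixed point
        \<open>\<tau>1\<close>.\<close>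
      have "(v - 1 / 2) * Q \<ge> (v - 1 / 2) * k" using Qk v12 by (intro mult_left_mono) auto
      then have "v * Q \<ge> v * k - k / 2 + t $ j $ j / 4 - CL / 2"
        using QC by (simp add: algebra_simps)
      then have "2 * pi * (v * Q) \<ge> 2 * pi * (v * k - k / 2 + t $ j $ j / 4 - CL / 2)"
        by (intro mult_left_mono) auto
      then have 1: "exp (- (2 * pi * (v * Q))) \<le> exp (- (2 * pi * v)) ^ k * exp (pi * k) * exp (pi * CL) * exp (- (pi / 2 * t $ j $ j))"
        by (simp add: exp_add[symmetric] exp_of_nat_mult[symmetric] algebra_simps)
      have 2: "sqrt v ^ k * exp (- (2 * pi * v)) ^ k \<le> 1"
      proof -
        have "sqrt v \<le> 1 + v" using v12 by (intro real_le_lsqrt) (auto simp: power2_eq_square algebra_simps)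
        also have "\<dots> \<le> exp v" by (rule exp_ge_add_one_self)
        also have "\<dots> \<le> exp (2 * pi * v)"
        proof -
          have "1 * v \<le> (2 * pi) * v" using v12 pi_gt3 by (intro mult_right_mono) auto
          then show ?thesis by simp
        qed
        finally have "sqrt v * exp (- (2 * pi * v)) \<le> 1" by (simp add: exp_minus field_simps)
        then have "(sqrt v * exp (- (2 * pi * v))) ^ k \<le> 1" using v12 by (intro power_le_one) auto
        then show ?thesis by (simp add: power_mult_distrib)
      qed
      have "norm (c t * ee (pairing t \<tau>)) * (sqrt v ^ k * E \<tau>) = norm (c t) * (sqrt v ^ k * exp (- (2 * pi * (v * Q))))"
        using norm_term[OF t \<tau>] unfolding v_def Q_def by (simp add: mult_ac)
      also have "\<dots> \<le> norm (c t) * (sqrt v ^ k * (exp (- (2 * pi * v)) ^ k * exp (pi * k) * exp (pi * CL) * exp (- (pi / 2 * t $ j $ j))))"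
        by (intro mult_left_mono 1) (use v12 in auto)
      also have "\<dots> = (sqrt v ^ k * exp (- (2 * pi * v)) ^ k) * (norm (c t) * (exp (pi * k) * exp (pi * CL) * exp (- (pi / 2 * t $ j $ j))))"
        by (simp add: mult_ac)
      also have "\<dots> \<le> 1 * (norm (c t) * (exp (pi * k) * exp (pi * CL) * exp (- (pi / 2 * t $ j $ j))))"
        by (intro mult_right_mono 2) auto
      also have "\<dots> = W * norm (c t * ee (pairing t \<tau>1))"
        unfolding norm_mult ntau1[OF t] W_def by (simp add: exp_minus)
      finally show ?thesis .
    qed simp
    have "norm (\<psi> \<tau>) \<le> infsum (\<lambda>t. norm (c t * ee (pairing t \<tau>))) T"
      unfolding subsum_def by (rule norm_infsum_bound[OF st])
    then have "norm (\<psi> \<tau>) * (sqrt v ^ k * E \<tau>) \<le> infsum (\<lambda>t. norm (c t * ee (pairing t \<tau>))) T * (sqrt v ^ k * E \<tau>)"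
      by (rule mult_right_mono) (use v12 E_pos[of \<tau>] in auto)
    also have "\<dots> = infsum (\<lambda>t. norm (c t * ee (pairing t \<tau>)) * (sqrt v ^ k * E \<tau>)) T"
      by (rule infsum_cmult_left'[symmetric])
    also have "\<dots> \<le> infsum (\<lambda>t. W * norm (c t * ee (pairing t \<tau>1))) T"
      by (rule infsum_mono[OF summable_on_cmult_left[OF st] summable_on_cmult_right[OF s1]]) (rule tm)
    also have "\<dots> = W * infsum (\<lambda>t. norm (c t * ee (pairing t \<tau>1))) T" by (rule infsum_cmult_right')
    finally show ?thesis by (simp add: v_def mult.assoc)
  qed
  have "F \<tau> \<le> W * infsum (\<lambda>t. norm (c t * ee (pairing t \<tau>1))) T" if "\<tau> \<in> siegel" for \<tau>
  proof -
    obtain \<sigma> where "\<sigma> \<in> siegel" "F \<sigma> = F \<tau>" "Im (\<sigma> $ j $ j) \<ge> 1 / 2" "\<And>a. a \<noteq> j \<Longrightarrow> \<bar>slope \<sigma> j a\<bar> \<le> 1 / 2"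
      using reduce[OF \<open>\<tau> \<in> siegel\<close>] by blast
    then show ?thesis using key[of \<sigma>] by (simp add: F_def)
  qed
  then show ?thesis by blast
qed

text \<open>The partial sum at \<open>\<tau>\<close> is compared with points whose height is lower
  by 1/4. Once \<open>ee (k s)\<close> is split off, all frequencies
  \<open>quad t (slope \<tau> j) - k\<close> are nonnegative, so the maximum principle carries the
  bound from the lower line up to \<open>\<tau>\<close>.\<close>

lemma F_block_bound:
  assumes M: "\<And>\<sigma>. \<sigma> \<in> siegel \<Longrightarrow> F \<sigma> \<le> M" and \<tau>: "\<tau> \<in> siegel" and v: "Im (\<tau> $ j $ j) \<ge> 1 / 2"
  shows "F \<tau> \<le> M / 2"
proof -
  define v where "v = Im (\<tau> $ j $ j)"
  have v12: "v \<ge> 1 / 2" using assms(3) by (simp add: v_def)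
  \<comment> \<open>Zero coefficients are dropped because \<open>big\<close> controls the frequency
    only where the coefficient does not vanish.\<close>
  define T' where "T' = {t \<in> T. c t \<noteq> 0}"
  have T'T: "T' \<subseteq> T" by (auto simp: T'_def)
  define a where "a = (\<lambda>t. c t * ee (pairing t \<tau>))"
  define e where "e = (\<lambda>t. quad t (slope \<tau> j) - k)"
  define \<sigma> where "\<sigma> = (\<lambda>s. \<tau> + cscale s (rank_one (slope \<tau> j)))"
  have \<sigma>: "\<sigma> s \<in> siegel" "schur_compl (\<sigma> s) j = schur_compl \<tau> j" "Im (\<sigma> s $ j $ j) = v + Im s" if "Im s = - (1 / 4)" for s
    unfolding \<sigma>_def v_def by (rule rank_one_facts[OF \<tau>]; use v12 that in \<open>simp add: v_def\<close>)+
  have tm: "a t * ee (of_real (e t) * s) = ee (- (of_nat k * s)) * (c t * ee (pairing t (\<sigma> s)))" for t s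
    unfolding a_def e_def \<sigma>_def pairing_add pairing_cscale pairing_rank_one
    by (simp add: ee_add[symmetric] mult_ac) (simp add: algebra_simps ee_add[symmetric])
  have psi': "\<psi> \<rho> = infsum (\<lambda>t. c t * ee (pairing t \<rho>)) T'" for \<rho>
    unfolding subsum_def by (rule infsum_cong_neutral) (auto simp: T'_def)
  have h: "infsum (\<lambda>t. a t * ee (of_real (e t) * s)) T' = ee (- (of_nat k * s)) * \<psi> (\<sigma> s)" for s
    unfolding tm psi' by (rule infsum_cmult_right')
  \<comment> \<open>The exponential is the norm of \<open>ee (- (k s))\<close> at imaginary part
    -1/4; the rest is the bound \<open>M\<close> for \<open>F\<close>, solved for the partial sum at
    height \<open>v - 1 / 4\<close>.\<close>
  define B where "B = exp (- (pi / 2 * k)) * (M / (sqrt (v - 1 / 4) ^ k * E \<tau>))"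
  have "norm (infsum a T') \<le> B"
  proof (rule half_plane_max[where e = e and \<epsilon> = "1 / 4"])
    show "e t \<ge> 0" if "t \<in> T'" for t
      using big[of t "slope \<tau> j"] that slope_jj[OF \<tau>] by (auto simp: e_def T'_def)
    have "(\<lambda>t. norm (c t * ee (pairing t (\<sigma> (- (\<i> / 4)))))) summable_on T'"
      by (rule fsummable_subset[OF c \<sigma>(1)]) (use T'T T_sub in auto)
    then have "(\<lambda>t. norm (ee (- (of_nat k * - (\<i> / 4)))) * norm (c t * ee (pairing t (\<sigma> (- (\<i> / 4)))))) summable_on T'"
      by (rule summable_on_cmult_right)
    then have "(\<lambda>t. norm (a t * ee (of_real (e t) * - (\<i> / 4)))) summable_on T'"
      unfolding tm norm_mult .
    moreover have "norm (a t * ee (of_real (e t) * - (\<i> / 4))) = norm (a t) * exp (2 * pi * (1 / 4) * e t)" for t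
      by (simp add: norm_mult norm_ee)
    ultimately show "(\<lambda>t. norm (a t) * exp (2 * pi * (1 / 4) * e t)) summable_on T'" by simp
    fix x :: real
    define s where "s = complex_of_real x - \<i> * of_real (1 / 4)"
    have s: "Im s = - (1 / 4)" by (simp add: s_def)
    have "F (\<sigma> s) \<le> M" by (rule M[OF \<sigma>(1)[OF s]])
    then have "norm (\<psi> (\<sigma> s)) * (sqrt (v - 1 / 4) ^ k * E \<tau>) \<le> M"
      using \<sigma>[OF s] s by (simp add: F_def E_def mult.assoc)
    then have "norm (\<psi> (\<sigma> s)) \<le> M / (sqrt (v - 1 / 4) ^ k * E \<tau>)"
      using v12 E_pos[of \<tau>] by (simp add: pos_le_divide_eq)
    moreover have "norm (ee (- (of_nat k * s))) = exp (- (pi / 2 * k))"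
      by (simp add: norm_ee s)
    ultimately have "norm (ee (- (of_nat k * s)) * \<psi> (\<sigma> s)) \<le> B"
      unfolding norm_mult B_def by (simp only:) (rule mult_left_mono, auto)
    then show "norm (infsum (\<lambda>t. a t * ee (of_real (e t) * (of_real x - \<i> * of_real (1 / 4)))) T') \<le> B"
      unfolding h s_def by simp
  qed simp
  then have "norm (\<psi> \<tau>) \<le> B" unfolding psi' a_def .
  then have "F \<tau> \<le> B * (sqrt v ^ k * E \<tau>)"
    unfolding F_def v_def[symmetric] mult.assoc
    by (rule mult_right_mono) (use v12 E_pos[of \<tau>] in auto)
  also have "\<dots> = M * (exp (- (pi / 2)) * (sqrt v / sqrt (v - 1 / 4))) ^ k"
    using E_pos[of \<tau>] by (simp add: B_def power_mult_distrib power_divide exp_of_nat_mult[symmetric] mult_ac)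
  also have "\<dots> \<le> M * (1 / 2)"
  proof (rule mult_left_mono)
    have "sqrt v / sqrt (v - 1 / 4) = sqrt (v / (v - 1 / 4))" by (simp add: real_sqrt_divide)
    also have "\<dots> \<le> sqrt 2" using v12 by (intro real_sqrt_le_mono) (simp add: field_simps)
    finally have "exp (- (pi / 2)) * (sqrt v / sqrt (v - 1 / 4)) \<le> exp (- (pi / 2)) * sqrt 2"
      by (intro mult_left_mono) auto
    also have "\<dots> \<le> 1 / 2" using sqrt2_exp by (simp add: mult.commute)
    finally have b: "exp (- (pi / 2)) * (sqrt v / sqrt (v - 1 / 4)) \<le> 1 / 2" .
    have b0: "0 \<le> exp (- (pi / 2)) * (sqrt v / sqrt (v - 1 / 4))" using v12 by simp
    have "(exp (- (pi / 2)) * (sqrt v / sqrt (v - 1 / 4))) ^ k \<le> (1 / 2) ^ k"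
      by (rule power_mono[OF b b0])
    \<comment> \<open>Positivity of the weight turns the factor into a contraction.\<close>
    also have "\<dots> \<le> (1 / 2) ^ 1" using k by (intro power_decreasing) auto
    finally show "(exp (- (pi / 2)) * (sqrt v / sqrt (v - 1 / 4))) ^ k \<le> 1 / 2" by simp
    show "M \<ge> 0" using M[OF \<tau>] F_nonneg[OF \<tau>] by simp
  qed
  finally show ?thesis by simp
qed

text \<open>Every point can be moved to height at least 1/2 without changing \<open>F\<close>, so
  the finite supremum of \<open>F\<close> is at most half of itself. Hence the partial sum over the
  block vanishes, and with it each of its coefficients.\<close>

theorem block_bound_coeff_zero: "c t0 = 0"
proof -
  define M where "M = Sup (F ` siegel)"
  obtain M' where M': "\<And>\<tau>. \<tau> \<in> siegel \<Longrightarrow> F \<tau> \<le> M'" using F_bounded by blast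
  then have bdd: "bdd_above (F ` siegel)" by (meson bdd_aboveI2)
  have M: "F \<tau> \<le> M" if "\<tau> \<in> siegel" for \<tau>
    unfolding M_def using that bdd by (intro cSup_upper) auto
  have half: "F \<tau> \<le> M / 2" if \<tau>: "\<tau> \<in> siegel" for \<tau>
  proof -
    obtain \<sigma> where "\<sigma> \<in> siegel" "F \<sigma> = F \<tau>" "Im (\<sigma> $ j $ j) \<ge> 1 / 2"
      using reduce[OF \<tau>] by blast
    then show ?thesis using F_block_bound[of M \<sigma>] M by simp
  qed
  have "\<psi> \<tau> = 0" if \<tau>: "\<tau> \<in> siegel" for \<tau>
  proof -
    have "M \<le> M / 2" unfolding M_def
      by (rule cSup_least) (use \<tau> half M_def in auto)
    then have "F \<tau> \<le> 0" using half[OF \<tau>] by simp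
    then have "F \<tau> = 0" using F_nonneg[OF \<tau>] by simp
    then show ?thesis using siegel_jj[OF \<tau>, of j] E_pos[of \<tau>] by (simp add: F_def)
  qed
  from subsum_zero_imp[OF c T_sub this, of t0] show ?thesis using t0 by (simp add: same_block_def)
qed

end

section \<open>Fourier coefficients of Jacobi forms\<close>

text \<open>Coefficients of a function of (\<tau>1, z) read as those of its lift: the lower right
  entry must be the index \<open>m\<close>, and the factor 2 undoes the halving of \<open>r\<close>
  in \<open>index_matrix\<close>.\<close>

definition lift_coeff :: "nat \<Rightarrow> ((real^'n::finite^'n) \<times> (real^1^'n) \<Rightarrow> complex) \<Rightarrow> real^('n + 1)^('n + 1) \<Rightarrow> complex" where
  "lift_coeff m c t = (if t $ Inr 1 $ Inr 1 = real m then c (upper_left t, 2 *\<^sub>R upper_right t) else 0)"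

lemma index_matrix_parts:
  "upper_left (index_matrix n r m) = n" "2 *\<^sub>R upper_right (index_matrix n r m) = r"
  "index_matrix n r m $ Inr 1 $ Inr 1 = real m"
  by (simp_all add: index_matrix_def mat_def)

lemma index_matrix_inverse:
  fixes t :: "real^('n::finite + 1)^('n + 1)"
  assumes "transpose t = t" "t $ Inr 1 $ Inr 1 = real m"
  shows "index_matrix (upper_left t) (2 *\<^sub>R upper_right t) m = t"
proof -
  have "t $ Inr i $ Inr j = real m" for i j :: 1 using assms(2) by (metis num1_eq1)
  moreover have "t $ Inr i $ Inl j = t $ Inl j $ Inr i" for i j using sym_nth[OF assms(1)] .
  ultimately show ?thesis
    by (simp add: index_matrix_def vec_sum_eq_iff upper_left_def upper_right_def transpose_def mat_def)
qed

lemma index_matrix_half_integral: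
  assumes "(n, r) \<in> fourier_indices" shows "half_integral (index_matrix n r m)"
proof -
  have n: "transpose n = n" "\<And>i. n $ i $ i \<in> \<int>" "\<And>i j. 2 * n $ i $ j \<in> \<int>"
    using assms by (auto simp: fourier_indices_def half_integral_def)
  have r: "r $ i $ j \<in> \<int>" for i j
    by (subst num1_eq1[of j]) (use assms in \<open>simp add: fourier_indices_def\<close>)
  have "transpose (index_matrix n r m) = index_matrix n r m"
    using sym_nth[OF n(1)] by (simp add: index_matrix_def vec_sum_eq_iff transpose_def mat_def)
  moreover have "index_matrix n r m $ i $ i \<in> \<int>" for i
    using n(2) by (cases i) (auto simp: index_matrix_def mat_def)
  moreover have "2 * index_matrix n r m $ i $ j \<in> \<int>" for i j
    using n(3) r by (cases i; cases j) (auto simp: index_matrix_def mat_def transpose_def)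
  ultimately show ?thesis unfolding half_integral_def by blast
qed

lemma parts_fourier_indices:
  fixes t :: "real^('n::finite + 1)^('n + 1)"
  assumes "half_integral t" shows "(upper_left t, 2 *\<^sub>R upper_right t) \<in> fourier_indices"
  using assms by (auto simp: fourier_indices_def half_integral_def upper_left_def upper_right_def transpose_def vec_eq_iff)

lemma sum_num1 [simp]: "(\<Sum>x\<in>(UNIV :: 1 set). f x) = f 1"
  by (simp add: UNIV_1)

lemma index_matrix_char:
  assumes "\<tau> \<in> siegel"
  shows "ee (pairing (index_matrix n r m) \<tau>) =
    e_tr (map_matrix of_real n ** upper_left \<tau> + map_matrix of_real r ** transpose (upper_right \<tau>)) * ee (of_nat m * \<tau> $ Inr 1 $ Inr 1)"
proof -
  have s: "\<tau> $ a $ b = \<tau> $ b $ a" for a b by (rule sym_nth[OF siegelD_sym[OF assms]])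
  have "trace (map_matrix of_real n ** upper_left \<tau> + map_matrix of_real r ** transpose (upper_right \<tau>)) =
     (\<Sum>a\<in>UNIV. \<Sum>b\<in>UNIV. of_real (n $ a $ b) * \<tau> $ Inl a $ Inl b) + (\<Sum>a\<in>UNIV. of_real (r $ a $ 1) * \<tau> $ Inl a $ Inr 1)"
    using s by (simp add: trace_def matrix_matrix_mult_def upper_left_def upper_right_def transpose_def sum.distrib)
  moreover have "pairing (index_matrix n r m) \<tau> =
     (\<Sum>a\<in>UNIV. \<Sum>b\<in>UNIV. of_real (n $ a $ b) * \<tau> $ Inl a $ Inl b) + (\<Sum>a\<in>UNIV. of_real (r $ a $ 1) * \<tau> $ Inl a $ Inr 1)
     + of_nat m * \<tau> $ Inr 1 $ Inr 1"
  proof -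
    have "pairing (index_matrix n r m) \<tau> =
       (\<Sum>a\<in>UNIV. (\<Sum>b\<in>UNIV. of_real (n $ a $ b) * \<tau> $ Inl a $ Inl b) + of_real (r $ a $ 1) * \<tau> $ Inl a $ Inr 1 / 2)
       + ((\<Sum>a\<in>UNIV. of_real (r $ a $ 1) * \<tau> $ Inl a $ Inr 1 / 2) + of_nat m * \<tau> $ Inr 1 $ Inr 1)"
      using s[of "Inr 1" "Inl _"]
      by (simp add: pairing_def sum_UNIV_sum index_matrix_def transpose_def mat_def)
    then show ?thesis
      by (simp only: sum.distrib) (simp add: sum_divide_distrib[symmetric])
  qed
  ultimately show ?thesis by (simp add: ee_add e_tr_def[folded ee_def])
qed

lemma lift_coeff_has_sum:
  fixes c :: "(real^'n::finite^'n) \<times> (real^1^'n) \<Rightarrow> complex"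
  assumes \<tau>: "\<tau> \<in> siegel"
  shows "((\<lambda>t. lift_coeff m c t * ee (pairing t \<tau>)) has_sum (S * ee (of_nat m * \<tau> $ Inr 1 $ Inr 1))) (Collect half_integral) \<longleftrightarrow>
    ((\<lambda>(n, r). c (n, r) * e_tr (map_matrix of_real n ** upper_left \<tau> + map_matrix of_real r ** transpose (upper_right \<tau>)))
       has_sum S) fourier_indices"
proof -
  define H where "H = {t :: real^('n + 1)^('n + 1). half_integral t \<and> t $ Inr 1 $ Inr 1 = real m}"
  have "((\<lambda>t. lift_coeff m c t * ee (pairing t \<tau>)) has_sum (S * ee (of_nat m * \<tau> $ Inr 1 $ Inr 1))) (Collect half_integral) \<longleftrightarrow>
     ((\<lambda>t. lift_coeff m c t * ee (pairing t \<tau>)) has_sum (S * ee (of_nat m * \<tau> $ Inr 1 $ Inr 1))) H"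
    by (rule has_sum_cong_neutral) (auto simp: H_def lift_coeff_def)
  also have "\<dots> \<longleftrightarrow> ((\<lambda>p. (case p of (n, r) \<Rightarrow> c (n, r) * e_tr (map_matrix of_real n ** upper_left \<tau> + map_matrix of_real r ** transpose (upper_right \<tau>)))
      * ee (of_nat m * \<tau> $ Inr 1 $ Inr 1)) has_sum (S * ee (of_nat m * \<tau> $ Inr 1 $ Inr 1))) fourier_indices"
  proof (rule has_sum_reindex_bij_witness[where i = "\<lambda>(n, r). index_matrix n r m" and j = "\<lambda>t. (upper_left t, 2 *\<^sub>R upper_right t)"])
    fix t assume t: "t \<in> H"
    then have im: "index_matrix (upper_left t) (2 *\<^sub>R upper_right t) m = t"
      by (intro index_matrix_inverse) (auto simp: H_def half_integral_def)
    then show "(case (upper_left t, 2 *\<^sub>R upper_right t) of (n, r) \<Rightarrow> index_matrix n r m) = t" by simp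
    show "(upper_left t, 2 *\<^sub>R upper_right t) \<in> fourier_indices" using t by (intro parts_fourier_indices) (auto simp: H_def)
    show "(case (upper_left t, 2 *\<^sub>R upper_right t) of (n, r) \<Rightarrow> c (n, r) * e_tr (map_matrix of_real n ** upper_left \<tau> + map_matrix of_real r ** transpose (upper_right \<tau>)))
      * ee (of_nat m * \<tau> $ Inr 1 $ Inr 1) = lift_coeff m c t * ee (pairing t \<tau>)"
      using index_matrix_char[OF \<tau>, of "upper_left t" "2 *\<^sub>R upper_right t" m] t unfolding im
      by (simp add: lift_coeff_def H_def)
  next
    fix p assume "p \<in> (fourier_indices :: ((real^'n^'n) \<times> (real^1^'n)) set)"
    then obtain n r where p: "p = (n, r)" "(n, r) \<in> fourier_indices" by (cases p) auto
    show "(upper_left (case p of (n, r) \<Rightarrow> index_matrix n r m), 2 *\<^sub>R upper_right (case p of (n, r) \<Rightarrow> index_matrix n r m)) = p"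
      by (simp add: p(1) index_matrix_parts)
    show "(case p of (n, r) \<Rightarrow> index_matrix n r m) \<in> H"
      using index_matrix_half_integral[OF p(2)] by (simp add: p(1) H_def index_matrix_parts)
  qed simp
  also have "\<dots> \<longleftrightarrow> ((\<lambda>(n, r). c (n, r) * e_tr (map_matrix of_real n ** upper_left \<tau> + map_matrix of_real r ** transpose (upper_right \<tau>)))
       has_sum S) fourier_indices"
    by (subst has_sum_cmult_left_iff) simp_all
  finally show ?thesis .
qed

text \<open>Expansions of lifts live on the half space of genus g, those of Jacobi functions on
  their own domain. A lower right entry \<open>\<i> * \<eta>\<close> with large
  \<open>\<eta>\<close> makes the Schur complement at the last position a small perturbation of the
  imaginary part of \<open>\<tau>1\<close>, so every point of the domain is reached.\<close>

lemma extend_to_siegel: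
  fixes \<tau>1 :: "complex^'n::finite^'n" and z :: "complex^1^'n"
  assumes \<tau>1: "\<tau>1 \<in> siegel"
  obtains \<tau> where "\<tau> \<in> siegel" "upper_left \<tau> = \<tau>1" "upper_right \<tau> = z"
proof -
  obtain d where d: "d > 0" "\<And>X. transpose X = X \<Longrightarrow> (\<And>a b. \<bar>Im (X $ a $ b)\<bar> \<le> d) \<Longrightarrow> \<tau>1 + X \<in> siegel"
    using siegel_perturb[OF \<tau>1] by blast
  define K where "K = (\<Sum>a\<in>UNIV. \<Sum>b\<in>UNIV. \<bar>Im (z $ a $ 1) * Im (z $ b $ 1)\<bar>)"
  have K: "\<bar>Im (z $ a $ 1) * Im (z $ b $ 1)\<bar> \<le> K" for a b
  proof -
    have "\<bar>Im (z $ a $ 1) * Im (z $ b $ 1)\<bar> \<le> (\<Sum>b\<in>UNIV. \<bar>Im (z $ a $ 1) * Im (z $ b $ 1)\<bar>)"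
      by (rule member_le_sum) auto
    also have "\<dots> \<le> K" unfolding K_def by (rule member_le_sum[where f = "\<lambda>a. \<Sum>b\<in>UNIV. \<bar>Im (z $ a $ 1) * Im (z $ b $ 1)\<bar>"]) (auto intro: sum_nonneg)
    finally show ?thesis .
  qed
  have K0: "K \<ge> 0" unfolding K_def by (intro sum_nonneg) auto
  \<comment> \<open>Chosen so that \<open>K / \<eta>\<close> stays within the tolerance
    \<open>d\<close>; the summand 1 keeps it positive when \<open>K\<close> is 0.\<close>
  define \<eta> where "\<eta> = K / d + 1"
  have \<eta>: "\<eta> > 0" "K \<le> d * \<eta>" using K0 d by (auto simp: \<eta>_def field_simps intro: add_nonneg_pos)
  define \<tau> :: "complex^('n + 1)^('n + 1)" where "\<tau> = block \<tau>1 z (transpose z) (\<chi> a b. \<i> * of_real \<eta>)"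
  have parts: "upper_left \<tau> = \<tau>1" "upper_right \<tau> = z" by (simp_all add: \<tau>_def)
  have jj: "Im (\<tau> $ Inr 1 $ Inr 1) = \<eta>" by (simp add: \<tau>_def)
  define X :: "complex^'n^'n" where "X = (\<chi> a b. - \<i> * of_real (Im (z $ a $ 1) * Im (z $ b $ 1) / \<eta>))"
  have X: "\<tau>1 + X \<in> siegel"
  proof (rule d(2))
    show "transpose X = X" by (simp add: X_def transpose_def vec_eq_iff mult.commute)
    show "\<bar>Im (X $ a $ b)\<bar> \<le> d" for a b
      using order_trans[OF K[of a b] \<eta>(2)] \<eta>(1) by (simp add: X_def field_simps)
  qed
  have "\<tau> \<in> siegel"
    unfolding siegel_schur_compl_iff[of \<tau> "Inr 1"]
  proof (intro conjI allI impI)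
    show "transpose \<tau> = \<tau>"
      using siegelD_sym[OF \<tau>1] by (simp add: \<tau>_def transpose_block) (simp add: transpose_def vec_sum_eq_iff)
    show "Im (\<tau> $ Inr 1 $ Inr 1) > 0" using jj \<eta> by simp
    fix u :: "'n + 1 \<Rightarrow> real" assume "\<exists>a. a \<noteq> Inr 1 \<and> u a \<noteq> 0"
    then obtain a where a: "u (Inl a) \<noteq> 0" by (metis num1_eq1 sum.exhaust)
    have sI: "schur_compl \<tau> (Inr 1) $ Inl a $ Inl b = Im ((\<tau>1 + X) $ a $ b)" for a b
      using \<eta>(1) by (simp add: schur_compl_def \<tau>_def X_def transpose_def)
    have sz: "schur_compl \<tau> (Inr 1) $ Inr i $ b = 0" "schur_compl \<tau> (Inr 1) $ b $ Inr i = 0" for b and i :: 1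
      using schur_compl_zero[of \<tau> "Inr 1"] jj \<eta>(1) by (simp_all add: num1_eq1[of i])
    have "quad (schur_compl \<tau> (Inr 1)) u = (\<Sum>a\<in>UNIV. \<Sum>b\<in>UNIV. Im ((\<tau>1 + X) $ a $ b) * ((\<chi> a. u (Inl a)) $ a * (\<chi> a. u (Inl a)) $ b))"
      unfolding quad_def sum_UNIV_sum sI sz by simp
    also have "\<dots> > 0"
    proof -
      have "(\<chi> a. u (Inl a)) $ a \<noteq> 0" using a by simp
      then have "(\<chi> a. u (Inl a)) \<noteq> 0" by (metis zero_index)
      then show ?thesis using X unfolding siegel_iff by blast
    qed
    finally show "quad (schur_compl \<tau> (Inr 1)) u > 0" .
  qed
  then show ?thesis using that parts by blast
qed

lemma has_fourier_expansion_iff: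
  fixes \<phi> :: "('n::finite) jacobi_fun"
  shows "has_fourier_expansion \<phi> c \<longleftrightarrow> (\<forall>x. x \<notin> fourier_indices \<longrightarrow> c x = 0) \<and> fourier_exp (jacobi_lift m \<phi>) (lift_coeff m c)"
proof -
  have "fourier_exp (jacobi_lift m \<phi>) (lift_coeff m c) \<longleftrightarrow> (\<forall>\<tau>\<in>siegel. ((\<lambda>(n, r). c (n, r) * e_tr (map_matrix of_real n ** upper_left \<tau> + map_matrix of_real r ** transpose (upper_right \<tau>)))
       has_sum \<phi> (upper_left \<tau>, upper_right \<tau>)) fourier_indices)"
    unfolding fourier_exp_def jacobi_lift_def e_tr_lower_right by (simp only: lift_coeff_has_sum cong: ball_cong)
  also have "\<dots> \<longleftrightarrow> (\<forall>(\<tau>, z) \<in> jacobi_domain.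
        ((\<lambda>(n, r). c (n, r) * e_tr (map_matrix of_real n ** \<tau> + map_matrix of_real r ** transpose z)) has_sum \<phi> (\<tau>, z)) fourier_indices)"
    (is "?L \<longleftrightarrow> ?R")
  proof
    assume L: ?L
    show ?R
    proof (clarify)
      fix \<tau>1 :: "complex^'n^'n" and z assume "(\<tau>1, z) \<in> jacobi_domain"
      then have "\<tau>1 \<in> siegel" by (simp add: jacobi_domain_def)
      then obtain \<tau> where "\<tau> \<in> siegel" "upper_left \<tau> = \<tau>1" "upper_right \<tau> = z" by (rule extend_to_siegel)
      with L show "((\<lambda>(n, r). c (n, r) * e_tr (map_matrix of_real n ** \<tau>1 + map_matrix of_real r ** transpose z)) has_sum \<phi> (\<tau>1, z)) fourier_indices"
        by blast
    qed
  next
    assume ?R then show ?L by (auto simp: jacobi_domain_def upper_left_siegel)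
  qed
  finally show ?thesis unfolding has_fourier_expansion_def by blast
qed

lemma has_fourier_expansion_unique:
  fixes \<phi> :: "('n::finite) jacobi_fun"
  assumes "has_fourier_expansion \<phi> c" "has_fourier_expansion \<phi> c'"
  shows "c = c'"
proof
  fix x :: "(real^'n^'n) \<times> (real^1^'n)"
  obtain n r where x: "x = (n, r)" by (cases x)
  show "c x = c' x"
  proof (cases "x \<in> fourier_indices")
    case True
    \<comment> \<open>Any index would do for the lift, since uniqueness involves no transformation
      law; 0 is taken.\<close>
    have "lift_coeff 0 c (index_matrix n r 0) = lift_coeff 0 c' (index_matrix n r 0)"
      by (rule fourier_exp_unique[of "jacobi_lift 0 \<phi>"])
        (use assms has_fourier_expansion_iff True x index_matrix_half_integral in auto)
    then show ?thesis by (simp add: lift_coeff_def index_matrix_parts x)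
  next
    case False
    then show ?thesis using assms unfolding has_fourier_expansion_def by metis
  qed
qed

lemma fourier_coeff_eqI: "has_fourier_expansion \<phi> c \<Longrightarrow> fourier_coeff \<phi> = c"
  unfolding fourier_coeff_def using has_fourier_expansion_unique by blast

lemma law_single:
  fixes c :: "real^'g::finite^'g \<Rightarrow> complex"
  assumes c: "fsummable c" and l: "law \<gamma> J c (Collect half_integral)" and t: "half_integral t"
    and comm: "\<And>A \<tau> s. A \<in> pairs \<Longrightarrow> \<tau> \<in> siegel \<Longrightarrow> \<gamma> (\<tau> + cscale (of_real s) (unit_sym A)) = \<gamma> \<tau> + cscale (of_real s) (unit_sym A)"
    and J: "\<And>A \<tau> s. A \<in> pairs \<Longrightarrow> \<tau> \<in> siegel \<Longrightarrow> J (\<tau> + cscale (of_real s) (unit_sym A)) = J \<tau>"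
    and \<tau>: "\<tau> \<in> siegel"
  shows "c t * ee (pairing t (\<gamma> \<tau>)) = J \<tau> * (c t * ee (pairing t \<tau>))"
proof -
  have l': "law \<gamma> J c {s \<in> Collect half_integral. \<forall>A\<in>pairs. pair_entry s A = of_int \<lfloor>pair_entry t A\<rfloor>}"
    by (rule law_restrict[OF c subset_refl subset_refl l comm J])
  have fl: "pair_entry t A = of_int \<lfloor>pair_entry t A\<rfloor>" if "A \<in> pairs" for A
    using pair_entry_Ints[OF t that] by (auto elim: Ints_cases)
  have "s = t" if "half_integral s" "\<forall>A\<in>pairs. pair_entry s A = of_int \<lfloor>pair_entry t A\<rfloor>" for s
  proof (rule eq_by_entries)
    show "pair_entry s A = pair_entry t A" if "A \<in> pairs" for A
      using \<open>\<forall>A\<in>pairs. pair_entry s A = of_int \<lfloor>pair_entry t A\<rfloor>\<close> that fl[OF that] by metis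
  qed (use that t in \<open>auto simp: half_integral_def\<close>)
  then have "{s \<in> Collect half_integral. \<forall>A\<in>pairs. pair_entry s A = of_int \<lfloor>pair_entry t A\<rfloor>} = {t}"
    using t fl by blast
  with l' \<tau> show ?thesis by (simp add: law_def subsum_def)
qed

lemma fourier_exp_subsum: "fourier_exp \<Phi> c \<Longrightarrow> \<tau> \<in> siegel \<Longrightarrow> subsum c (Collect half_integral) \<tau> = \<Phi> \<tau>"
  by (simp add: fourier_exp_def subsum_def infsumI)

text \<open>A real translation of the last diagonal entry multiplies the lift by
  \<open>ee (m s)\<close> and the term of index \<open>t\<close> by its own character. Comparing
  single coefficients at one suitable \<open>s\<close> forces the two frequencies to agree.\<close>

lemma jacobi_support:
  fixes \<phi> :: "('n::finite) jacobi_fun"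
  assumes c: "fourier_exp (jacobi_lift m \<phi>) c" and t: "half_integral t" and nz: "c t \<noteq> 0"
  shows "t $ Inr 1 $ Inr 1 = real m"
proof (rule ccontr)
  assume ne: "t $ Inr 1 $ Inr 1 \<noteq> real m"
  \<comment> \<open>Makes the two phases differ by the factor \<open>ee (1 / 2)\<close>, which is
    not 1.\<close>
  define s where "s = 1 / (2 * (t $ Inr 1 $ Inr 1 - real m))"
  obtain \<tau> :: "complex^('n + 1)^('n + 1)" where \<tau>: "\<tau> \<in> siegel"
    using siegel_scalar[of 1] by (metis zero_less_one)
  define \<gamma> where "\<gamma> = (\<lambda>\<tau>::complex^('n + 1)^('n + 1). \<tau> + cscale (of_real s) (unit_sym {Inr 1}))"
  have "jacobi_lift m \<phi> (\<gamma> \<tau>) = ee (of_nat m * of_real s) * jacobi_lift m \<phi> \<tau>" for \<tau>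
  proof -
    have "upper_left (\<gamma> \<tau>) = upper_left \<tau>" "upper_right (\<gamma> \<tau>) = upper_right \<tau>"
      by (simp_all add: \<gamma>_def upper_left_def upper_right_def unit_sym_def cscale_def vec_eq_iff)
    moreover have "\<gamma> \<tau> $ Inr 1 $ Inr 1 = \<tau> $ Inr 1 $ Inr 1 + of_real s" by (simp add: \<gamma>_def cscale_def unit_sym_def)
    ultimately show ?thesis by (simp add: jacobi_lift_def e_tr_lower_right distrib_left ee_add)
  qed
  then have "law \<gamma> (\<lambda>_. ee (of_nat m * of_real s)) c (Collect half_integral)"
    unfolding law_def using fourier_exp_subsum[OF c] siegel_shift_of_real[of _ s "{Inr 1}"] by (metis \<gamma>_def)
  then have "c t * ee (pairing t (\<gamma> \<tau>)) = ee (of_nat m * of_real s) * (c t * ee (pairing t \<tau>))"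
    by (rule law_single[OF fourier_exp_summable[OF c] _ t _ _ \<tau>]) (simp_all add: \<gamma>_def)
  then have "ee (pairing t \<tau>) * ee (of_real (s * t $ Inr 1 $ Inr 1)) = ee (pairing t \<tau>) * ee (of_nat m * of_real s)"
    using nz by (simp add: \<gamma>_def pairing_add pairing_cscale pairing_unit_sym pair_entry_single ee_add mult_ac)
  then have "ee (of_real (s * t $ Inr 1 $ Inr 1)) = ee (of_nat m * of_real s)" by simp
  then have "ee (of_real (s * t $ Inr 1 $ Inr 1) + - (of_nat m * of_real s)) = 1" unfolding ee_add ee_minus by simp
  moreover have "complex_of_real (s * t $ Inr 1 $ Inr 1) + - (of_nat m * of_real s) = of_real (s * (t $ Inr 1 $ Inr 1 - real m))"
    by (simp add: algebra_simps)
  moreover have "s * (t $ Inr 1 $ Inr 1 - real m) = 1 / 2" using ne by (simp add: s_def)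
  ultimately have "ee (of_real (1 / 2)) = 1" by metis
  then have "ee (1 / 2) = 1" by simp
  then obtain n :: int where "(1 / 2 :: complex) = of_int n" unfolding ee_eq_1 by blast
  then have "complex_of_int 1 = of_int (2 * n)" by (simp add: mult.commute)
  then have "1 = 2 * n" by (simp only: of_int_eq_iff)
  then show False by presburger
qed

text \<open>The expansion of the lift is supported on indices with lower right entry
  \<open>m\<close> and so descends to \<phi>. With uniqueness this gives the definite description in
  \<open>fourier_coeff\<close> its meaning.\<close>

lemma jacobi_fourier_expansion:
  fixes \<phi> :: "('n::finite) jacobi_fun"
  assumes \<phi>: "\<phi> \<in> jacobi_forms k m"
  shows "has_fourier_expansion \<phi> (fourier_coeff \<phi>)"
proof -
  obtain c where c: "fourier_exp (jacobi_lift m \<phi>) c"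
    using siegel_fourier_exists[OF siegel_periodic_jacobi_lift[OF \<phi>]] by blast
  define c' where "c' = (\<lambda>(n, r). if (n, r) \<in> fourier_indices then c (index_matrix n r m) else 0)"
  have "lift_coeff m c' t = c t" if t: "half_integral t" for t
  proof (cases "t $ Inr 1 $ Inr 1 = real m")
    case True
    then show ?thesis
      using index_matrix_inverse[OF _ True] parts_fourier_indices[OF t] t by (simp add: lift_coeff_def c'_def half_integral_def)
  next
    case False
    then show ?thesis using jacobi_support[OF c t] by (auto simp: lift_coeff_def)
  qed
  then have "fourier_exp (jacobi_lift m \<phi>) (lift_coeff m c')"
    unfolding fourier_exp_def
  proof (intro ballI)
    fix \<tau> :: "complex^('n + 1)^('n + 1)" assume "\<tau> \<in> siegel"
    then have "((\<lambda>t. c t * ee (pairing t \<tau>)) has_sum jacobi_lift m \<phi> \<tau>) (Collect half_integral)"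
      using c by (simp add: fourier_exp_def)
    then show "((\<lambda>t. lift_coeff m c' t * ee (pairing t \<tau>)) has_sum jacobi_lift m \<phi> \<tau>) (Collect half_integral)"
      by (rule has_sum_cong[THEN iffD1, rotated]) (simp add: \<open>\<And>t. half_integral t \<Longrightarrow> lift_coeff m c' t = c t\<close>)
  qed
  then have "has_fourier_expansion \<phi> c'"
    using has_fourier_expansion_iff[of \<phi> c' m] by (auto simp: c'_def)
  then show ?thesis using fourier_coeff_eqI by metis
qed

lemma jacobi_fourier_exp:
  fixes \<phi> :: "('n::finite) jacobi_fun"
  assumes "\<phi> \<in> jacobi_forms k m"
  shows "fourier_exp (jacobi_lift m \<phi>) (lift_coeff m (fourier_coeff \<phi>))"
  using jacobi_fourier_expansion[OF assms] has_fourier_expansion_iff by blast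

lemma jacobi_law_shear:
  fixes \<phi> :: "('n::finite) jacobi_fun"
  assumes \<phi>: "\<phi> \<in> jacobi_forms k m" and x: "x (Inl j) = 0"
  shows "law (shear x (Inl j)) (\<lambda>_. 1) (lift_coeff m (fourier_coeff \<phi>)) (Collect half_integral)"
  unfolding law_def
  using fourier_exp_subsum[OF jacobi_fourier_exp[OF \<phi>]] shear_facts(1)[of _ x "Inl j"] jacobi_shear[OF \<phi>, of _ x j] x
  by simp

lemma jacobi_law_siegel_inv:
  fixes \<phi> :: "('n::finite) jacobi_fun"
  assumes \<phi>: "\<phi> \<in> jacobi_forms k m"
  shows "law (siegel_inv (Inl j)) (\<lambda>\<tau>. (\<tau> $ Inl j $ Inl j) ^ k) (lift_coeff m (fourier_coeff \<phi>)) (Collect half_integral)"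
  unfolding law_def
proof (intro ballI conjI)
  fix \<tau> :: "complex^('n + 1)^('n + 1)" assume \<tau>: "\<tau> \<in> siegel"
  show "siegel_inv (Inl j) \<tau> \<in> siegel" by (rule siegel_inv_facts[OF \<tau>])
  have "\<tau> $ Inl j $ Inl j \<noteq> 0" using siegel_jj[OF \<tau>, of "Inl j"] by auto
  then show "subsum (lift_coeff m (fourier_coeff \<phi>)) (Collect half_integral) (siegel_inv (Inl j) \<tau>) =
     (\<tau> $ Inl j $ Inl j) ^ k * subsum (lift_coeff m (fourier_coeff \<phi>)) (Collect half_integral) \<tau>"
    using fourier_exp_subsum[OF jacobi_fourier_exp[OF \<phi>]] jacobi_siegel_inv[OF \<phi> \<tau>] siegel_inv_facts(1)[OF \<tau>] \<tau> by simp
qed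

section \<open>The Koecher principle and the support of a formal series\<close>

definition unimod_act :: "int^'g::finite^'g \<Rightarrow> real^'g^'g \<Rightarrow> real^'g^'g" where
  "unimod_act u t = transpose (map_matrix of_int u) ** t ** map_matrix of_int u"

lemma unimod_act_nth: "unimod_act u t $ a $ b = (\<Sum>c\<in>UNIV. \<Sum>d\<in>UNIV. of_int (u $ c $ a) * t $ c $ d * of_int (u $ d $ b))"
proof -
  have "unimod_act u t $ a $ b = (\<Sum>d\<in>UNIV. \<Sum>c\<in>UNIV. of_int (u $ c $ a) * t $ c $ d * of_int (u $ d $ b))"
    by (simp add: unimod_act_def matrix_matrix_mult_def transpose_def sum_distrib_right)
  also have "\<dots> = (\<Sum>c\<in>UNIV. \<Sum>d\<in>UNIV. of_int (u $ c $ a) * t $ c $ d * of_int (u $ d $ b))"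
    by (rule sum.swap)
  finally show ?thesis .
qed

lemma map_of_int_mult: "map_matrix of_int (u ** v) = (map_matrix of_int u ** map_matrix of_int v :: real^'g^'g)"
  for u v :: "int^'g::finite^'g"
  by (simp add: vec_eq_iff matrix_matrix_mult_def)

lemma unimod_act_unimod_act: "unimod_act v (unimod_act u t) = unimod_act (u ** v) t"
  unfolding unimod_act_def map_of_int_mult matrix_transpose_mul by (simp only: matrix_mul_assoc)

lemma unimod_act_one: "unimod_act (mat 1) t = t"
proof -
  have "map_matrix of_int (mat 1 :: int^'a^'a) = (mat 1 :: real^'a^'a)" by (simp add: vec_eq_iff mat_def)
  then show ?thesis by (simp add: unimod_act_def transpose_mat)
qed

lemma sum_swap4:
  fixes F :: "'a::finite \<Rightarrow> 'a \<Rightarrow> 'a \<Rightarrow> 'a \<Rightarrow> 'b::comm_monoid_add"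
  shows "(\<Sum>c\<in>UNIV. \<Sum>d\<in>UNIV. \<Sum>a\<in>UNIV. \<Sum>b\<in>UNIV. F a b c d) = (\<Sum>a\<in>UNIV. \<Sum>b\<in>UNIV. \<Sum>c\<in>UNIV. \<Sum>d\<in>UNIV. F a b c d)"
proof -
  have "(\<Sum>c\<in>UNIV. \<Sum>d\<in>UNIV. \<Sum>a\<in>UNIV. \<Sum>b\<in>UNIV. F a b c d) = (\<Sum>c\<in>UNIV. \<Sum>a\<in>UNIV. \<Sum>d\<in>UNIV. \<Sum>b\<in>UNIV. F a b c d)"
    by (intro sum.cong refl sum.swap)
  also have "\<dots> = (\<Sum>a\<in>UNIV. \<Sum>c\<in>UNIV. \<Sum>d\<in>UNIV. \<Sum>b\<in>UNIV. F a b c d)" by (rule sum.swap)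
  also have "\<dots> = (\<Sum>a\<in>UNIV. \<Sum>c\<in>UNIV. \<Sum>b\<in>UNIV. \<Sum>d\<in>UNIV. F a b c d)"
    by (intro sum.cong refl sum.swap)
  also have "\<dots> = (\<Sum>a\<in>UNIV. \<Sum>b\<in>UNIV. \<Sum>c\<in>UNIV. \<Sum>d\<in>UNIV. F a b c d)"
    by (intro sum.cong refl sum.swap)
  finally show ?thesis .
qed

lemma quad_unimod_act: "quad (unimod_act u t) x = quad t (\<lambda>c. \<Sum>a\<in>UNIV. of_int (u $ c $ a) * x a)"
proof -
  have "quad t (\<lambda>c. \<Sum>a\<in>UNIV. of_int (u $ c $ a) * x a) =
     (\<Sum>c\<in>UNIV. \<Sum>d\<in>UNIV. \<Sum>a\<in>UNIV. \<Sum>b\<in>UNIV. of_int (u $ c $ a) * t $ c $ d * of_int (u $ d $ b) * (x a * x b))"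
    unfolding quad_def sum_product unfolding sum_distrib_left by (intro sum.cong refl) (simp only: mult_ac)
  also have "\<dots> = (\<Sum>a\<in>UNIV. \<Sum>b\<in>UNIV. \<Sum>c\<in>UNIV. \<Sum>d\<in>UNIV. of_int (u $ c $ a) * t $ c $ d * of_int (u $ d $ b) * (x a * x b))"
    by (rule sum_swap4)
  finally show ?thesis unfolding quad_def unimod_act_nth by (simp add: sum_distrib_right)
qed

lemma quad_add_scale:
  "quad t (\<lambda>a. x a + s * y a) = quad t x + s * (\<Sum>a\<in>UNIV. \<Sum>b\<in>UNIV. t $ a $ b * (x a * y b + y a * x b)) + s\<^sup>2 * quad t y"
  by (simp add: quad_def sum_distrib_left sum.distrib[symmetric] algebra_simps power2_eq_square)

text \<open>Off the diagonal equal terms come in pairs, so only twice the entry matters; adding one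
  position at a time exhibits the pairs.\<close>

lemma quad_Ints:
  assumes t: "half_integral t"
  shows "quad t (\<lambda>a. of_int (x a)) \<in> \<int>"
proof -
  have s: "t $ a $ b = t $ b $ a" for a b using t by (intro sym_nth) (simp add: half_integral_def)
  have "(\<Sum>a\<in>S. \<Sum>b\<in>S. t $ a $ b * (of_int (x a) * of_int (x b))) \<in> \<int>" if "finite S" for S
    using that
  proof (induction S)
    case (insert i S)
    define F where "F = (\<lambda>a b. t $ a $ b * (real_of_int (x a) * real_of_int (x b)))"
    have "(\<Sum>a\<in>S. F a i) = (\<Sum>a\<in>S. F i a)"
    proof (rule sum.cong[OF refl])
      fix a show "F a i = F i a" unfolding F_def by (subst s) simp
    qed
    then have "(\<Sum>a\<in>insert i S. \<Sum>b\<in>insert i S. F a b) = (\<Sum>a\<in>S. \<Sum>b\<in>S. F a b) + F i i + (\<Sum>b\<in>S. 2 * F i b)"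
      using insert.hyps by (simp add: sum.distrib sum_distrib_left[symmetric])
    then have "(\<Sum>a\<in>insert i S. \<Sum>b\<in>insert i S. t $ a $ b * (of_int (x a) * of_int (x b))) =
      (\<Sum>a\<in>S. \<Sum>b\<in>S. t $ a $ b * (of_int (x a) * of_int (x b))) + t $ i $ i * (of_int (x i) * of_int (x i)) +
      (\<Sum>b\<in>S. 2 * t $ i $ b * (of_int (x i) * of_int (x b)))"
      by (simp add: F_def mult.assoc)
    moreover have "t $ i $ i \<in> \<int>" using t by (simp add: half_integral_def)
    moreover have "2 * t $ i $ b * (of_int (x i) * of_int (x b)) \<in> \<int>" for b
      by (rule Ints_mult) (use t in \<open>auto simp: half_integral_def\<close>)
    ultimately show ?case using insert.IH by (auto intro!: Ints_add Ints_mult[of "t $ i $ i"] Ints_sum)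
  qed simp
  then show ?thesis by (simp add: quad_def)
qed

lemma unimod_act_diag: "unimod_act u t $ a $ a = quad t (\<lambda>c. of_int (u $ c $ a))"
  by (simp add: unimod_act_nth quad_def mult_ac)

lemma transpose_unimod_act: "transpose t = t \<Longrightarrow> transpose (unimod_act u t) = unimod_act u t"
proof -
  assume t: "transpose t = t"
  have tt: "transpose (transpose X) = X" for X :: "real^'a^'a" by (simp add: transpose_def vec_eq_iff)
  show ?thesis unfolding unimod_act_def matrix_transpose_mul t tt by (simp only: matrix_mul_assoc)
qed

lemma half_integral_unimod_act:
  assumes t: "half_integral t" shows "half_integral (unimod_act u t)"
  unfolding half_integral_def
proof (intro conjI allI)
  show "transpose (unimod_act u t) = unimod_act u t" using t by (intro transpose_unimod_act) (simp add: half_integral_def)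
  show "unimod_act u t $ i $ i \<in> \<int>" for i unfolding unimod_act_diag using quad_Ints[OF t] .
  show "2 * unimod_act u t $ i $ j \<in> \<int>" for i j
  proof -
    have "2 * unimod_act u t $ i $ j = (\<Sum>c\<in>UNIV. \<Sum>d\<in>UNIV. of_int (u $ c $ i) * (2 * t $ c $ d) * of_int (u $ d $ j))"
      unfolding unimod_act_nth by (simp add: sum_distrib_left mult_ac)
    also have "\<dots> \<in> \<int>"
      by (intro Ints_sum, rule Ints_mult[OF Ints_mult[OF Ints_of_int _] Ints_of_int])
        (use t in \<open>auto simp: half_integral_def\<close>)
    finally show ?thesis .
  qed
qed

lemma pos_semidef_iff: "pos_semidef t \<longleftrightarrow> transpose t = t \<and> (\<forall>x. quad t x \<ge> 0)"
proof -
  have "(\<forall>v::real^'a. v \<bullet> (t *v v) \<ge> 0) \<longleftrightarrow> (\<forall>x. quad t x \<ge> 0)"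
  proof
    assume R: "\<forall>v::real^'a. v \<bullet> (t *v v) \<ge> 0"
    show "\<forall>x. quad t x \<ge> 0"
    proof
      fix x :: "'a \<Rightarrow> real"
      have "(\<chi> a. x a) \<bullet> (t *v (\<chi> a. x a)) = quad t x" by (simp add: qform quad_def)
      then show "quad t x \<ge> 0" using R by metis
    qed
  qed (simp add: qform quad_def[symmetric])
  then show ?thesis by (simp add: pos_semidef_def)
qed

lemma pos_semidef_unimod_act: "pos_semidef t \<Longrightarrow> pos_semidef (unimod_act u t)"
  by (simp add: pos_semidef_iff transpose_unimod_act quad_unimod_act)

definition transvection :: "('g::finite \<Rightarrow> int) \<Rightarrow> 'g \<Rightarrow> int^'g^'g" where
  "transvection x j = (\<chi> a b. (if a = b then 1 else 0) + (if b = j then x a else 0))"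

lemma transvection_sum:
  fixes f :: "'g::finite \<Rightarrow> 'b::comm_ring_1"
  shows "(\<Sum>b\<in>UNIV. of_int (transvection x j $ a $ b) * f b) = f a + of_int (x a) * f j"
proof -
  have "of_int (transvection x j $ a $ b) * f b = (if b = a then f a else 0) + (if b = j then of_int (x a) * f j else 0)" for b
    by (simp add: transvection_def distrib_right)
  then show ?thesis by (simp add: sum.distrib)
qed

lemma transvection_inverse: assumes "x j = 0" shows "transvection x j ** transvection (\<lambda>a. - x a) j = mat 1"
proof -
  have "(transvection x j ** transvection (\<lambda>a. - x a) j) $ a $ b = (mat 1 :: int^'a^'a) $ a $ b" for a b
    using transvection_sum[of x j a "\<lambda>c. transvection (\<lambda>a. - x a) j $ c $ b"] assms
    by (auto simp: matrix_matrix_mult_def transvection_def mat_def)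
  then show ?thesis by (simp add: vec_eq_iff)
qed

lemma pairing_shear:
  assumes "\<tau> \<in> siegel"
  shows "pairing t (shear x j \<tau>) = pairing (unimod_act (transvection x j) t) \<tau>"
proof -
  have sh: "shear x j \<tau> $ c $ d = (\<Sum>a\<in>UNIV. \<Sum>b\<in>UNIV. of_int (transvection x j $ c $ a) * (of_int (transvection x j $ d $ b) * \<tau> $ a $ b))" for c d
    unfolding sum_distrib_left[symmetric] transvection_sum by (simp add: shear_def algebra_simps)
  have "pairing t (shear x j \<tau>) = (\<Sum>c\<in>UNIV. \<Sum>d\<in>UNIV. \<Sum>a\<in>UNIV. \<Sum>b\<in>UNIV.
      of_int (transvection x j $ c $ a) * of_real (t $ c $ d) * of_int (transvection x j $ d $ b) * \<tau> $ a $ b)"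
    unfolding pairing_def sh by (simp add: sum_distrib_left mult_ac)
  also have "\<dots> = (\<Sum>a\<in>UNIV. \<Sum>b\<in>UNIV. \<Sum>c\<in>UNIV. \<Sum>d\<in>UNIV.
      of_int (transvection x j $ c $ a) * of_real (t $ c $ d) * of_int (transvection x j $ d $ b) * \<tau> $ a $ b)"
    by (rule sum_swap4)
  also have "\<dots> = pairing (unimod_act (transvection x j) t) \<tau>"
    unfolding pairing_def unimod_act_nth by (simp add: sum_distrib_right)
  finally show ?thesis .
qed

text \<open>Shearing the point amounts to a substitution in the index, so reindexing yields a second
  expansion of the same function, and expansions are unique.\<close>

lemma fourier_exp_unimod_act:
  assumes c: "fourier_exp \<Phi> c" and inv: "\<And>\<tau>. \<tau> \<in> siegel \<Longrightarrow> \<Phi> (shear x j \<tau>) = \<Phi> \<tau>" and x: "x j = 0"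
    and t: "half_integral t"
  shows "c (unimod_act (transvection x j) t) = c t"
proof -
  define A where "A = unimod_act (transvection x j)"
  define A' where "A' = unimod_act (transvection (\<lambda>a. - x a) j)"
  have AA': "A (A' t) = t" "A' (A t) = t" for t
    using transvection_inverse[of x j] transvection_inverse[of "\<lambda>a. - x a" j] x by (simp_all add: A_def A'_def unimod_act_unimod_act unimod_act_one)
  have hi: "half_integral t \<Longrightarrow> half_integral (A t)" "half_integral t \<Longrightarrow> half_integral (A' t)" for t
    by (simp_all add: A_def A'_def half_integral_unimod_act)
  have "fourier_exp \<Phi> (\<lambda>t. c (A' t))"
    unfolding fourier_exp_def
  proof
    fix \<tau> :: "complex^'a^'a" assume \<tau>: "\<tau> \<in> siegel"
    have "((\<lambda>t. c t * ee (pairing (A t) \<tau>)) has_sum \<Phi> \<tau>) (Collect half_integral)"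
      using c shear_facts(1)[OF \<tau>, of x j] x inv[OF \<tau>] unfolding fourier_exp_def A_def
      by (metis (no_types, lifting) pairing_shear[OF \<tau>] has_sum_cong)
    also have "?this \<longleftrightarrow> ((\<lambda>t. c (A' t) * ee (pairing t \<tau>)) has_sum \<Phi> \<tau>) (Collect half_integral)"
      by (rule has_sum_reindex_bij_witness[where i = A' and j = A]) (auto simp: AA' hi)
    finally show "((\<lambda>t. c (A' t) * ee (pairing t \<tau>)) has_sum \<Phi> \<tau>) (Collect half_integral)" .
  qed
  from fourier_exp_unique[OF this c, of "A t"] show ?thesis using hi(1)[OF t] AA' by (simp add: A_def)
qed

section \<open>The Koecher principle\<close>

lemma summable_superlevel_finite:
  fixes f :: "'a \<Rightarrow> real"
  assumes "f summable_on A" "e > 0" "\<And>x. x \<in> A \<Longrightarrow> f x \<ge> 0"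
  shows "finite {x \<in> A. f x \<ge> e}"
proof (rule ccontr)
  assume inf: "infinite {x \<in> A. f x \<ge> e}"
  obtain N :: nat where N: "infsum f A < real N * e" using reals_Archimedean3[OF assms(2)] by blast
  obtain B where B: "B \<subseteq> {x \<in> A. f x \<ge> e}" "finite B" "card B = N"
    using infinite_arbitrarily_large[OF inf] by blast
  have "real N * e \<le> sum f B"
    using B sum_mono[of B "\<lambda>_. e" f] by (auto simp: subset_iff)
  also have "\<dots> \<le> infsum f A"
    by (rule finite_sum_le_infsum[OF assms(1) B(2)]) (use B assms(3) in auto)
  finally show False using N by simp
qed

text \<open>Adding \<open>s\<close> times \<open>w\<close> to the j-th basis vector produces indices
  with the same coefficient whose j-th diagonal entry tends to minus infinity, quadratically in
  \<open>s\<close>, while the other diagonal entries stay. At \<open>\<i>\<close> times the identity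
  their terms are bounded away from 0, against summability.\<close>

lemma indefinite_contradiction:
  fixes c :: "real^'g::finite^'g \<Rightarrow> complex" and w :: "'g \<Rightarrow> int"
  assumes c: "fsummable c" and inv: "\<And>x. x j = 0 \<Longrightarrow> c (unimod_act (transvection x j) t) = c t"
    and t: "half_integral t" and nz: "c t \<noteq> 0" and w: "w j = 0" and neg: "quad t (\<lambda>a. of_int (w a)) < 0"
  shows False
proof -
  define q where "q = - quad t (\<lambda>a. of_int (w a))"
  define \<delta> where "\<delta> = (\<lambda>b (a::'g). if a = b then 1 else 0 :: real)"
  define B where "B = (\<Sum>a\<in>UNIV. \<Sum>b\<in>UNIV. t $ a $ b * (\<delta> j a * of_int (w b) + of_int (w a) * \<delta> j b))"
  have q: "q > 0" using neg by (simp add: q_def)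
  define ts where "ts = (\<lambda>s::nat. unimod_act (transvection (\<lambda>a. int s * w a) j) t)"
  have col: "(\<lambda>c. real_of_int (transvection (\<lambda>a. int s * w a) j $ c $ b)) = (if b = j then (\<lambda>a. \<delta> j a + real s * of_int (w a)) else \<delta> b)" for s b
    by (auto simp: transvection_def \<delta>_def fun_eq_iff)
  have d1: "ts s $ b $ b = t $ b $ b" if "b \<noteq> j" for s b
    using that quad_axis[of t b] unfolding ts_def unimod_act_diag col by (simp add: \<delta>_def)
  have d2: "ts s $ j $ j = t $ j $ j + real s * B - (real s)\<^sup>2 * q" for s
    using quad_axis[of t j] unfolding ts_def unimod_act_diag col by (simp add: quad_add_scale B_def q_def \<delta>_def)
  \<comment> \<open>From here on the quadratic term outweighs the linear one by at least
    \<open>s\<close>, so the entry drops at least linearly.\<close>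
  define s0 where "s0 = nat \<lceil>(\<bar>B\<bar> + 1) / q\<rceil>"
  have dec: "ts s $ j $ j \<le> t $ j $ j - real s" if "s \<ge> s0" for s
  proof -
    have "real s \<ge> (\<bar>B\<bar> + 1) / q" using that unfolding s0_def by linarith
    then have "q * real s \<ge> \<bar>B\<bar> + 1" using q by (simp add: field_simps)
    then have "B - q * real s \<le> - 1" by linarith
    then have "real s * (B - q * real s) \<le> real s * (- 1)" by (intro mult_left_mono) auto
    then show ?thesis unfolding d2 by (simp add: algebra_simps power2_eq_square)
  qed
  define \<tau> :: "complex^'g^'g" where "\<tau> = cscale (\<i> * of_real 1) (mat 1)"
  have \<tau>: "\<tau> \<in> siegel" unfolding \<tau>_def by (rule siegel_scalar) simp
  have ntau: "norm (c s * ee (pairing s \<tau>)) = norm (c s) * exp (- (2 * pi * (\<Sum>a\<in>UNIV. s $ a $ a)))" for s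
  proof -
    have "Im (\<tau> $ a $ b) = (if b = a then 1 else 0)" for a b by (auto simp: \<tau>_def cscale_def mat_def)
    then have "Im (pairing s \<tau>) = (\<Sum>a\<in>UNIV. s $ a $ a)"
      unfolding Im_pairing by (simp add: if_distrib[of "\<lambda>x. _ * x"] cong: if_cong)
    then show ?thesis by (simp add: norm_mult norm_ee)
  qed
  define e where "e = norm (c t) * exp (- (2 * pi * (\<Sum>a\<in>UNIV. t $ a $ a)))"
  have e: "e > 0" using nz by (simp add: e_def)
  define X where "X = {s \<in> Collect half_integral. norm (c s * ee (pairing s \<tau>)) \<ge> e}"
  have "finite X" unfolding X_def
    by (rule summable_superlevel_finite) (use c \<tau> e in \<open>auto simp: fsummable_def\<close>)
  have tsX: "ts s \<in> X" if "s \<ge> s0" for s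
  proof -
    have "c (ts s) = c t" unfolding ts_def by (rule inv) (simp add: w)
    moreover have "(\<Sum>a\<in>UNIV. ts s $ a $ a) \<le> (\<Sum>a\<in>UNIV. t $ a $ a)"
    proof (rule sum_mono)
      fix a show "ts s $ a $ a \<le> t $ a $ a"
        using d1[of a s] dec[OF that] by (cases "a = j") auto
    qed
    ultimately have "norm (c (ts s) * ee (pairing (ts s) \<tau>)) \<ge> e"
      unfolding ntau e_def by (simp add: mult_left_mono)
    then show ?thesis using half_integral_unimod_act[OF t] by (simp add: X_def ts_def)
  qed
  define M where "M = Min ((\<lambda>s. s $ j $ j) ` X)"
  define s1 where "s1 = max s0 (nat \<lceil>t $ j $ j - M\<rceil> + 1)"
  have "M \<le> ts s1 $ j $ j" unfolding M_def using \<open>finite X\<close> tsX[of s1] by (intro Min_le) (auto simp: s1_def)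
  moreover have "ts s1 $ j $ j \<le> t $ j $ j - real s1" by (rule dec) (simp add: s1_def)
  moreover have "real s1 > t $ j $ j - M" unfolding s1_def by linarith
  ultimately show False by linarith
qed

text \<open>A negative value persists near \<open>v\<close>, hence at a rational vector with common
  denominator, and clearing the denominator does not change the sign.\<close>

lemma negative_integer_vector:
  assumes "quad t v < 0"
  obtains w :: "'g::finite \<Rightarrow> int" where "quad t (\<lambda>a. of_int (w a)) < 0"
proof -
  define w where "w = (\<lambda>N a. \<lfloor>real (Suc N) * v a\<rfloor>)"
  have "(\<lambda>N. real_of_int (w N a) / real (Suc N)) \<longlonglongrightarrow> v a" for a
  proof -
    have "\<bar>real_of_int (w N a) / real (Suc N) - v a\<bar> \<le> 1 / real (Suc N)" for N
    proof -
      have "\<bar>real_of_int (w N a) - real (Suc N) * v a\<bar> \<le> 1" unfolding w_def by linarith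
      moreover have "real_of_int (w N a) / real (Suc N) - v a = (real_of_int (w N a) - real (Suc N) * v a) / real (Suc N)"
        by (simp add: field_simps)
      ultimately show ?thesis by (simp add: divide_right_mono)
    qed
    then have "(\<lambda>N. real_of_int (w N a) / real (Suc N) - v a) \<longlonglongrightarrow> 0"
      by (intro Lim_null_comparison[OF _ lim_inverse_n'[THEN LIMSEQ_Suc]]) auto
    then show ?thesis by (rule LIM_zero_cancel)
  qed
  then have "(\<lambda>N. quad t (\<lambda>a. real_of_int (w N a) / real (Suc N))) \<longlonglongrightarrow> quad t v"
    unfolding quad_def by (intro tendsto_intros)
  from eventually_happens'[OF sequentially_bot order_tendstoD(2)[OF this assms]]
  obtain N where "quad t (\<lambda>a. real_of_int (w N a) / real (Suc N)) < 0" by blast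
  moreover have "quad t (\<lambda>a. real_of_int (w N a) / real (Suc N)) = quad t (\<lambda>a. of_int (w N a)) / (real (Suc N))\<^sup>2"
    unfolding quad_def sum_divide_distrib by (simp add: power2_eq_square)
  ultimately have "quad t (\<lambda>a. of_int (w N a)) < 0" by (simp add: divide_less_0_iff)
  then show ?thesis by (rule that)
qed

text \<open>\<open>indefinite_contradiction\<close> asks for an integral vector that vanishes at one
  of the positions where transvections are available. The Euclidean algorithm on the components at
  \<open>i\<close> and \<open>l\<close>, carried out by those transvections on the index, produces
  one; this is why two positions are required.\<close>

lemma koecher:
  fixes c :: "real^'g::finite^'g \<Rightarrow> complex"
  assumes c: "fsummable c" and il: "i \<noteq> l"
    and inv: "\<And>x t j. j \<in> {i, l} \<Longrightarrow> x j = 0 \<Longrightarrow> half_integral t \<Longrightarrow> c (unimod_act (transvection x j) t) = c t"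
    and t: "half_integral t" and nz: "c t \<noteq> 0"
  shows "pos_semidef t"
proof -
  have main: "False" if "half_integral t" "c t \<noteq> 0" "quad t (\<lambda>a. of_int (w a)) < 0" for t and w :: "'g \<Rightarrow> int"
    using that
  proof (induction "nat (\<bar>w i\<bar> + \<bar>w l\<bar>)" arbitrary: t w rule: less_induct)
    case less
    have red: False if ab: "{a, b} = {i, l}" "a \<noteq> b" and nz: "w b \<noteq> 0" and le: "\<bar>w b\<bar> \<le> \<bar>w a\<bar>" for a b
    proof -
      \<comment> \<open>With this sign, subtraction lowers the absolute value of the larger
        component by that of the smaller.\<close>
      define \<sigma> where "\<sigma> = sgn (w a) * sgn (w b)"
      define x where "x = (\<lambda>e. if e = a then \<sigma> else 0)"
      define w' where "w' = (\<lambda>e. if e = a then w a - \<sigma> * w b else w e)"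
      have bil: "b \<in> {i, l}" using ab by auto
      have "w a \<noteq> 0" using nz le by auto
      have "\<bar>w a - \<sigma> * w b\<bar> = \<bar>w a\<bar> - \<bar>w b\<bar>"
        using le \<open>w a \<noteq> 0\<close> nz by (auto simp: \<sigma>_def sgn_if)
      then have dec: "nat (\<bar>w' i\<bar> + \<bar>w' l\<bar>) < nat (\<bar>w i\<bar> + \<bar>w l\<bar>)"
        using ab nz by (auto simp: w'_def doubleton_eq_iff)
      have "(\<lambda>e. \<Sum>d\<in>UNIV. of_int (transvection x b $ e $ d) * real_of_int (w' d)) = (\<lambda>e. of_int (w e))"
        unfolding transvection_sum using ab(2) by (auto simp: x_def w'_def)
      then have "quad (unimod_act (transvection x b) t) (\<lambda>e. of_int (w' e)) = quad t (\<lambda>e. of_int (w e))"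
        unfolding quad_unimod_act by simp
      moreover have "c (unimod_act (transvection x b) t) = c t" by (rule inv[OF bil]) (use ab less.prems in \<open>auto simp: x_def\<close>)
      ultimately show False
        using less.hyps[OF dec half_integral_unimod_act[OF less.prems(1)], of "transvection x b"] less.prems by simp
    qed
    have col: False if "j \<in> {i, l}" "w j = 0" for j
      by (rule indefinite_contradiction[OF c _ less.prems(1,2) that(2) less.prems(3)]) (use inv that less.prems in auto)
    show ?case
      using red[of i l] red[of l i] col il by (cases "w i = 0 \<or> w l = 0"; cases "\<bar>w l\<bar> \<le> \<bar>w i\<bar>") auto
  qed
  have "quad t x \<ge> 0" for x
    using negative_integer_vector[of t x] main[OF t nz] by (metis not_le)
  then show ?thesis using t by (simp add: pos_semidef_iff half_integral_def)
qed

text \<open>With a single position in the first block there is no second transvection, and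
  semidefiniteness is the imposed condition at the cusp; otherwise two positions of the first block
  feed \<open>koecher\<close>.\<close>

lemma lift_coeff_pos_semidef:
  fixes \<phi> :: "('n::finite) jacobi_fun"
  assumes \<phi>: "\<phi> \<in> jacobi_forms k m" and t: "half_integral t" and nz: "lift_coeff m (fourier_coeff \<phi>) t \<noteq> 0"
  shows "pos_semidef t"
proof (cases "CARD('n) = 1")
  case True
  have m: "t $ Inr 1 $ Inr 1 = real m" using nz by (auto simp: lift_coeff_def split: if_splits)
  have "pos_semidef (index_matrix (upper_left t) (2 *\<^sub>R upper_right t) m)"
    using \<phi> True parts_fourier_indices[OF t] nz m unfolding jacobi_forms_def lift_coeff_def by auto
  then show ?thesis using index_matrix_inverse[OF _ m] t by (simp add: half_integral_def)
next
  case False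
  obtain i l :: 'n where "i \<noteq> l"
  proof -
    have "CARD('n) \<noteq> 0" by simp
    then have "\<not> CARD('n) \<le> Suc 0" using False by linarith
    then show ?thesis using that by (metis card_le_Suc0_iff_eq finite UNIV_I)
  qed
  then have il: "(Inl i :: 'n + 1) \<noteq> Inl l" by simp
  show ?thesis
  proof (rule koecher[OF fourier_exp_summable[OF jacobi_fourier_exp[OF \<phi>]] il _ t nz])
    fix x :: "'n + 1 \<Rightarrow> int" and t :: "real^('n + 1)^('n + 1)" and j :: "'n + 1"
    assume "j \<in> {Inl i, Inl l}" "x j = 0" "half_integral t"
    then show "lift_coeff m (fourier_coeff \<phi>) (unimod_act (transvection x j) t) = lift_coeff m (fourier_coeff \<phi>) t"
      by (intro fourier_exp_unimod_act[OF jacobi_fourier_exp[OF \<phi>]]) (auto intro!: jacobi_shear[OF \<phi>])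
  qed
qed

section \<open>The support of a symmetric formal series\<close>

definition fj_support :: "('n::finite) formal_series \<Rightarrow> (real^('n + 1)^('n + 1)) set" where
  "fj_support f = {t. half_integral t \<and> pos_semidef t \<and> fj_coeff f t \<noteq> 0}"

lemma fj_coeff_lift_coeff:
  fixes f :: "('n::finite) formal_series"
  assumes "t $ Inr 1 $ Inr 1 = real m"
  shows "fj_coeff f t = lift_coeff m (fourier_coeff (f m)) t"
  using assms by (simp add: fj_coeff_def lift_coeff_def lower_right_def)

lemma pos_semidef_diag: "pos_semidef t \<Longrightarrow> t $ a $ a \<ge> 0"
  using quad_axis[of t a] unfolding pos_semidef_iff by metis

lemma half_integral_diag_nat:
  assumes "half_integral t" "pos_semidef t"
  obtains m where "t $ a $ a = real m"
proof -
  have "t $ a $ a \<in> \<int>" using assms by (simp add: half_integral_def)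
  then obtain z where z: "t $ a $ a = of_int z" by (rule Ints_cases)
  then have "z \<ge> 0" using pos_semidef_diag[OF assms(2), of a] by simp
  then have "t $ a $ a = real (nat z)" using z by simp
  then show ?thesis by (rule that)
qed

lemma fj_support_unimod_act:
  fixes f :: "('n::finite) formal_series" and u :: "int^('n + 1)^('n + 1)"
  assumes "f \<in> FM k" "t \<in> fj_support f" "invertible u"
  shows "unimod_act u t \<in> fj_support f"
proof -
  have "fj_coeff f t = of_int (det u) ^ k * fj_coeff f (unimod_act u t)"
    using assms unfolding FM_def fj_symmetric_def fj_support_def unimod_act_def by blast
  then have "fj_coeff f (unimod_act u t) \<noteq> 0" using assms by (auto simp: fj_support_def)
  then show ?thesis using assms half_integral_unimod_act pos_semidef_unimod_act by (auto simp: fj_support_def)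
qed

text \<open>Since \<open>Inl j\<close> lies in the first block, all indices of the block share the
  last diagonal entry \<open>m\<close> and belong to the one Jacobi form \<open>f m\<close>; no
  convergence in \<open>m\<close> is involved. Without a short value, \<open>block_bound\<close>
  would make the coefficient at \<open>t0\<close> zero.\<close>

lemma fj_support_block_bound:
  fixes f :: "('n::finite) formal_series"
  assumes f: "f \<in> FM k" and k: "k > 0" and ts0: "t0 \<in> fj_support f"
  shows "\<exists>t\<in>fj_support f. t \<in> same_block t0 (Inl j) \<and> (\<exists>x. x (Inl j) = 1 \<and> quad t x < real k)"
proof (rule ccontr)
  assume neg: "\<not> ?thesis"
  have hi: "half_integral t0" and ps: "pos_semidef t0" using ts0 by (auto simp: fj_support_def)
  obtain m where m: "t0 $ Inr 1 $ Inr 1 = real m" by (rule half_integral_diag_nat[OF hi ps])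
  have \<phi>: "f m \<in> jacobi_forms k m" using f by (simp add: FM_def)
  let ?c = "lift_coeff m (fourier_coeff (f m))"
  have S: "t \<in> fj_support f" if "t \<in> same_block t0 (Inl j)" "?c t \<noteq> 0" for t
  proof -
    have "t $ Inr 1 $ Inr 1 = real m" using that(1) m by (simp add: same_block_def)
    then show ?thesis
      using that lift_coeff_pos_semidef[OF \<phi> _ that(2)] fj_coeff_lift_coeff[of t m f] by (simp add: fj_support_def same_block_def)
  qed
  interpret block_bound ?c "Inl j" k t0
  proof
    show "fsummable ?c" by (rule fourier_exp_summable[OF jacobi_fourier_exp[OF \<phi>]])
    show "law (shear x (Inl j)) (\<lambda>_. 1) ?c (Collect half_integral)" if "x (Inl j) = 0" for x
      by (rule jacobi_law_shear[of "f m" k m x j, OF \<phi> that])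
    show "law (siegel_inv (Inl j)) (\<lambda>\<tau>. (\<tau> $ Inl j $ Inl j) ^ k) ?c (Collect half_integral)"
      by (rule jacobi_law_siegel_inv[OF \<phi>])
    show "quad t x \<ge> real k" if "t \<in> same_block t0 (Inl j)" "?c t \<noteq> 0" "x (Inl j) = 1" for t x
      using neg S[OF that(1,2)] that by (meson not_le)
    show "quad t x \<ge> 0" if "t \<in> same_block t0 (Inl j)" "?c t \<noteq> 0" for t x
      using S[OF that] by (simp add: fj_support_def pos_semidef_iff)
  qed (use k hi in auto)
  have "?c t0 = 0" by (rule block_bound_coeff_zero)
  then show False using ts0 fj_coeff_lift_coeff[OF m, of f] by (simp add: fj_support_def)
qed

lemma fj_support_empty:
  fixes f :: "('n::finite) formal_series"
  assumes f: "f \<in> FM k" and e: "fj_support f = {}"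
  shows "f = (\<lambda>_ _. 0)"
proof -
  have "f m x = 0" for m x
  proof (cases "x \<in> jacobi_domain")
    case True
    have \<phi>: "f m \<in> jacobi_forms k m" using f by (simp add: FM_def)
    have "fourier_coeff (f m) (n, r) = 0" if nr: "(n, r) \<in> fourier_indices" for n r
    proof (rule ccontr)
      assume nz: "fourier_coeff (f m) (n, r) \<noteq> 0"
      let ?t = "index_matrix n r m"
      have j: "lift_coeff m (fourier_coeff (f m)) ?t \<noteq> 0" using nz by (simp add: lift_coeff_def index_matrix_parts)
      then have "?t \<in> fj_support f"
        using index_matrix_half_integral[OF nr] lift_coeff_pos_semidef[OF \<phi> _ j] fj_coeff_lift_coeff[OF index_matrix_parts(3), of f n r m]
        by (simp add: fj_support_def)
      then show False using e by simp
    qed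
    then have z: "fourier_coeff (f m) p = 0" if "p \<in> fourier_indices" for p using that by (cases p) auto
    obtain \<tau> zz where x: "x = (\<tau>, zz)" by (cases x)
    have "((\<lambda>(n, r). fourier_coeff (f m) (n, r) * e_tr (map_matrix of_real n ** \<tau> + map_matrix of_real r ** transpose zz))
       has_sum f m x) fourier_indices"
      using jacobi_fourier_expansion[OF \<phi>] True unfolding has_fourier_expansion_def x by blast
    moreover have "((\<lambda>(n, r). fourier_coeff (f m) (n, r) * e_tr (map_matrix of_real n ** \<tau> + map_matrix of_real r ** transpose zz))
       has_sum 0) fourier_indices"
      by (rule has_sum_0) (use z in auto)
    ultimately show ?thesis by (rule has_sum_unique)
  next
    case False
    then show ?thesis using f unfolding FM_def jacobi_forms_def by blast
  qed
  then show ?thesis by (simp add: fun_eq_iff)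
qed

section \<open>Reduction of the quadratic forms in the support\<close>

text \<open>Unit columns outside \<open>K\<close> guarantee that substitution by \<open>u\<close>
  preserves the diagonal entries there, while the j-th diagonal entry becomes the value of the form
  at \<open>z\<close>.\<close>

definition completes :: "'g::finite set \<Rightarrow> 'g \<Rightarrow> ('g \<Rightarrow> int) \<Rightarrow> int^'g^'g \<Rightarrow> bool" where
  "completes K j z u \<longleftrightarrow> invertible u \<and> (\<forall>i a. i \<notin> K \<longrightarrow> u $ a $ i = (if a = i then 1 else 0)) \<and> (\<forall>a. u $ a $ j = z a)"

lemma completes_unit:
  assumes "j \<in> K" "z j * z j = 1"
  shows "\<exists>u. completes K j z u"
proof -
  define cm where "cm = (\<lambda>z :: 'a \<Rightarrow> int. \<chi> a b. if b = j then z a else if a = b then 1 else (0 :: int))"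
  define y where "y = (\<lambda>a. if a = j then z j else - z a * z j)"
  have mult: "(cm z ** X) $ a $ b = z a * X $ j $ b + (if a = j then 0 else X $ a $ b)" for z X a b
  proof -
    have "(cm z ** X) $ a $ b = (\<Sum>k\<in>UNIV. (if k = j then z a * X $ j $ b else 0) + (if k = a then (if a = j then 0 else X $ a $ b) else 0))"
      unfolding matrix_matrix_mult_def cm_def vec_lambda_beta by (rule sum.cong) auto
    then show ?thesis by (simp add: sum.distrib)
  qed
  have zz: "w * z j * z j = w" for w using assms(2) by (simp add: mult.assoc)
  have "(cm z ** cm y) $ a $ b = (mat 1 :: int^'a^'a) $ a $ b" for a b
    unfolding mult using assms(2) by (cases "a = j"; cases "b = j") (simp_all add: cm_def y_def mat_def)
  moreover have "(cm y ** cm z) $ a $ b = (mat 1 :: int^'a^'a) $ a $ b" for a b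
    unfolding mult using assms(2) by (cases "a = j"; cases "b = j") (simp_all add: cm_def y_def mat_def zz)
  ultimately have "cm z ** cm y = mat 1" "cm y ** cm z = mat 1" by (simp_all add: vec_eq_iff)
  then have "invertible (cm z)" unfolding invertible_def by blast
  then have "completes K j z (cm z)" using assms(1) by (auto simp: completes_def cm_def)
  then show ?thesis by blast
qed

lemma completes_transvection:
  assumes u: "completes K j (\<lambda>a. z a - x a * z l) u" and l: "l \<in> K" and x: "x l = 0"
  shows "completes K j z (transvection x l ** u)"
proof -
  have m: "(transvection x l ** u) $ a $ b = u $ a $ b + x a * u $ l $ b" for a b
    using transvection_sum[of x l a "\<lambda>c. u $ c $ b"] by (simp add: matrix_matrix_mult_def)
  have "invertible (transvection x l)"
    unfolding invertible_def using transvection_inverse[of x l] transvection_inverse[of "\<lambda>a. - x a" l] x by auto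
  then have "invertible (transvection x l ** u)" using u by (auto simp: completes_def intro: invertible_mult)
  moreover have "(transvection x l ** u) $ a $ i = (if a = i then 1 else 0)" if "i \<notin> K" for i a
    using u that l unfolding m completes_def by auto
  moreover have "(transvection x l ** u) $ a $ j = z a" for a
    using u x unfolding m completes_def by simp
  ultimately show ?thesis by (simp add: completes_def)
qed

text \<open>Euclidean algorithm by transvections at positions of \<open>K\<close>: the sum of
  absolute values over \<open>K\<close> drops until one nonzero component is left there, which
  primitivity makes a unit; a further transvection moves a unit to \<open>j\<close> if
  necessary.\<close>

lemma complete_primitive:
  fixes K :: "'g::finite set"
  assumes "j \<in> K" "\<And>d. (\<And>k. k \<in> K \<Longrightarrow> d dvd z k) \<Longrightarrow> d dvd 1"
  shows "\<exists>u. completes K j z u"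
  using assms
proof (induction "nat (\<Sum>i\<in>K. \<bar>z i\<bar>)" arbitrary: z rule: less_induct)
  case less
  show ?case
  proof (cases "\<exists>i l. i \<in> K \<and> l \<in> K \<and> i \<noteq> l \<and> z i \<noteq> 0 \<and> z l \<noteq> 0 \<and> \<bar>z l\<bar> \<le> \<bar>z i\<bar>")
    case True
    then obtain i l where il: "i \<in> K" "l \<in> K" "i \<noteq> l" "z i \<noteq> 0" "z l \<noteq> 0" "\<bar>z l\<bar> \<le> \<bar>z i\<bar>" by blast
    define x where "x = (\<lambda>a. if a = i then sgn (z i) * sgn (z l) else 0)"
    define z' where "z' = (\<lambda>a. z a - x a * z l)"
    have xl: "x l = 0" using il by (simp add: x_def)
    have zi: "\<bar>z' i\<bar> = \<bar>z i\<bar> - \<bar>z l\<bar>" using il by (auto simp: z'_def x_def sgn_if)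
    have "(\<Sum>a\<in>K. \<bar>z' a\<bar>) = \<bar>z' i\<bar> + (\<Sum>a\<in>K - {i}. \<bar>z' a\<bar>)" by (rule sum.remove) (use il in auto)
    also have "(\<Sum>a\<in>K - {i}. \<bar>z' a\<bar>) = (\<Sum>a\<in>K - {i}. \<bar>z a\<bar>)" by (rule sum.cong) (auto simp: z'_def x_def)
    also have "\<bar>z' i\<bar> + \<dots> = (\<Sum>a\<in>K. \<bar>z a\<bar>) - \<bar>z l\<bar>"
      using sum.remove[of K i "\<lambda>a. \<bar>z a\<bar>"] il zi by simp
    finally have "(\<Sum>a\<in>K. \<bar>z' a\<bar>) < (\<Sum>a\<in>K. \<bar>z a\<bar>)" using il by simp
    moreover have "(\<Sum>a\<in>K. \<bar>z' a\<bar>) \<ge> 0" by (intro sum_nonneg) auto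
    ultimately have dec: "nat (\<Sum>a\<in>K. \<bar>z' a\<bar>) < nat (\<Sum>a\<in>K. \<bar>z a\<bar>)" by linarith
    have "d dvd 1" if d: "\<And>k. k \<in> K \<Longrightarrow> d dvd z' k" for d
    proof (rule less.prems(2))
      fix k assume k: "k \<in> K"
      have "d dvd z l" using d[OF il(2)] xl by (simp add: z'_def)
      then have "d dvd z' k + x k * z l" using d[OF k] by simp
      then show "d dvd z k" by (simp add: z'_def)
    qed
    then obtain u where "completes K j z' u" using less.hyps[OF dec less.prems(1)] by blast
    then show ?thesis using completes_transvection[of K j z x l u] il(2) xl by (auto simp: z'_def)
  next
    case False
    have "\<exists>i\<in>K. z i \<noteq> 0"
    proof (rule ccontr)
      assume "\<not> ?thesis"
      \<comment> \<open>The divisor 0 divides all components over \<open>K\<close> if they vanish,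
        so primitivity excludes this case.\<close>
      then have "0 dvd (1::int)" by (intro less.prems(2)) simp
      then show False by simp
    qed
    then obtain i where i: "i \<in> K" "z i \<noteq> 0" by blast
    have zero: "z l = 0" if "l \<in> K" "l \<noteq> i" for l
    proof (rule ccontr)
      assume "z l \<noteq> 0"
      then show False using False i that by (cases "\<bar>z l\<bar> \<le> \<bar>z i\<bar>") force+
    qed
    have "z i dvd 1"
    proof (rule less.prems(2))
      show "z i dvd z k" if "k \<in> K" for k using zero[OF that] by (cases "k = i") auto
    qed
    then have zz: "z i * z i = 1" by (auto simp: zdvd1_eq abs_if split: if_splits)
    show ?thesis
    proof (cases "i = j")
      case True
      then show ?thesis using completes_unit[of j K z] zz less.prems(1) by simp
    next
      case False
      \<comment> \<open>The new component at \<open>j\<close> is \<open>z i * z i\<close>, which is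
        1.\<close>
      define x where "x = (\<lambda>a. if a = j then - z i else 0)"
      have zj: "z j = 0" using zero[OF less.prems(1)] False by simp
      have "\<exists>u. completes K j (\<lambda>a. z a - x a * z i) u"
        by (rule completes_unit[OF less.prems(1)]) (simp add: x_def zj zz)
      then show ?thesis using completes_transvection[of K j z x i] i(1) False by (auto simp: x_def)
    qed
  qed
qed

section \<open>Lexicographic minima and their diagonal entries\<close>

lemma lexmin:
  fixes d :: "'x \<Rightarrow> nat \<Rightarrow> nat"
  assumes "T \<noteq> {}"
  shows "\<exists>t\<in>T. \<forall>i<n. \<forall>s\<in>T. (\<forall>i'<i. d s i' = d t i') \<longrightarrow> d t i \<le> d s i"
proof (induction n)
  case 0
  then show ?case using assms by auto
next
  case (Suc n)
  then obtain t where t: "t \<in> T" "\<And>i s. i < n \<Longrightarrow> s \<in> T \<Longrightarrow> (\<forall>i'<i. d s i' = d t i') \<Longrightarrow> d t i \<le> d s i" by blast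
  have "\<exists>s. (s \<in> T \<and> (\<forall>i<n. d s i = d t i)) \<and> (\<forall>r. r \<in> T \<and> (\<forall>i<n. d r i = d t i) \<longrightarrow> d s n \<le> d r n)"
    using ex_has_least_nat[of "\<lambda>s. s \<in> T \<and> (\<forall>i<n. d s i = d t i)" t "\<lambda>s. d s n"] t(1) by blast
  then obtain s where s: "s \<in> T" "\<And>i. i < n \<Longrightarrow> d s i = d t i"
    "\<And>r. r \<in> T \<Longrightarrow> (\<forall>i<n. d r i = d t i) \<Longrightarrow> d s n \<le> d r n" by blast
  have "d s i \<le> d r i" if "i < Suc n" "r \<in> T" "\<forall>i'<i. d r i' = d s i'" for i r
  proof (cases "i = n")
    case True
    then show ?thesis using s that by simp
  next
    case False
    then have i: "i < n" using that by simp
    then show ?thesis using t(2)[OF i that(2)] s(2) that(3) by simp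
  qed
  then show ?case using s(1) by blast
qed

text \<open>Nonnegativity at the difference of two scaled unit vectors bounds each mixed product by
  the two squares; summing over all pairs of positions yields the factor g.\<close>

lemma quad_diag_bound:
  fixes t :: "real^'g::finite^'g"
  assumes t: "pos_semidef t"
  shows "quad t \<beta> \<le> real CARD('g) * (\<Sum>b\<in>UNIV. (\<beta> b)\<^sup>2 * t $ b $ b)"
proof -
  have two: "2 * (t $ a $ b * (\<beta> a * \<beta> b)) \<le> (\<beta> a)\<^sup>2 * t $ a $ a + (\<beta> b)\<^sup>2 * t $ b $ b" for a b
  proof (cases "a = b")
    case False
    define v where "v = (\<lambda>c. (if c = a then \<beta> a else 0) + (- 1) * (if c = b then \<beta> b else 0))"
    have sq: "quad t (\<lambda>c. if c = a then s else 0) = s\<^sup>2 * t $ a $ a" for a s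
    proof -
      have "t $ c $ d * ((if c = a then s else 0) * (if d = a then s else 0)) = (if c = a then if d = a then s\<^sup>2 * t $ a $ a else 0 else 0)" for c d
        by (auto simp: power2_eq_square)
      then show ?thesis unfolding quad_def by (simp only: sum_delta2)
    qed
    have cr: "(\<Sum>c\<in>UNIV. \<Sum>d\<in>UNIV. t $ c $ d * ((if c = a then \<beta> a else 0) * (if d = b then \<beta> b else 0) + (if c = b then \<beta> b else 0) * (if d = a then \<beta> a else 0)))
       = 2 * (t $ a $ b * (\<beta> a * \<beta> b))"
    proof -
      have s: "t $ b $ a = t $ a $ b" using t by (intro sym_nth) (simp add: pos_semidef_iff)
      have "t $ c $ d * ((if c = a then \<beta> a else 0) * (if d = b then \<beta> b else 0) + (if c = b then \<beta> b else 0) * (if d = a then \<beta> a else 0))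
        = (if c = a then if d = b then t $ a $ b * (\<beta> a * \<beta> b) else 0 else 0) + (if c = b then if d = a then t $ a $ b * (\<beta> a * \<beta> b) else 0 else 0)" for c d
        using s False by auto
      then show ?thesis by (simp only: sum.distrib sum_delta2)
    qed
    have "quad t v = (\<beta> a)\<^sup>2 * t $ a $ a + (\<beta> b)\<^sup>2 * t $ b $ b - 2 * (t $ a $ b * (\<beta> a * \<beta> b))"
      unfolding v_def quad_add_scale sq cr by simp
    moreover have "quad t v \<ge> 0" using t by (simp add: pos_semidef_iff)
    ultimately show ?thesis by simp
  qed (simp add: power2_eq_square)
  have "2 * quad t \<beta> \<le> (\<Sum>a\<in>UNIV. \<Sum>b\<in>UNIV. (\<beta> a)\<^sup>2 * t $ a $ a + (\<beta> b)\<^sup>2 * t $ b $ b)"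
    unfolding quad_def sum_distrib_left by (intro sum_mono two)
  also have "\<dots> = 2 * (real CARD('g) * (\<Sum>b\<in>UNIV. (\<beta> b)\<^sup>2 * t $ b $ b))"
    by (simp add: sum.distrib sum_distrib_left)
  finally show ?thesis by simp
qed

lemma quad_scale: "quad t (\<lambda>a. c * x a) = c\<^sup>2 * quad t x"
  by (simp add: quad_def sum_distrib_left power2_eq_square mult_ac)

text \<open>A form that is minimal for the lexicographic order of its diagonal behaves like a Minkowski
  reduced one: after the last big gap in the diagonal, an integral approximation of a short real vector
  \<open>y\<close> with last pair_entry 1 can be made primitive on the later coordinates and rounded on the earlier ones.\<close>

lemma reduced_bound:
  fixes T :: "(real^'g::finite^'g) set" and e :: "nat \<Rightarrow> 'g"
  defines "g \<equiv> CARD('g)"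
  defines "K0 \<equiv> 8 * g\<^sup>2"
  defines "M \<equiv> 8 * g\<^sup>2 * K0 ^ g"
  assumes e: "bij_betw e {..<g} UNIV"
    and psd: "\<And>s. s \<in> T \<Longrightarrow> pos_semidef s"
    and act: "\<And>s u. s \<in> T \<Longrightarrow> invertible u \<Longrightarrow> unimod_act u s \<in> T"
    and min: "\<And>s i. s \<in> T \<Longrightarrow> i < g \<Longrightarrow> (\<And>i'. i' < i \<Longrightarrow> s $ e i' $ e i' = t $ e i' $ e i') \<Longrightarrow> t $ e i $ e i \<le> s $ e i $ e i"
    and t: "t \<in> T" and t1: "t1 \<in> T" "\<And>a b. a \<noteq> e (g - 1) \<Longrightarrow> b \<noteq> e (g - 1) \<Longrightarrow> t1 $ a $ b = t $ a $ b"
    and y: "y (e (g - 1)) = 1" "quad t1 y \<le> N"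
  shows "t $ b $ b \<le> real (11 * K0 ^ g * M ^ (2 * g)) * N"
proof -
  define a where "a = (\<lambda>i. t $ e i $ e i)"
  have g0: "g > 0" by (simp add: g_def)
  have K1: "K0 \<ge> 1" using g0 by (simp add: K0_def)
  have M1: "M \<ge> 1" using g0 K1 by (simp add: M_def)
  have einj: "e i = e i' \<longleftrightarrow> i = i'" if "i < g" "i' < g" for i i'
    using e that by (auto simp: bij_betw_def inj_on_def)
  have esurj: "\<exists>i<g. b = e i" for b using e unfolding bij_betw_def by (metis UNIV_I image_iff lessThan_iff)
  have a0: "a i \<ge> 0" for i unfolding a_def by (rule pos_semidef_diag[OF psd[OF t]])
  \<comment> \<open>Completion over the positions from \<open>i\<close> on leaves the earlier
    diagonal entries alone, so lexicographic minimality of \<open>t\<close> applies to the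
    substituted form. It is stated for any \<open>s\<close> with the same earlier entries because it
    will be applied to \<open>t1\<close>.\<close>
  have short: "a i \<le> quad s (\<lambda>b. of_int (z b))"
    if i: "i < g" and s: "s \<in> T" "\<And>i'. i' < i \<Longrightarrow> s $ e i' $ e i' = a i'"
      and prim: "\<And>d. (\<And>i'. i \<le> i' \<Longrightarrow> i' < g \<Longrightarrow> d dvd z (e i')) \<Longrightarrow> d dvd 1" for i s z
  proof -
    have "\<exists>u. completes (e ` {i..<g}) (e i) z u"
      by (rule complete_primitive) (use i prim in auto)
    then obtain u where u: "completes (e ` {i..<g}) (e i) z u" by blast
    have "unimod_act u s $ e i' $ e i' = a i'" if i': "i' < i" for i'
    proof -
      have "e i' \<notin> e ` {i..<g}" using einj i i' by force
      then have "(\<lambda>c. real_of_int (u $ c $ e i')) = (\<lambda>c. if c = e i' then 1 else 0)"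
        using u by (auto simp: completes_def fun_eq_iff)
      then show ?thesis unfolding unimod_act_diag using s(2)[OF i'] by (simp add: quad_axis)
    qed
    then have "a i \<le> unimod_act u s $ e i $ e i"
      unfolding a_def using u by (intro min act s(1) i) (auto simp: completes_def)
    also have "\<dots> = quad s (\<lambda>b. of_int (z b))"
      unfolding unimod_act_diag using u by (simp add: completes_def)
    finally show ?thesis .
  qed
  have mono: "a i \<le> a i'" if "i \<le> i'" "i' < g" for i i'
  proof -
    have "a i \<le> quad t (\<lambda>b. of_int (if b = e i' then 1 else 0))"
    proof (rule short[of i t])
      fix d :: int assume "\<And>k. i \<le> k \<Longrightarrow> k < g \<Longrightarrow> d dvd (if e k = e i' then 1 else 0)"
      from this[of i'] show "d dvd 1" using that by simp
    qed (use that t in \<open>auto simp: a_def\<close>)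
    also have "\<dots> = a i'" by (simp add: if_distrib[of real_of_int] quad_axis a_def cong: if_cong)
    finally show ?thesis .
  qed
  \<comment> \<open>Positions after a gap of factor \<open>K0\<close>; 0 is included so that a last
    one exists. Before \<open>i0\<close> the entries are smaller by \<open>K0\<close>, after it they
    grow by at most \<open>K0\<close> per step.\<close>
  define I where "I = {i. i < g \<and> (i = 0 \<or> real K0 * a (i - 1) < a i)}"
  define i0 where "i0 = Max I"
  have I: "finite I" "I \<noteq> {}" using g0 by (auto simp: I_def)
  have "i0 \<in> I" unfolding i0_def using I by (rule Max_in)
  then have i0: "i0 < g" "i0 = 0 \<or> real K0 * a (i0 - 1) < a i0" by (auto simp: I_def)
  have below: "real K0 * a i \<le> a i0" if "i < i0" for i
  proof -
    have "real K0 * a i \<le> real K0 * a (i0 - 1)" using mono[of i "i0 - 1"] that i0 by (intro mult_left_mono) auto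
    then show ?thesis using i0 that by linarith
  qed
  have above: "a (i0 + n) \<le> real K0 ^ n * a i0" if "i0 + n < g" for n
    using that
  proof (induction n)
    case (Suc n)
    have "i0 + Suc n \<notin> I" using Max_ge[OF I(1), of "i0 + Suc n"] by (auto simp: i0_def)
    then have "a (i0 + Suc n) \<le> real K0 * a (i0 + n)" using Suc.prems by (simp add: I_def)
    also have "\<dots> \<le> real K0 * (real K0 ^ n * a i0)" using Suc by (intro mult_left_mono) auto
    finally show ?case by (simp add: mult_ac)
  qed simp
  have above': "a i \<le> real K0 ^ g * a i0" if "i < g" for i
  proof (cases "i \<le> i0")
    case True
    have "a i \<le> 1 * a i0" using mono[OF True i0(1)] by simp
    also have "\<dots> \<le> real K0 ^ g * a i0" using K1 a0 by (intro mult_right_mono) auto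
    finally show ?thesis .
  next
    case False
    then have "a i \<le> real K0 ^ (i - i0) * a i0" using above[of "i - i0"] that by simp
    also have "\<dots> \<le> real K0 ^ g * a i0" using K1 a0 that by (intro mult_right_mono power_increasing) auto
    finally show ?thesis .
  qed
  have Mpos: "0 < M" using M1 by simp
  \<comment> \<open>Simultaneous approximation of all components with one denominator up to
    \<open>M ^ g\<close>; the size of \<open>M\<close> lets the square of the error beat the growth
    \<open>K0 ^ g\<close>.\<close>
  obtain q p where q: "0 < q" "q \<le> int (M ^ g)" and p: "\<And>i. i < g \<Longrightarrow> \<bar>of_int q * y (e i) - of_int (p i)\<bar> < 1 / real M"
    using Dirichlet_approx_simult[OF Mpos, of g "\<lambda>i. y (e i)"] by metis
  have M1': "1 / real M \<le> 1" using M1 by simp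
  \<comment> \<open>As \<open>y\<close> is 1 at the last position, an error below 1 between integers
    means equality.\<close>
  have pL: "p (g - 1) = q"
  proof -
    have "\<bar>real_of_int q - of_int (p (g - 1))\<bar> < 1" using p[of "g - 1"] y(1) g0 M1' by simp
    then have "\<bar>real_of_int (q - p (g - 1))\<bar> < 1" by simp
    then have "\<bar>q - p (g - 1)\<bar> < 1" by (metis of_int_abs of_int_less_1_iff)
    then show ?thesis by simp
  qed
  \<comment> \<open>Dividing by this gcd makes the vector primitive on the positions from
    \<open>i0\<close> on, as \<open>short\<close> demands. On the earlier positions the quotient
    need not be integral and is rounded, an error that is affordable because the entries there are
    smaller by \<open>K0\<close>.\<close>
  define q' where "q' = Gcd (p ` {i0..<g})"
  have q'd: "q' dvd p i" if "i0 \<le> i" "i < g" for i unfolding q'_def using that by (intro Gcd_dvd) auto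
  have "q' dvd q" using q'd[of "g - 1"] i0 pL by simp
  then have q'0: "q' > 0" using q(1) unfolding q'_def by (metis Gcd_int_greater_eq_0 dvd_0_left less_le less_irrefl)
  define \<iota> where "\<iota> = inv_into {..<g} e"
  have \<iota>: "\<iota> (e i) = i" if "i < g" for i
    unfolding \<iota>_def using e that by (simp add: bij_betw_def inv_into_f_f)
  define z where "z = (\<lambda>b. if \<iota> b \<ge> i0 then p (\<iota> b) div q' else round (of_int (p (\<iota> b)) / of_int q' :: real))"
  define \<alpha> where "\<alpha> = of_int q / (of_int q' :: real)"
  define \<beta> where "\<beta> = (\<lambda>b. of_int (z b) - \<alpha> * y b)"
  have q'1: "real_of_int q' \<ge> 1" using q'0 by simp
  have diff: "\<bar>of_int (p i) / of_int q' - \<alpha> * y (e i)\<bar> \<le> 1 / real M" if "i < g" for i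
  proof -
    have "of_int (p i) / of_int q' - \<alpha> * y (e i) = - (of_int q * y (e i) - of_int (p i)) / of_int q'"
      by (simp add: \<alpha>_def diff_divide_distrib)
    then have "\<bar>of_int (p i) / of_int q' - \<alpha> * y (e i)\<bar> = \<bar>of_int q * y (e i) - of_int (p i)\<bar> / of_int q'"
      using q'1 by (simp add: abs_divide)
    also have "\<dots> \<le> (1 / real M) / 1"
      by (rule frac_le) (use p[OF that] q'1 in auto)
    finally show ?thesis by simp
  qed
  have \<beta>1: "\<bar>\<beta> (e i)\<bar> \<le> 1 / real M" if "i0 \<le> i" "i < g" for i
  proof -
    have "of_int (z (e i)) = real_of_int (p i) / of_int q'"
      using that q'd[OF that] \<iota>[OF that(2)] by (simp add: z_def real_of_int_div)
    then show ?thesis using diff[OF that(2)] by (simp add: \<beta>_def)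
  qed
  have \<beta>2: "\<bar>\<beta> (e i)\<bar> \<le> 3 / 2" if "i < i0" "i < g" for i
  proof -
    have "\<bar>of_int (z (e i)) - of_int (p i) / (of_int q' :: real)\<bar> \<le> 1 / 2"
      using that \<iota>[OF that(2)] of_int_round_abs_le by (simp add: z_def)
    then show ?thesis using diff[OF that(2)] M1' unfolding \<beta>_def by linarith
  qed
  \<comment> \<open>The error vanishes exactly at the last position. This is essential: the last
    diagonal entry of \<open>t1\<close> is not controlled by \<open>t\<close>.\<close>
  have \<beta>L: "\<beta> (e (g - 1)) = 0"
  proof -
    have L: "i0 \<le> g - 1" "g - 1 < g" using i0 g0 by auto
    have "of_int (z (e (g - 1))) = real_of_int (p (g - 1)) / of_int q'"
      using L q'd[OF L] \<iota>[OF L(2)] by (simp add: z_def real_of_int_div)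
    then show ?thesis unfolding \<beta>_def \<alpha>_def pL y(1) by simp
  qed
  have "a i0 \<le> quad t1 (\<lambda>b. of_int (z b))"
  proof (rule short[OF i0(1) t1(1)])
    show "t1 $ e i' $ e i' = a i'" if "i' < i0" for i'
      unfolding a_def by (intro t1(2)) (use that i0 einj in auto)
    fix d assume d: "\<And>i'. i0 \<le> i' \<Longrightarrow> i' < g \<Longrightarrow> d dvd z (e i')"
    have "d * q' dvd q'"
      unfolding q'_def
    proof (rule Gcd_greatest, fold q'_def)
      fix w assume "w \<in> p ` {i0..<g}"
      then obtain i where i: "w = p i" "i0 \<le> i" "i < g" by auto
      have "d dvd p i div q'" using d[OF i(2,3)] \<iota>[OF i(3)] i(2) by (simp add: z_def)
      then have "d * q' dvd (p i div q') * q'" by (rule mult_dvd_mono) simp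
      then show "d * q' dvd w" using q'd[OF i(2,3)] i(1) by simp
    qed
    then have "d * q' dvd 1 * q'" by simp
    then show "d dvd 1" using q'0 by (metis dvd_mult_cancel_right less_irrefl)
  qed
  also have "\<dots> = quad t1 (\<lambda>b. \<alpha> * y b + \<beta> b)" by (simp add: \<beta>_def)
  \<comment> \<open>Parallelogram inequality: the main part costs at most
    \<open>\<alpha>\<^sup>2\<close> times the short value, and the error part will be absorbed into
    the left-hand side.\<close>
  also have "\<dots> \<le> 2 * quad t1 (\<lambda>b. \<alpha> * y b) + 2 * quad t1 \<beta>"
    using quad_double[of t1 "\<lambda>b. \<alpha> * y b" \<beta>] psd[OF t1(1)] by (simp add: pos_semidef_iff) (smt (verit))
  also have "\<dots> \<le> 2 * (real (M ^ (2 * g)) * N) + 2 * (real g * (real g * ((9 / 4 / K0 + K0 ^ g / (real M)\<^sup>2) * a i0)))"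
  proof (intro add_mono mult_left_mono)
    have N0: "0 \<le> quad t1 y" using psd[OF t1(1)] by (simp add: pos_semidef_iff)
    have "0 \<le> \<alpha>" using q(1) q'0 by (simp add: \<alpha>_def)
    moreover have "\<alpha> \<le> real (M ^ g)"
    proof -
      have "\<alpha> \<le> of_int q / 1" unfolding \<alpha>_def by (rule divide_left_mono) (use q q'1 in auto)
      also have "\<dots> \<le> real (M ^ g)" using q(2) by (metis div_by_1 of_int_le_iff of_int_of_nat_eq)
      finally show ?thesis .
    qed
    ultimately have "\<alpha>\<^sup>2 \<le> (real (M ^ g))\<^sup>2" by (intro power_mono)
    also have "(real (M ^ g))\<^sup>2 = real (M ^ (2 * g))" by (simp add: power2_eq_square mult_2 power_add)
    finally have "\<alpha>\<^sup>2 \<le> real (M ^ (2 * g))" .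
    then show "quad t1 (\<lambda>b. \<alpha> * y b) \<le> real (M ^ (2 * g)) * N"
      unfolding quad_scale using y(2) N0 by (intro mult_mono) auto
    have "quad t1 \<beta> \<le> real g * (\<Sum>b\<in>UNIV. (\<beta> b)\<^sup>2 * t1 $ b $ b)"
      unfolding g_def by (rule quad_diag_bound[OF psd[OF t1(1)]])
    also have "\<dots> \<le> real g * (\<Sum>b\<in>(UNIV::'g set). (9 / 4 / K0 + K0 ^ g / (real M)\<^sup>2) * a i0)"
    proof (intro mult_left_mono sum_mono)
      fix b :: 'g
      obtain i where i: "i < g" "b = e i" using esurj by blast
      have c0: "0 \<le> 9 / 4 / real K0 * a i0" "0 \<le> K0 ^ g / (real M)\<^sup>2 * a i0" using a0 by auto
      show "(\<beta> b)\<^sup>2 * t1 $ b $ b \<le> (9 / 4 / K0 + K0 ^ g / (real M)\<^sup>2) * a i0"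
      proof (cases "i = g - 1")
        case True
        then show ?thesis using \<beta>L i c0 by (simp add: distrib_right)
      next
        case False
        then have t1a: "t1 $ b $ b = a i" unfolding a_def i(2) by (intro t1(2)) (use i einj g0 in auto)
        show ?thesis
        proof (cases "i < i0")
          case True
          have "(\<beta> b)\<^sup>2 \<le> (3 / 2)\<^sup>2" using \<beta>2[OF True i(1)] i(2) by (intro abs_le_square_iff[THEN iffD1]) simp
          then have "(\<beta> b)\<^sup>2 * a i \<le> 9 / 4 * a i" using a0 by (intro mult_right_mono) (auto simp: power2_eq_square)
          also have "\<dots> \<le> 9 / 4 / real K0 * a i0" using below[OF True] K1 by (simp add: field_simps)
          finally show ?thesis using c0 by (simp add: t1a distrib_right)
        next
          case False
          have "\<bar>\<beta> b\<bar> \<le> \<bar>1 / real M\<bar>" using \<beta>1[of i] i False by simp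
          then have "(\<beta> b)\<^sup>2 \<le> (1 / real M)\<^sup>2" by (intro abs_le_square_iff[THEN iffD1])
          then have "(\<beta> b)\<^sup>2 * a i \<le> (1 / real M)\<^sup>2 * (real K0 ^ g * a i0)"
            using above'[OF i(1)] a0 by (intro mult_mono) auto
          then show ?thesis using c0 by (simp add: t1a distrib_right power_divide)
        qed
      qed
    qed simp
    also have "\<dots> = real g * (real g * ((9 / 4 / K0 + K0 ^ g / (real M)\<^sup>2) * a i0))" by (simp add: g_def)
    finally show "quad t1 \<beta> \<le> real g * (real g * ((9 / 4 / K0 + K0 ^ g / (real M)\<^sup>2) * a i0))" .
  qed auto
  finally have fin: "a i0 \<le> 2 * (real (M ^ (2 * g)) * N) + 2 * (real g * (real g * ((9 / 4 / K0 + K0 ^ g / (real M)\<^sup>2) * a i0)))" .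
  \<comment> \<open>Origin of the constants: \<open>K0 = 8 * g\<^sup>2\<close> turns the rounding
    error (3/2)^2 = 9/4 into 9/16, and \<open>M = 8 * g\<^sup>2 * K0 ^ g\<close> leaves 1/4 for the
    approximation error. The total 13/16 is below 1.\<close>
  have small: "2 * (real g * (real g * (9 / 4 / K0 + K0 ^ g / (real M)\<^sup>2))) \<le> 13 / 16"
  proof -
    have gp: "real g > 0" using g0 by simp
    have 1: "2 * (real g * (real g * (9 / 4 / K0))) = 9 / 16"
      using gp by (simp add: K0_def power2_eq_square field_simps)
    have "2 * (real g * (real g * (K0 ^ g / (real M)\<^sup>2))) \<le> 2 * (real g * (real g * (K0 ^ g / real M)))"
      using M1 by (intro mult_left_mono divide_left_mono) (auto simp: power2_eq_square)
    also have "\<dots> = 1 / 4"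
      using gp K1 by (simp add: M_def power2_eq_square field_simps)
    finally show ?thesis using 1 by (simp add: distrib_left)
  qed
  have "2 * (real g * (real g * ((9 / 4 / K0 + K0 ^ g / (real M)\<^sup>2) * a i0))) \<le> 13 / 16 * a i0"
    using mult_right_mono[OF small a0[of i0]] by (simp only: mult.assoc)
  with fin have "a i0 \<le> 16 / 3 * (2 * (real (M ^ (2 * g)) * N))" by linarith
  obtain i where i: "i < g" "b = e i" using esurj by blast
  have N0: "0 \<le> N" using psd[OF t1(1)] y(2) unfolding pos_semidef_iff by (meson order_trans)
  \<comment> \<open>Absorbing 13/16 leaves 3/16, whence the factor 32/3, rounded up to 11.\<close>
  have "a i0 \<le> 11 * (real (M ^ (2 * g)) * N)"
  proof -
    have "0 \<le> real (M ^ (2 * g)) * N" by (intro mult_nonneg_nonneg N0) simp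
    then show ?thesis using \<open>a i0 \<le> 16 / 3 * (2 * (real (M ^ (2 * g)) * N))\<close> by linarith
  qed
  then have "real K0 ^ g * a i0 \<le> real K0 ^ g * (11 * (real (M ^ (2 * g)) * N))"
    by (rule mult_left_mono) simp
  then have "a i \<le> real K0 ^ g * (11 * (real (M ^ (2 * g)) * N))"
    using above'[OF i(1)] by simp
  then show ?thesis by (simp add: a_def i(2) mult_ac)
qed

section \<open>The dimension bound\<close>

lemma jacobi_lift_add: "jacobi_lift m (\<phi> + \<psi>) \<tau> = jacobi_lift m \<phi> \<tau> + jacobi_lift m \<psi> \<tau>"
  by (simp add: jacobi_lift_def distrib_right)

lemma jacobi_lift_scale: "jacobi_lift m (\<lambda>x. c * \<phi> x) \<tau> = c * jacobi_lift m \<phi> \<tau>"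
  by (simp add: jacobi_lift_def)

lemma has_fourier_expansion_add:
  assumes "has_fourier_expansion \<phi> c" "has_fourier_expansion \<psi> d"
  shows "has_fourier_expansion (\<phi> + \<psi>) (\<lambda>x. c x + d x)"
  unfolding has_fourier_expansion_def
proof (intro conjI allI impI ballI)
  show "c x + d x = 0" if "x \<notin> fourier_indices" for x
    using assms that unfolding has_fourier_expansion_def by (metis add.right_neutral)
  fix p :: "(complex^'a^'a) \<times> (complex^1^'a)" assume p: "p \<in> jacobi_domain"
  obtain \<tau> z where pz: "p = (\<tau>, z)" by (cases p)
  have "((\<lambda>(n, r). c (n, r) * e_tr (map_matrix of_real n ** \<tau> + map_matrix of_real r ** transpose z)) has_sum \<phi> (\<tau>, z)) fourier_indices"
    "((\<lambda>(n, r). d (n, r) * e_tr (map_matrix of_real n ** \<tau> + map_matrix of_real r ** transpose z)) has_sum \<psi> (\<tau>, z)) fourier_indices"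
    using assms p unfolding has_fourier_expansion_def pz by blast+
  from has_sum_add[OF this]
  show "case p of (\<tau>, z) \<Rightarrow> ((\<lambda>(n, r). (c (n, r) + d (n, r)) * e_tr (map_matrix of_real n ** \<tau> + map_matrix of_real r ** transpose z))
     has_sum (\<phi> + \<psi>) (\<tau>, z)) fourier_indices"
    by (simp add: pz case_prod_unfold distrib_right)
qed

lemma has_fourier_expansion_scale:
  assumes "has_fourier_expansion \<phi> d"
  shows "has_fourier_expansion (\<lambda>x. c * \<phi> x) (\<lambda>x. c * d x)"
  unfolding has_fourier_expansion_def
proof (intro conjI allI impI ballI)
  show "c * d x = 0" if "x \<notin> fourier_indices" for x
    using assms that unfolding has_fourier_expansion_def by (metis mult_zero_right)
  fix p :: "(complex^'a^'a) \<times> (complex^1^'a)" assume p: "p \<in> jacobi_domain"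
  obtain \<tau> z where pz: "p = (\<tau>, z)" by (cases p)
  have "((\<lambda>(n, r). d (n, r) * e_tr (map_matrix of_real n ** \<tau> + map_matrix of_real r ** transpose z)) has_sum \<phi> (\<tau>, z)) fourier_indices"
    using assms p unfolding has_fourier_expansion_def pz by blast
  from has_sum_cmult_right[OF this, of c]
  show "case p of (\<tau>, z) \<Rightarrow> ((\<lambda>(n, r). c * d (n, r) * e_tr (map_matrix of_real n ** \<tau> + map_matrix of_real r ** transpose z))
     has_sum c * \<phi> (\<tau>, z)) fourier_indices"
    by (simp add: pz case_prod_unfold mult.assoc)
qed

lemma jacobi_forms_add:
  fixes \<phi> \<psi> :: "('n::finite) jacobi_fun"
  assumes \<phi>: "\<phi> \<in> jacobi_forms k m" and \<psi>: "\<psi> \<in> jacobi_forms k m"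
  shows "\<phi> + \<psi> \<in> jacobi_forms k m" "fourier_coeff (\<phi> + \<psi>) = (\<lambda>x. fourier_coeff \<phi> x + fourier_coeff \<psi> x)"
proof -
  show fc: "fourier_coeff (\<phi> + \<psi>) = (\<lambda>x. fourier_coeff \<phi> x + fourier_coeff \<psi> x)"
    by (intro fourier_coeff_eqI has_fourier_expansion_add jacobi_fourier_expansion[OF \<phi>] jacobi_fourier_expansion[OF \<psi>])
  have "jacobi_holomorphic (\<phi> + \<psi>)"
    unfolding jacobi_holomorphic_def
  proof
    fix x :: "(complex^'n^'n) \<times> (complex^1^'n)" assume x: "x \<in> jacobi_domain"
    obtain p where p: "(\<phi> has_derivative p) (at x within jacobi_domain)" "\<And>c A w. p (map_matrix ((*) c) A, map_matrix ((*) c) w) = c * p (A, w)"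
      using \<phi> x unfolding jacobi_forms_def jacobi_holomorphic_def by blast
    obtain q where q: "(\<psi> has_derivative q) (at x within jacobi_domain)" "\<And>c A w. q (map_matrix ((*) c) A, map_matrix ((*) c) w) = c * q (A, w)"
      using \<psi> x unfolding jacobi_forms_def jacobi_holomorphic_def by blast
    have "((\<phi> + \<psi>) has_derivative (\<lambda>h. p h + q h)) (at x within jacobi_domain)"
      using has_derivative_add[OF p(1) q(1)] by (simp add: plus_fun_def)
    moreover have "p (map_matrix ((*) c) A, map_matrix ((*) c) w) + q (map_matrix ((*) c) A, map_matrix ((*) c) w) = c * (p (A, w) + q (A, w))" for c A w
      unfolding p(2) q(2) by (simp add: distrib_left)
    ultimately show "\<exists>\<phi>'. ((\<phi> + \<psi>) has_derivative \<phi>') (at x within jacobi_domain) \<and>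
        (\<forall>c A w. \<phi>' (map_matrix ((*) c) A, map_matrix ((*) c) w) = c * \<phi>' (A, w))" by blast
  qed
  moreover have "(\<phi> + \<psi>) x = 0" if "x \<notin> jacobi_domain" for x
  proof -
    have "\<phi> x = 0" "\<psi> x = 0" using \<phi> \<psi> that unfolding jacobi_forms_def by blast+
    then show ?thesis by simp
  qed
  moreover have "jacobi_lift m (\<phi> + \<psi>) (siegel_action (jacobi_matrix M l \<mu>) \<tau>) =
      det (automorphy (jacobi_matrix M l \<mu>) \<tau>) ^ k * jacobi_lift m (\<phi> + \<psi>) \<tau>"
    if "M \<in> Sp_int" "\<tau> \<in> siegel" for M l \<mu> \<tau>
  proof -
    have "jacobi_lift m \<phi> (siegel_action (jacobi_matrix M l \<mu>) \<tau>) = det (automorphy (jacobi_matrix M l \<mu>) \<tau>) ^ k * jacobi_lift m \<phi> \<tau>"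
      "jacobi_lift m \<psi> (siegel_action (jacobi_matrix M l \<mu>) \<tau>) = det (automorphy (jacobi_matrix M l \<mu>) \<tau>) ^ k * jacobi_lift m \<psi> \<tau>"
      using \<phi> \<psi> that unfolding jacobi_forms_def by blast+
    then show ?thesis by (simp add: jacobi_lift_add distrib_left)
  qed
  moreover have "pos_semidef (index_matrix n r m)"
    if "CARD('n) = 1" "(n, r) \<in> fourier_indices" "fourier_coeff (\<phi> + \<psi>) (n, r) \<noteq> 0" for n r
  proof -
    have "fourier_coeff \<phi> (n, r) \<noteq> 0 \<or> fourier_coeff \<psi> (n, r) \<noteq> 0" using that(3) fc by auto
    then show ?thesis using \<phi> \<psi> that(1,2) unfolding jacobi_forms_def by blast
  qed
  ultimately show "\<phi> + \<psi> \<in> jacobi_forms k m" unfolding jacobi_forms_def by blast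
qed

lemma jacobi_forms_scale:
  fixes \<phi> :: "('n::finite) jacobi_fun"
  assumes \<phi>: "\<phi> \<in> jacobi_forms k m"
  shows "(\<lambda>x. c * \<phi> x) \<in> jacobi_forms k m" "fourier_coeff (\<lambda>x. c * \<phi> x) = (\<lambda>x. c * fourier_coeff \<phi> x)"
proof -
  show fc: "fourier_coeff (\<lambda>x. c * \<phi> x) = (\<lambda>x. c * fourier_coeff \<phi> x)"
    by (intro fourier_coeff_eqI has_fourier_expansion_scale jacobi_fourier_expansion[OF \<phi>])
  have "jacobi_holomorphic (\<lambda>x. c * \<phi> x)"
    unfolding jacobi_holomorphic_def
  proof
    fix x :: "(complex^'n^'n) \<times> (complex^1^'n)" assume x: "x \<in> jacobi_domain"
    obtain p where p: "(\<phi> has_derivative p) (at x within jacobi_domain)" "\<And>c A w. p (map_matrix ((*) c) A, map_matrix ((*) c) w) = c * p (A, w)"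
      using \<phi> x unfolding jacobi_forms_def jacobi_holomorphic_def by blast
    have "((\<lambda>x. c * \<phi> x) has_derivative (\<lambda>h. c * p h)) (at x within jacobi_domain)"
      by (rule has_derivative_mult_right[OF p(1)])
    moreover have "c * p (map_matrix ((*) d) A, map_matrix ((*) d) w) = d * (c * p (A, w))" for d A w
      unfolding p(2) by simp
    ultimately show "\<exists>\<phi>'. ((\<lambda>x. c * \<phi> x) has_derivative \<phi>') (at x within jacobi_domain) \<and>
        (\<forall>c A w. \<phi>' (map_matrix ((*) c) A, map_matrix ((*) c) w) = c * \<phi>' (A, w))" by blast
  qed
  moreover have "c * \<phi> x = 0" if "x \<notin> jacobi_domain" for x
  proof -
    have "\<phi> x = 0" using \<phi> that unfolding jacobi_forms_def by blast
    then show ?thesis by simp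
  qed
  moreover have "jacobi_lift m (\<lambda>x. c * \<phi> x) (siegel_action (jacobi_matrix M l \<mu>) \<tau>) =
      det (automorphy (jacobi_matrix M l \<mu>) \<tau>) ^ k * jacobi_lift m (\<lambda>x. c * \<phi> x) \<tau>"
    if "M \<in> Sp_int" "\<tau> \<in> siegel" for M l \<mu> \<tau>
  proof -
    have "jacobi_lift m \<phi> (siegel_action (jacobi_matrix M l \<mu>) \<tau>) = det (automorphy (jacobi_matrix M l \<mu>) \<tau>) ^ k * jacobi_lift m \<phi> \<tau>"
      using \<phi> that unfolding jacobi_forms_def by blast
    then show ?thesis by (simp add: jacobi_lift_scale)
  qed
  moreover have "pos_semidef (index_matrix n r m)"
    if "CARD('n) = 1" "(n, r) \<in> fourier_indices" "fourier_coeff (\<lambda>x. c * \<phi> x) (n, r) \<noteq> 0" for n r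
  proof -
    have "fourier_coeff \<phi> (n, r) \<noteq> 0" using that(3) fc by auto
    then show ?thesis using \<phi> that(1,2) unfolding jacobi_forms_def by blast
  qed
  ultimately show "(\<lambda>x. c * \<phi> x) \<in> jacobi_forms k m" unfolding jacobi_forms_def by blast
qed

lemma FM_add:
  fixes f h :: "('n::finite) formal_series"
  assumes f: "f \<in> FM k" and h: "h \<in> FM k"
  shows "f + h \<in> FM k" "fj_coeff (f + h) t = fj_coeff f t + fj_coeff h t"
proof -
  have j: "f m \<in> jacobi_forms k m" "h m \<in> jacobi_forms k m" for m using f h by (auto simp: FM_def)
  have fj: "fj_coeff (f + h) t = fj_coeff f t + fj_coeff h t" for t
    using jacobi_forms_add(2)[OF j] by (simp add: fj_coeff_def)
  show "fj_coeff (f + h) t = fj_coeff f t + fj_coeff h t" by (rule fj)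
  have "fj_symmetric k f" "fj_symmetric k h" using f h by (auto simp: FM_def)
  have "fj_symmetric k (f + h)"
    unfolding fj_symmetric_def
  proof (intro allI impI)
    fix t :: "real^('n + 1)^('n + 1)" and u :: "int^('n + 1)^('n + 1)" assume tu: "half_integral t" "pos_semidef t" "invertible u"
    let ?t = "transpose (map_matrix of_int u) ** t ** map_matrix of_int u"
    have 1: "fj_coeff f t = of_int (det u) ^ k * fj_coeff f ?t" "fj_coeff h t = of_int (det u) ^ k * fj_coeff h ?t"
      using \<open>fj_symmetric k f\<close> \<open>fj_symmetric k h\<close> tu unfolding fj_symmetric_def by blast+
    show "fj_coeff (f + h) t = of_int (det u) ^ k * fj_coeff (f + h) ?t"
      unfolding fj 1 by (simp only: distrib_left)
  qed
  then show "f + h \<in> FM k" using jacobi_forms_add(1)[OF j] by (simp add: FM_def)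
qed

lemma FM_scale:
  fixes f :: "('n::finite) formal_series"
  assumes f: "f \<in> FM k"
  shows "fj_scale c f \<in> FM k" "fj_coeff (fj_scale c f) t = c * fj_coeff f t"
proof -
  have j: "f m \<in> jacobi_forms k m" for m using f by (auto simp: FM_def)
  have fj: "fj_coeff (fj_scale c f) t = c * fj_coeff f t" for t
    using jacobi_forms_scale(2)[OF j] by (simp add: fj_coeff_def fj_scale_def)
  show "fj_coeff (fj_scale c f) t = c * fj_coeff f t" by (rule fj)
  have "fj_symmetric k f" using f by (auto simp: FM_def)
  have "fj_symmetric k (fj_scale c f)"
    unfolding fj_symmetric_def
  proof (intro allI impI)
    fix t :: "real^('n + 1)^('n + 1)" and u :: "int^('n + 1)^('n + 1)" assume tu: "half_integral t" "pos_semidef t" "invertible u"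
    let ?t = "transpose (map_matrix of_int u) ** t ** map_matrix of_int u"
    have 1: "fj_coeff f t = of_int (det u) ^ k * fj_coeff f ?t"
      using \<open>fj_symmetric k f\<close> tu unfolding fj_symmetric_def by blast
    show "fj_coeff (fj_scale c f) t = of_int (det u) ^ k * fj_coeff (fj_scale c f) ?t"
      unfolding fj 1 by (simp only: mult.left_commute)
  qed
  then show "fj_scale c f \<in> FM k" using jacobi_forms_scale(1)[OF j] by (simp add: FM_def fj_scale_def)
qed

lemma FM_sum:
  fixes B :: "('n::finite) formal_series set"
  assumes "finite B" "B \<noteq> {}" "B \<subseteq> FM k"
  shows "(\<Sum>f\<in>B. fj_scale (x f) f) \<in> FM k \<and> fj_coeff (\<Sum>f\<in>B. fj_scale (x f) f) t = (\<Sum>f\<in>B. x f * fj_coeff f t)"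
  using assms
proof (induction B rule: finite_ne_induct)
  case (singleton f)
  then show ?case using FM_scale(1)[of f k "x f"] FM_scale(2)[of f k "x f"] by simp
next
  case (insert f B)
  then have "f \<in> FM k" "(\<Sum>f\<in>B. fj_scale (x f) f) \<in> FM k" by auto
  then show ?case
    unfolding sum.insert[OF insert.hyps(1,3)] FM_add(2)[OF FM_scale(1)[OF \<open>f \<in> FM k\<close>] \<open>(\<Sum>f\<in>B. fj_scale (x f) f) \<in> FM k\<close>]
      FM_scale(2)[OF \<open>f \<in> FM k\<close>]
    using insert.IH insert.prems by (intro conjI FM_add(1) FM_scale(1)) auto
qed

text \<open>Elimination: an equation with nonzero coefficient at \<open>b0\<close> is solved for
  \<open>x b0\<close> and substituted into the others, which removes one equation and one
  unknown.\<close>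

lemma homogeneous_system:
  fixes A :: "'b \<Rightarrow> 's \<Rightarrow> 'f::field"
  assumes "finite S" "finite B" "card S < card B"
  shows "\<exists>x. (\<exists>b\<in>B. x b \<noteq> 0) \<and> (\<forall>s\<in>S. (\<Sum>b\<in>B. x b * A b s) = 0)"
  using assms
proof (induction S arbitrary: B A)
  case empty
  then obtain b where "b \<in> B" by fastforce
  then show ?case by (intro exI[of _ "\<lambda>_. 1"]) auto
next
  case (insert s S)
  show ?case
  proof (cases "\<forall>b\<in>B. A b s = 0")
    case True
    then show ?thesis using insert.IH[of B A] insert.hyps insert.prems by auto
  next
    case False
    then obtain b0 where b0: "b0 \<in> B" "A b0 s \<noteq> 0" by blast
    have "card S < card (B - {b0})" using insert.hyps insert.prems b0 by (simp add: card_Diff_singleton)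
    moreover have "finite (B - {b0})" using insert.prems by simp
    ultimately obtain x where x: "\<exists>b\<in>B - {b0}. x b \<noteq> 0" "\<And>r. r \<in> S \<Longrightarrow> (\<Sum>b\<in>B - {b0}. x b * (A b r - A b s / A b0 s * A b0 r)) = 0"
      using insert.IH[of "B - {b0}" "\<lambda>b r. A b r - A b s / A b0 s * A b0 r"] by blast
    define X where "X = (\<Sum>b\<in>B - {b0}. x b * A b s) / A b0 s"
    define x' where "x' = (\<lambda>b. if b = b0 then - X else x b)"
    have split: "(\<Sum>b\<in>B. x' b * A b r) = - X * A b0 r + (\<Sum>b\<in>B - {b0}. x b * A b r)" for r
    proof -
      have "(\<Sum>b\<in>B. x' b * A b r) = x' b0 * A b0 r + (\<Sum>b\<in>B - {b0}. x' b * A b r)"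
        by (rule sum.remove) (use insert.prems b0 in auto)
      also have "(\<Sum>b\<in>B - {b0}. x' b * A b r) = (\<Sum>b\<in>B - {b0}. x b * A b r)"
        by (rule sum.cong) (auto simp: x'_def)
      finally show ?thesis by (simp add: x'_def)
    qed
    have "(\<Sum>b\<in>B. x' b * A b r) = 0" if "r \<in> insert s S" for r
    proof (cases "r = s")
      case True
      then show ?thesis unfolding split X_def using b0 by simp
    next
      case False
      then have "0 = (\<Sum>b\<in>B - {b0}. x b * (A b r - A b s / A b0 s * A b0 r))" using x(2) that by simp
      also have "\<dots> = (\<Sum>b\<in>B - {b0}. x b * A b r) - X * A b0 r"
        by (simp add: X_def right_diff_distrib sum_subtractf sum_divide_distrib sum_distrib_right mult.assoc)
      finally show ?thesis unfolding split by simp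
    qed
    moreover have "\<exists>b\<in>B. x' b \<noteq> 0" using x(1) by (auto simp: x'_def)
    ultimately show ?thesis by blast
  qed
qed

text \<open>The coefficients at \<open>S\<close> embed the space into one of dimension
  \<open>card S\<close>. Finite generation is recorded as well, since \<open>fj.dim\<close> is 0 for
  a space without a finite basis and the inequality alone would not exclude that case.\<close>

lemma FM_dim_le:
  fixes S :: "(real^('n::finite + 1)^('n + 1)) set"
  assumes S: "finite S" and inj: "\<And>f :: 'n formal_series. f \<in> FM k \<Longrightarrow> (\<And>t. t \<in> S \<Longrightarrow> fj_coeff f t = 0) \<Longrightarrow> f = (\<lambda>_ _. 0)"
  shows "(\<exists>B. finite B \<and> (FM k :: ('n formal_series) set) \<subseteq> fj.span B) \<and> fj.dim (FM k :: ('n formal_series) set) \<le> card S"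
proof -
  have small: "card B \<le> card S" if B: "finite B" "B \<subseteq> FM k" "fj.independent B" for B :: "'n formal_series set"
  proof (rule ccontr)
    assume "\<not> card B \<le> card S"
    then obtain x where x: "\<exists>b\<in>B. x b \<noteq> 0" "\<And>t. t \<in> S \<Longrightarrow> (\<Sum>b\<in>B. x b * fj_coeff b t) = 0"
      using homogeneous_system[OF S B(1), of "fj_coeff"] by auto
    have ne: "B \<noteq> {}" using x(1) by auto
    have "(\<Sum>f\<in>B. fj_scale (x f) f) = (\<lambda>_ _. 0)"
      by (rule inj) (use FM_sum[OF B(1) ne B(2), of x] x(2) in auto)
    then have "(\<Sum>f\<in>B. fj_scale (x f) f) = 0" by (simp add: zero_fun_def)
    then show False using fj.independentD[OF B(3) B(1) subset_refl, of x] x(1) by blast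
  qed
  obtain B where B: "B \<subseteq> (FM k :: ('n formal_series) set)" "fj.independent B" "FM k \<subseteq> fj.span B" "card B = fj.dim (FM k :: ('n formal_series) set)"
    using fj.basis_exists by blast
  \<comment> \<open>An infinite basis would contain an independent set with
    \<open>card S + 1\<close> elements.\<close>
  have "finite B"
  proof (rule ccontr)
    assume "infinite B"
    then obtain B' where B': "B' \<subseteq> B" "finite B'" "card B' = Suc (card S)" using infinite_arbitrarily_large by blast
    then show False using small[of B'] B fj.independent_mono[OF B(2) B'(1)] by auto
  qed
  then show ?thesis using B small[of B] by auto
qed

section \<open>Counting semidefinite indices with bounded diagonal\<close>

lemma card_pairs: "card (pairs :: 'g::finite set set) = CARD('g) * (CARD('g) + 1) div 2"
proof -
  have "(pairs :: 'g set set) = {A. A \<subseteq> UNIV \<and> card A = 1} \<union> {A. A \<subseteq> UNIV \<and> card A = 2}"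
    unfolding pairs_def by (auto simp: le_Suc_eq numeral_2_eq_2)
  also have "card \<dots> = CARD('g) + (CARD('g) choose 2)"
    by (subst card_Un_disjoint) (auto simp: n_subsets[of "UNIV :: 'g set", simplified])
  also have "\<dots> = CARD('g) * (CARD('g) + 1) div 2"
    unfolding choose_two by (cases "CARD('g)") (auto simp: algebra_simps)
  finally show ?thesis .
qed

text \<open>A half-integral matrix is determined by its exponents at \<open>pairs\<close>. Testing
  the form at the sum and the difference of two unit vectors bounds twice an off-diagonal entry by
  \<open>2 * R\<close>, so each of the g(g+1)/2 exponents takes at most \<open>4 * R + 1\<close>
  values.\<close>

lemma bounded_indices:
  defines "S \<equiv> (\<lambda>R::nat. {t :: real^'g::finite^'g. half_integral t \<and> pos_semidef t \<and> (\<forall>a. t $ a $ a \<le> real R)})"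
  shows "finite (S R)" "card (S R) \<le> (4 * R + 1) ^ (CARD('g) * (CARD('g) + 1) div 2)"
proof -
  define F where "F = (\<lambda>t::real^'g^'g. restrict (\<lambda>A. \<lfloor>pair_entry t A\<rfloor>) pairs)"
  have inj: "inj_on F (S R)"
  proof (rule inj_onI)
    fix t s assume ts: "t \<in> S R" "s \<in> S R" "F t = F s"
    show "t = s"
    proof (rule eq_by_entries)
      fix A :: "'g set" assume A: "A \<in> pairs"
      have "\<lfloor>pair_entry t A\<rfloor> = \<lfloor>pair_entry s A\<rfloor>" using fun_cong[OF ts(3), of A] A by (simp add: F_def)
      moreover have "pair_entry t A \<in> \<int>" "pair_entry s A \<in> \<int>" using pair_entry_Ints A ts by (auto simp: S_def)
      ultimately show "pair_entry t A = pair_entry s A" by (metis Ints_cases floor_of_int)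
    qed (use ts in \<open>auto simp: S_def half_integral_def\<close>)
  qed
  have sub: "F ` S R \<subseteq> PiE pairs (\<lambda>_. {- (2 * int R)..2 * int R})"
  proof
    fix h assume "h \<in> F ` S R"
    then obtain t where t: "t \<in> S R" "h = F t" by blast
    have tr: "transpose t = t" and ps: "pos_semidef t" and d: "\<And>a. t $ a $ a \<le> R" using t by (auto simp: S_def pos_semidef_iff)
    have "\<bar>pair_entry t A\<bar> \<le> 2 * real R" if A: "A \<in> pairs" for A
    proof -
      obtain a b where ab: "A = {a, b}" using A by (auto simp: pairs_iff)
      show ?thesis
      proof (cases "a = b")
        case True
        then show ?thesis using d[of a] pos_semidef_diag[OF ps, of a] by (simp add: ab pair_entry_single)
      next
        case False
        have q: "quad t (\<lambda>c. (if c = a then 1 else 0) + s * (if c = b then 1 else 0)) = t $ a $ a + s * (2 * t $ a $ b) + s\<^sup>2 * t $ b $ b" for s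
        proof -
          have "t $ c $ d * ((if c = a then 1 else 0) * (if d = b then 1 else 0) + (if c = b then 1 else 0) * (if d = a then 1 else 0)) =
            (if c = a then if d = b then t $ a $ b else 0 else 0) + (if c = b then if d = a then t $ a $ b else 0 else 0)" for c d
            using False sym_nth[OF tr, of a b] by auto
          then show ?thesis unfolding quad_add_scale quad_axis by (simp only: sum.distrib sum_delta2) simp
        qed
        have "0 \<le> t $ a $ a + s * (2 * t $ a $ b) + s\<^sup>2 * t $ b $ b" for s
          unfolding q[symmetric] using ps unfolding pos_semidef_iff by blast
        from this[of 1] this[of "- 1"] show ?thesis
          using d[of a] d[of b] unfolding ab pair_entry_pair[OF tr False] by (simp add: abs_le_iff)
      qed
    qed
    then have "\<lfloor>pair_entry t A\<rfloor> \<in> {- (2 * int R)..2 * int R}" if A: "A \<in> pairs" for A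
    proof -
      obtain n where n: "pair_entry t A = of_int n" using pair_entry_Ints[OF _ A, of t] t by (auto simp: S_def elim: Ints_cases)
      have "\<bar>real_of_int n\<bar> \<le> real_of_int (2 * int R)" using \<open>\<And>A. A \<in> pairs \<Longrightarrow> \<bar>pair_entry t A\<bar> \<le> 2 * real R\<close>[OF A] n by simp
      then have "\<bar>n\<bar> \<le> 2 * int R" by (simp only: of_int_abs[symmetric] of_int_le_iff)
      then show ?thesis by (simp add: n abs_le_iff)
    qed
    then show "h \<in> PiE pairs (\<lambda>_. {- (2 * int R)..2 * int R})" unfolding t(2) F_def by auto
  qed
  have finP: "finite (PiE (pairs :: 'g set set) (\<lambda>_. {- (2 * int R)..2 * int R}))" by (intro finite_PiE) auto
  show "finite (S R)" using finite_imageD[OF finite_subset[OF sub finP] inj] .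
  have "card (S R) = card (F ` S R)" using card_image[OF inj] by simp
  also have "\<dots> \<le> card (PiE (pairs :: 'g set set) (\<lambda>_. {- (2 * int R)..2 * int R}))" by (rule card_mono[OF finP sub])
  also have "\<dots> = (4 * R + 1) ^ card (pairs :: 'g set set)"
  proof -
    have "nat (4 * int R + 1) = 4 * R + 1" by linarith
    then show ?thesis by (simp add: card_PiE)
  qed
  finally show "card (S R) \<le> (4 * R + 1) ^ (CARD('g) * (CARD('g) + 1) div 2)" by (simp add: card_pairs)
qed

lemma fj_support_small_diag:
  "\<exists>C::nat. \<forall>k>0. \<forall>f \<in> (FM k :: ('n::finite formal_series) set). fj_support f \<noteq> {} \<longrightarrow>
     (\<exists>t\<in>fj_support f. \<forall>b. t $ b $ b \<le> real (C * k))"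
proof -
  define g where "g = CARD('n + 1)"
  define K0 where "K0 = 8 * g\<^sup>2"
  define M where "M = 8 * g\<^sup>2 * K0 ^ g"
  have g0: "g > 0" by (simp add: g_def)
  obtain j :: 'n where True by blast
  \<comment> \<open>The exceptional row must lie in the first block for the block bound and come
    last for the reduction, so the positions are enumerated with \<open>Inl j\<close> at the
    end.\<close>
  obtain e where e: "bij_betw e {..<g} (UNIV :: ('n + 1) set)" "e (g - 1) = Inl j"
  proof -
    obtain h where h: "bij_betw h {..<g} (UNIV :: ('n + 1) set)"
      using ex_bij_betw_nat_finite[of "UNIV :: ('n + 1) set"] by (auto simp: g_def lessThan_atLeast0)
    define w where "w = h (g - 1)"
    have "bij_betw (Transposition.transpose w (Inl j) \<circ> h) {..<g} UNIV"
      by (rule bij_betw_trans[OF h]) (rule bij_transpose)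
    moreover have "(Transposition.transpose w (Inl j) \<circ> h) (g - 1) = Inl j" by (simp add: w_def)
    ultimately show ?thesis using that by blast
  qed
  have "\<exists>t\<in>fj_support f. \<forall>b. t $ b $ b \<le> real (11 * K0 ^ g * M ^ (2 * g)) * real k"
    if k: "k > 0" and f: "f \<in> FM k" and ne: "fj_support f \<noteq> {}" for k and f :: "'n formal_series"
  proof -
    \<comment> \<open>Diagonal entries of indices in the support are natural numbers; in this form
      \<open>lexmin\<close> can minimise them.\<close>
    define d where "d = (\<lambda>(t::real^('n+1)^('n+1)) i. nat \<lfloor>t $ e i $ e i\<rfloor>)"
    have dr: "real (d t i) = t $ e i $ e i" if "t \<in> fj_support f" for t i
    proof -
      have hp: "half_integral t" "pos_semidef t" using that by (auto simp: fj_support_def)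
      obtain m where "t $ e i $ e i = real m" by (rule half_integral_diag_nat[OF hp])
      then show ?thesis by (simp add: d_def)
    qed
    obtain t where t: "t \<in> fj_support f" "\<And>i s. i < g \<Longrightarrow> s \<in> fj_support f \<Longrightarrow> (\<forall>i'<i. d s i' = d t i') \<Longrightarrow> d t i \<le> d s i"
      using lexmin[OF ne, of g d] by blast
    obtain t1 y where t1: "t1 \<in> fj_support f" "t1 \<in> same_block t (Inl j)" and y: "y (Inl j) = 1" "quad t1 y < real k"
      using fj_support_block_bound[OF f k t(1), of j] by blast
    have "t $ b $ b \<le> real (11 * K0 ^ g * M ^ (2 * g)) * real k" for b
      unfolding M_def K0_def unfolding g_def
    proof (rule reduced_bound[of e "fj_support f" t t1 y "real k"])
      show "bij_betw e {..<CARD('n + 1)} UNIV" using e(1) by (simp only: g_def)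
      show "pos_semidef s" if "s \<in> fj_support f" for s using that by (simp add: fj_support_def)
      show "unimod_act u s \<in> fj_support f" if "s \<in> fj_support f" "invertible u" for s u by (rule fj_support_unimod_act[OF f that])
      show "t $ e i $ e i \<le> s $ e i $ e i"
        if "s \<in> fj_support f" "i < CARD('n + 1)" "\<And>i'. i' < i \<Longrightarrow> s $ e i' $ e i' = t $ e i' $ e i'" for s i
      proof -
        have "d s i' = d t i'" if "i' < i" for i' using \<open>\<And>i'. i' < i \<Longrightarrow> s $ e i' $ e i' = t $ e i' $ e i'\<close>[OF that] by (simp add: d_def)
        then have "d t i \<le> d s i" using t(2)[of i s] that(1,2) by (simp add: g_def)
        then have "real (d t i) \<le> real (d s i)" by simp
        then show ?thesis using dr[OF t(1)] dr[OF that(1)] by simp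
      qed
      show "t1 $ a $ b = t $ a $ b" if "a \<noteq> e (CARD('n + 1) - 1)" "b \<noteq> e (CARD('n + 1) - 1)" for a b
        using that t1(2) e(2) unfolding g_def same_block_def by auto
      show "y (e (CARD('n + 1) - 1)) = 1" using e(2) y(1) unfolding g_def by simp
    qed (use t t1 y in auto)
    then show ?thesis using t(1) by blast
  qed
  then show ?thesis by (intro exI[of _ "11 * K0 ^ g * M ^ (2 * g)"]) (auto simp del: of_nat_power)
qed

theorem theorem2p11:
  fixes g :: nat
  assumes "g \<ge> 2" and "CARD('n::finite) + 1 = g"
  shows "\<exists>C::real. \<forall>k::nat. k > 0 \<longrightarrow>
    (\<exists>B. finite B \<and> (FM k :: ('n formal_series) set) \<subseteq> fj.span B) \<and>
    real (fj.dim (FM k :: ('n formal_series) set)) \<le> C * real k ^ (g * (g + 1) div 2)"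
proof -
  have card: "CARD('n + 1) = g" using assms(2) by simp
  define P where "P = g * (g + 1) div 2"
  obtain C :: nat where C: "\<And>k f. k > 0 \<Longrightarrow> f \<in> (FM k :: 'n formal_series set) \<Longrightarrow> fj_support f \<noteq> {} \<Longrightarrow>
     \<exists>t\<in>fj_support f. \<forall>b. t $ b $ b \<le> real (C * k)"
    using fj_support_small_diag[where 'n = 'n] by blast
  have "(\<exists>B. finite B \<and> (FM k :: ('n formal_series) set) \<subseteq> fj.span B) \<and>
    real (fj.dim (FM k :: ('n formal_series) set)) \<le> real ((4 * C + 1) ^ P) * real k ^ P" if k: "k > 0" for k
  proof -
    define S where "S = {t :: real^('n + 1)^('n + 1). half_integral t \<and> pos_semidef t \<and> (\<forall>a. t $ a $ a \<le> real (C * k))}"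
    have S: "finite S" "card S \<le> (4 * (C * k) + 1) ^ P"
      using bounded_indices[where 'g = "'n + 1", of "C * k"] unfolding card S_def P_def .
    have main: "(\<exists>B. finite B \<and> (FM k :: ('n formal_series) set) \<subseteq> fj.span B) \<and> fj.dim (FM k :: ('n formal_series) set) \<le> card S"
    proof (rule FM_dim_le[OF S(1)])
      fix f :: "'n formal_series" assume f: "f \<in> FM k" and z: "\<And>t. t \<in> S \<Longrightarrow> fj_coeff f t = 0"
      have "fj_support f = {}"
      proof (rule ccontr)
        assume "fj_support f \<noteq> {}"
        from C[OF k f this] obtain t where "t \<in> fj_support f" "\<forall>b. t $ b $ b \<le> real (C * k)" by blast
        then show False using z[of t] by (simp add: S_def fj_support_def)
      qed
      then show "f = (\<lambda>_ _. 0)" by (rule fj_support_empty[OF f])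
    qed
    \<comment> \<open>The additive 1 is absorbed because \<open>k\<close> is at least 1.\<close>
    have "4 * (C * k) + 1 \<le> (4 * C + 1) * k" using k by (simp add: algebra_simps)
    then have "(4 * (C * k) + 1) ^ P \<le> ((4 * C + 1) * k) ^ P" by (rule power_mono) simp
    then have "fj.dim (FM k :: ('n formal_series) set) \<le> (4 * C + 1) ^ P * k ^ P"
      unfolding power_mult_distrib using main S(2) by linarith
    then have "real (fj.dim (FM k :: ('n formal_series) set)) \<le> real ((4 * C + 1) ^ P * k ^ P)"
      by (simp only: of_nat_le_iff)
    then show ?thesis using main by simp
  qed
  then show ?thesis unfolding P_def by blast
qed

end
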